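(* Let $m,n\ge 0$ be integers and let $N=r(m+1)(n+1)$. There exists an explicit representation $\pi^{m,n}$ of $\Gamma$ into $\mathrm{Uni}(N,\mathbf C)$, the space of $N\times N$ unipotent matrices, such that for all $\gamma\in\Gamma$ and $\mathrm{Re}(s)>1$, we have $$\mathbb E^{m,n}(\gamma z,s)=\pi^{m,n}(\gamma)\,\mathbb E^{m,n}(z,s).$$ Furthermore, $$\Delta\,\mathbb E^{m,n}(z,s)=s(1-s)\,\mathbb E^{m,n}(z,s),$$ where $\Delta$ denotes the usual hyperbolic Laplacian $-4y^2\frac{d}{dz}\frac{d}{d\bar z}$ (with $z=x+iy\in\mathbf H$).
   Context: $\mathbf H$ is the upper half-plane and $\Gamma$ is a Fuchsian group of the first kind acting on $\mathbf H$ such that $\Gamma\backslash\mathbf H$ has finite volume and is non-compact. Representatives $\mathfrak a,\mathfrak b,\dots$ of the $r$ $\Gamma$-inequivalent cusps are fixed; $\Gamma_{\mathfrak a}$ is the stabilizer of $\mathfrak a$ in $\Gamma$, and $\sigma_{\mathfrak a}\in \mathrm{SL}_2(\mathbf R)$ is a scaling matrix: $\sigma_{\mathfrak a}\infty=\mathfrak a$ and $\sigma_{\mathfrak a}^{-1}\Gamma_{\mathfrak a}\sigma_{\mathfrak a}$ is generated (modulo $\pm I$) by $\begin{pmatrix}1&1\\0&1\end{pmatrix}$. $S_2(\Gamma)$ is the space of holomorphic weight 2 cusp forms for $\Gamma$; $f,g\in S_2(\Gamma)$ are fixed. $\chi$ is a fixed character of $\Gamma$ with $|\chi|=1$ and $\chi(\gamma)=1$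 for $\gamma\in\Gamma_{\mathfrak a}$, for every cusp $\mathfrak a$. Modular symbols: $\langle\gamma,f\rangle=\int_{z_0}^{\gamma z_0}f(w)\,dw$ (independent of $z_0\in\mathbf H$), similarly $\langle\gamma,g\rangle$. For integers $m,n\ge0$, $$E_{\mathfrak a}^{m,n}(z,s)=\sum_{\gamma\in\Gamma_{\mathfrak a}\backslash\Gamma}\chi(\gamma)\langle\gamma,f\rangle^m\,\overline{\langle\gamma,g\rangle}^{\,n}\,\mathrm{Im}(\sigma_{\mathfrak a}^{-1}\gamma z)^s ,$$ which converges absolutely for $\mathrm{Re}(s)>1$, $z\in\mathbf H$ (with $0^0=1$). $\mathcal E^{m,n}=(E^{m,n}_{\mathfrak a})_{\mathfrak a}$ is the $r\times1$ column vector indexed by the inequivalent cusps. $\mathcal I_{m,n}$ is the set of pairs $(i_1,i_2)$ with $0\le i_1\le m$, $0\le i_2\le n$, ordered lexicographically. $\mathbb E^{m,n}$ is the $N\times1$ column vector obtained by stacking the vectors $\mathcal E^{m-i_1,n-i_2}$ for $(i_1,i_2)\in\mathcal I_{m,n}$ in increasing order (so the top block is $\mathcal E^{m,n}$ and the bottom block is $\mathcal E^{0,0}$).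
   Formalization: For a nontrivial character χ no such unipotent representation exists (already for m=n=0, E(γz,s)=χ(γ)⁻¹E(z,s)); the formal theorem instead has π a representation into GL(N,C) with χ(γ)π(γ) unipotent, which for χ=1 is the stated claim. *)

theory Defs
  imports
    "HOL-Complex_Analysis.Complex_Analysis"
    "HOL-Algebra.Coset"
    "Jordan_Normal_Form.Matrix"
begin

no_notation vec_index (infixl \<open>$\<close> 100)
no_notation fps_nth (infixl \<open>$\<close> 75)

section \<open>\<open>SL\<^sub>2(\<real>)\<close> and its action\<close>

definition SL2R :: "(real^2^2) monoid" where
  "SL2R = \<lparr>carrier = {A. det A = 1}, mult = (**), one = Finite_Cartesian_Product.mat 1\<rparr>"

lemma group_SL2R: "group SL2R"
proof (rule groupI)
  fix A assume A: "A \<in> carrier SL2R"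
  then have "invertible A"
    by (simp add: SL2R_def invertible_det_nz)
  then obtain B where "A ** B = Finite_Cartesian_Product.mat 1"
    and B: "B ** A = Finite_Cartesian_Product.mat 1"
    unfolding invertible_def by blast
  have "det B * det A = 1"
    using B by (metis det_I det_mul)
  then show "\<exists>B\<in>carrier SL2R. B \<otimes>\<^bsub>SL2R\<^esub> A = \<one>\<^bsub>SL2R\<^esub>"
    using A B by (intro bexI[of _ B]) (auto simp: SL2R_def)
qed (auto simp: SL2R_def det_mul matrix_mul_assoc)

definition upper_half :: "complex set" where
  "upper_half = {z. Im z > 0}"

definition cocycle :: "real^2^2 \<Rightarrow> complex \<Rightarrow> complex" where
  "cocycle A z = of_real (A$2$1) * z + of_real (A$2$2)"

definition moebius_act :: "real^2^2 \<Rightarrow> complex \<Rightarrow> complex" where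
  "moebius_act A z =
     moebius (of_real (A$1$1)) (of_real (A$1$2)) (of_real (A$2$1)) (of_real (A$2$2)) z"

lemma Im_moebius:
  assumes "det A = 1"
  shows "Im (moebius_act A z) = Im z / (cmod (cocycle A z))\<^sup>2"
proof -
  have d: "A$1$1 * A$2$2 - A$1$2 * A$2$1 = 1"
    using assms by (simp add: det_2)
  have "Im ((of_real (A$1$1) * z + of_real (A$1$2)) * cnj (cocycle A z))
      = (A$1$1 * A$2$2 - A$1$2 * A$2$1) * Im z"
    by (simp add: cocycle_def algebra_simps)
  then show ?thesis
    using d unfolding moebius_act_def moebius_def cocycle_def[symmetric]
    by (subst complex_div_cnj) (simp only: Im_divide_of_real mult_1_left)
qed

lemma cocycle_nonzero:
  assumes "det A = 1" "z \<in> upper_half"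
  shows "cocycle A z \<noteq> 0"
proof
  assume "cocycle A z = 0"
  then have *: "A$2$1 * Im z = 0" "A$2$1 * Re z + A$2$2 = 0"
    by (simp_all add: cocycle_def complex_eq_iff)
  then show False
    using assms by (auto simp: det_2 upper_half_def)
qed

lemma moebius_upper_half:
  "det A = 1 \<Longrightarrow> z \<in> upper_half \<Longrightarrow> moebius_act A z \<in> upper_half"
  using cocycle_nonzero[of A z] by (simp add: Im_moebius upper_half_def)

text \<open>The Riemann sphere, on which all of \<open>SL\<^sub>2(\<real>)\<close> acts; cusps are points of its real circle.\<close>

datatype csphere = Pt complex | Infty

fun moebius_ext :: "real^2^2 \<Rightarrow> csphere \<Rightarrow> csphere" where
  "moebius_ext A Infty =
     (if A$2$1 = 0 then Infty else Pt (of_real (A$1$1 / A$2$1)))"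
| "moebius_ext A (Pt z) =
     (if cocycle A z = 0 then Infty else Pt (moebius_act A z))"

definition real_proj_line :: "csphere set" where
  "real_proj_line = insert Infty (range (\<lambda>x::real. Pt (of_real x)))"

definition parabolic :: "real^2^2 \<Rightarrow> bool" where
  "parabolic A \<longleftrightarrow> det A = 1 \<and> \<bar>trace A\<bar> = 2
     \<and> A \<noteq> Finite_Cartesian_Product.mat 1 \<and> A \<noteq> - Finite_Cartesian_Product.mat 1"

definition stabilizer :: "(real^2^2) set \<Rightarrow> csphere \<Rightarrow> (real^2^2) set" where
  "stabilizer \<Gamma> x = {\<gamma> \<in> \<Gamma>. moebius_ext \<gamma> x = x}"

definition cusps :: "(real^2^2) set \<Rightarrow> csphere set" where
  "cusps \<Gamma> = {x \<in> real_proj_line. \<exists>\<gamma>\<in>\<Gamma>. parabolic \<gamma> \<and> moebius_ext \<gamma> x = x}"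


section \<open>Fuchsian groups of the first kind\<close>

definition quotient_topology :: "'a topology \<Rightarrow> ('a \<Rightarrow> 'b) \<Rightarrow> 'b topology" where
  "quotient_topology X q =
     topology (\<lambda>V. V \<subseteq> q ` topspace X \<and> openin X {x \<in> topspace X. q x \<in> V})"

lemma openin_quotient_topology:
  "openin (quotient_topology X q) V \<longleftrightarrow>
     V \<subseteq> q ` topspace X \<and> openin X {x \<in> topspace X. q x \<in> V}"
proof -
  have "istopology (\<lambda>V. V \<subseteq> q ` topspace X \<and> openin X {x \<in> topspace X. q x \<in> V})"
    unfolding istopology_def
  proof (intro conjI allI impI; (elim conjE)?)
    fix S T
    assume "openin X {x \<in> topspace X. q x \<in> S}" "openin X {x \<in> topspace X. q x \<in> T}"
    then have "openin X ({x \<in> topspace X. q x \<in> S} \<inter> {x \<in> topspace X. q x \<in> T})"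
      by blast
    also have "\<dots> = {x \<in> topspace X. q x \<in> S \<inter> T}" by blast
    finally show "openin X {x \<in> topspace X. q x \<in> S \<inter> T}" .
  next
    fix K assume K: "\<forall>V\<in>K. V \<subseteq> q ` topspace X \<and> openin X {x \<in> topspace X. q x \<in> V}"
    then have "openin X (\<Union>V\<in>K. {x \<in> topspace X. q x \<in> V})" by blast
    also have "\<dots> = {x \<in> topspace X. q x \<in> \<Union>K}" by blast
    finally show "openin X {x \<in> topspace X. q x \<in> \<Union>K}" .
  qed blast+
  then show ?thesis
    by (simp add: quotient_topology_def)
qed

definition group_orbit :: "'g set \<Rightarrow> ('g \<Rightarrow> 'a \<Rightarrow> 'a) \<Rightarrow> 'a \<Rightarrow> 'a set" where
  "group_orbit \<Gamma> act x = (\<lambda>\<gamma>. act \<gamma> x) ` \<Gamma>"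

definition extended_half_plane :: "(real^2^2) set \<Rightarrow> csphere set" where
  "extended_half_plane \<Gamma> = Pt ` upper_half \<union> cusps \<Gamma>"

text \<open>The topology of \<open>\<H>\<^sup>* = \<H> \<union> {cusps}\<close>: the usual one on \<open>\<H>\<close>, and the horoballs
  \<open>\<sigma> {Im z > Y}\<close> together with \<open>\<sigma>\<infinity>\<close> as neighbourhoods of a cusp \<open>\<sigma>\<infinity>\<close>.\<close>

definition horocycle_topology :: "(real^2^2) set \<Rightarrow> csphere topology" where
  "horocycle_topology \<Gamma> = topology (\<lambda>U. U \<subseteq> extended_half_plane \<Gamma>
     \<and> open {z \<in> upper_half. Pt z \<in> U}
     \<and> (\<forall>\<sigma>\<in>carrier SL2R. moebius_ext \<sigma> Infty \<in> U \<longrightarrow>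
          (\<exists>Y>0. \<forall>z. Im z > Y \<longrightarrow> Pt (moebius_act \<sigma> z) \<in> U)))"

lemma openin_horocycle_topology:
  "openin (horocycle_topology \<Gamma>) U \<longleftrightarrow> U \<subseteq> extended_half_plane \<Gamma>
     \<and> open {z \<in> upper_half. Pt z \<in> U}
     \<and> (\<forall>\<sigma>\<in>carrier SL2R. moebius_ext \<sigma> Infty \<in> U \<longrightarrow>
          (\<exists>Y>0. \<forall>z. Im z > Y \<longrightarrow> Pt (moebius_act \<sigma> z) \<in> U))"
proof -
  have "istopology (\<lambda>U. U \<subseteq> extended_half_plane \<Gamma>
     \<and> open {z \<in> upper_half. Pt z \<in> U}
     \<and> (\<forall>\<sigma>\<in>carrier SL2R. moebius_ext \<sigma> Infty \<in> U \<longrightarrow>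
          (\<exists>Y>0. \<forall>z. Im z > Y \<longrightarrow> Pt (moebius_act \<sigma> z) \<in> U)))"
    (is "istopology (\<lambda>U. ?A U \<and> ?B U \<and> ?C U)")
    unfolding istopology_def
  proof (intro conjI allI impI; (elim conjE)?)
    fix S T assume B: "?B S" "?B T" and C: "?C S" "?C T"
    have "{z \<in> upper_half. Pt z \<in> S \<inter> T} =
        {z \<in> upper_half. Pt z \<in> S} \<inter> {z \<in> upper_half. Pt z \<in> T}" by blast
    then show "?B (S \<inter> T)" using B by (simp add: open_Int)
    show "?C (S \<inter> T)"
    proof (intro ballI impI)
      fix \<sigma> assume "\<sigma> \<in> carrier SL2R" "moebius_ext \<sigma> Infty \<in> S \<inter> T"
      then obtain Y1 Y2 where "Y1 > 0" "\<forall>z. Im z > Y1 \<longrightarrow> Pt (moebius_act \<sigma> z) \<in> S"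
        "Y2 > 0" "\<forall>z. Im z > Y2 \<longrightarrow> Pt (moebius_act \<sigma> z) \<in> T"
        using C by (metis IntE)
      then show "\<exists>Y>0. \<forall>z. Im z > Y \<longrightarrow> Pt (moebius_act \<sigma> z) \<in> S \<inter> T"
        by (intro exI[of _ "max Y1 Y2"]) auto
    qed
  next
    fix K assume K: "\<forall>U\<in>K. ?A U \<and> ?B U \<and> ?C U"
    have "{z \<in> upper_half. Pt z \<in> \<Union>K} = (\<Union>U\<in>K. {z \<in> upper_half. Pt z \<in> U})" by blast
    then show "?B (\<Union>K)" using K by (simp add: open_UN)
    show "?C (\<Union>K)"
    proof (intro ballI impI)
      fix \<sigma> assume \<sigma>: "\<sigma> \<in> carrier SL2R" "moebius_ext \<sigma> Infty \<in> \<Union>K"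
      then obtain U where U: "U \<in> K" "moebius_ext \<sigma> Infty \<in> U" by blast
      then obtain Y where "Y > 0" "\<forall>z. Im z > Y \<longrightarrow> Pt (moebius_act \<sigma> z) \<in> U"
        using K \<sigma>(1) by blast
      then show "\<exists>Y>0. \<forall>z. Im z > Y \<longrightarrow> Pt (moebius_act \<sigma> z) \<in> \<Union>K"
        using U(1) by blast
    qed
  qed blast+
  then show ?thesis
    by (simp add: horocycle_topology_def)
qed

text \<open>Shimura's and Miyake's definition of ``first kind'': the quotient of \<open>\<H>\<^sup>*\<close> is compact.\<close>

definition fuchsian_first_kind :: "(real^2^2) set \<Rightarrow> bool" where
  "fuchsian_first_kind \<Gamma> \<longleftrightarrow> subgroup \<Gamma> SL2R \<and> discrete \<Gamma>
     \<and> compact_space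
         (quotient_topology (horocycle_topology \<Gamma>) (group_orbit \<Gamma> moebius_ext))"

definition hyperbolic_area :: "complex measure" where
  "hyperbolic_area =
     density lborel (\<lambda>z. indicator upper_half z * ennreal (1 / (Im z)\<^sup>2))"

definition fundamental_domain :: "(real^2^2) set \<Rightarrow> complex set \<Rightarrow> bool" where
  "fundamental_domain \<Gamma> F \<longleftrightarrow> F \<in> sets borel \<and> F \<subseteq> upper_half
     \<and> (\<forall>z\<in>upper_half. \<exists>\<gamma>\<in>\<Gamma>. moebius_act \<gamma> z \<in> F)
     \<and> (\<forall>\<gamma>\<in>\<Gamma>. \<gamma> \<noteq> Finite_Cartesian_Product.mat 1 \<and> \<gamma> \<noteq> - Finite_Cartesian_Product.mat 1
          \<longrightarrow> F \<inter> moebius_act \<gamma> ` F \<in> null_sets hyperbolic_area)"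

definition finite_covolume :: "(real^2^2) set \<Rightarrow> bool" where
  "finite_covolume \<Gamma> \<longleftrightarrow>
     (\<exists>F. fundamental_domain \<Gamma> F \<and> emeasure hyperbolic_area F < \<infinity>)"

definition noncompact_quotient :: "(real^2^2) set \<Rightarrow> bool" where
  "noncompact_quotient \<Gamma> \<longleftrightarrow>
     \<not> compact_space (quotient_topology (top_of_set upper_half) (group_orbit \<Gamma> moebius_act))"

definition cusp_representatives ::
    "(real^2^2) set \<Rightarrow> nat \<Rightarrow> (nat \<Rightarrow> csphere) \<Rightarrow> bool" where
  "cusp_representatives \<Gamma> r \<aa> \<longleftrightarrow> (\<forall>i<r. \<aa> i \<in> cusps \<Gamma>)
     \<and> (\<forall>x\<in>cusps \<Gamma>. \<exists>!i. i < r \<and> (\<exists>\<gamma>\<in>\<Gamma>. moebius_ext \<gamma> (\<aa> i) = x))"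

definition translation :: "real \<Rightarrow> real^2^2" where
  "translation t = vector [vector [1, t], vector [0, 1]]"

text \<open>``Generated modulo \<open>\<plusminus>I\<close>'' means equality after adjoining signs on both sides; it is not
  assumed that \<open>-I \<in> \<Gamma>\<close>.\<close>

definition scaling_matrix :: "(real^2^2) set \<Rightarrow> csphere \<Rightarrow> real^2^2 \<Rightarrow> bool" where
  "scaling_matrix \<Gamma> a \<sigma> \<longleftrightarrow> \<sigma> \<in> carrier SL2R \<and> moebius_ext \<sigma> Infty = a
     \<and> (let S = (\<lambda>\<gamma>. inv\<^bsub>SL2R\<^esub> \<sigma> ** \<gamma> ** \<sigma>) ` stabilizer \<Gamma> a;
            T = range (\<lambda>k::int. translation (of_int k))
        in S \<union> uminus ` S = T \<union> uminus ` T)"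


section \<open>Cusp forms, modular symbols, Eisenstein series\<close>

text \<open>Vanishing at the cusp \<open>\<sigma>\<infinity>\<close> is expressed by the limit at \<open>Im z \<rightarrow> \<infinity>\<close>, uniformly in \<open>Re z\<close>,
  of the weight 2 translate of \<open>f\<close> by \<open>\<sigma>\<close>.\<close>

definition cusp_form2 :: "(real^2^2) set \<Rightarrow> (complex \<Rightarrow> complex) \<Rightarrow> bool" where
  "cusp_form2 \<Gamma> f \<longleftrightarrow> f holomorphic_on upper_half
     \<and> (\<forall>\<gamma>\<in>\<Gamma>. \<forall>z\<in>upper_half. f (moebius_act \<gamma> z) = cocycle \<gamma> z ^ 2 * f z)
     \<and> (\<forall>\<sigma>\<in>carrier SL2R. moebius_ext \<sigma> Infty \<in> cusps \<Gamma> \<longrightarrow>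
          ((\<lambda>z. f (moebius_act \<sigma> z) / cocycle \<sigma> z ^ 2) \<longlongrightarrow> 0) (filtercomap Im at_top))"

definition cuspidal_unitary_character ::
    "(real^2^2) set \<Rightarrow> (real^2^2 \<Rightarrow> complex) \<Rightarrow> bool" where
  "cuspidal_unitary_character \<Gamma> chi \<longleftrightarrow>
     (\<forall>\<gamma>\<in>\<Gamma>. \<forall>\<delta>\<in>\<Gamma>. chi (\<gamma> ** \<delta>) = chi \<gamma> * chi \<delta>) \<and> (\<forall>\<gamma>\<in>\<Gamma>. cmod (chi \<gamma>) = 1)
     \<and> (\<forall>a\<in>cusps \<Gamma>. \<forall>\<gamma>\<in>stabilizer \<Gamma> a. chi \<gamma> = 1)"

text \<open>For \<open>f\<close> in \<open>S\<^sub>2(\<Gamma>)\<close> the integral does not depend on the base point, which is taken to be \<open>\<i>\<close>.\<close>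

definition modular_symbol :: "real^2^2 \<Rightarrow> (complex \<Rightarrow> complex) \<Rightarrow> complex" where
  "modular_symbol \<gamma> f = contour_integral (linepath \<i> (moebius_act \<gamma> \<i>)) f"

text \<open>The sum runs over the right cosets \<open>\<Gamma>\<^sub>a \<gamma>\<close>. Its terms depend on the coset only, so the choice
  of a representative is immaterial.\<close>

definition eisenstein ::
    "(real^2^2) set \<Rightarrow> (real^2^2 \<Rightarrow> complex) \<Rightarrow> (complex \<Rightarrow> complex) \<Rightarrow> (complex \<Rightarrow> complex) \<Rightarrow>
     csphere \<Rightarrow> real^2^2 \<Rightarrow> nat \<Rightarrow> nat \<Rightarrow> complex \<Rightarrow> complex \<Rightarrow> complex" where
  "eisenstein \<Gamma> chi f g a \<sigma> m n z s =
     (\<Sum>\<^sub>\<infinity>C \<in> rcosets\<^bsub>SL2R\<lparr>carrier := \<Gamma>\<rparr>\<^esub> (stabilizer \<Gamma> a).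
        let \<gamma> = (SOME \<gamma>. \<gamma> \<in> C)
        in chi \<gamma> * modular_symbol \<gamma> f ^ m * cnj (modular_symbol \<gamma> g) ^ n
           * of_real (Im (moebius_act (inv\<^bsub>SL2R\<^esub> \<sigma>) (moebius_act \<gamma> z))) powr s)"

text \<open>The list comprehension enumerates the pairs \<open>(i\<^sub>1, i\<^sub>2)\<close> in lexicographic order, and the
  cusps within each block.\<close>

definition eisenstein_vec ::
    "(real^2^2) set \<Rightarrow> (real^2^2 \<Rightarrow> complex) \<Rightarrow> (complex \<Rightarrow> complex) \<Rightarrow> (complex \<Rightarrow> complex) \<Rightarrow>
     nat \<Rightarrow> (nat \<Rightarrow> csphere) \<Rightarrow> (nat \<Rightarrow> real^2^2) \<Rightarrow> nat \<Rightarrow> nat \<Rightarrow> complex \<Rightarrow> complex \<Rightarrow>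
     complex Matrix.vec" where
  "eisenstein_vec \<Gamma> chi f g r \<aa> \<sigma> m n z s =
     vec_of_list [eisenstein \<Gamma> chi f g (\<aa> j) (\<sigma> j) (m - i1) (n - i2) z s.
                  i1 \<leftarrow> [0..<m+1], i2 \<leftarrow> [0..<n+1], j \<leftarrow> [0..<r]]"

lemma dim_eisenstein_vec:
  "dim_vec (eisenstein_vec \<Gamma> chi f g r \<aa> \<sigma> m n z s) = r * (m+1) * (n+1)"
  by (simp add: eisenstein_vec_def length_concat comp_def sum_list_triv algebra_simps del: upt_Suc)


section \<open>The Laplacian and unipotent matrices\<close>

definition d_dz :: "(complex \<Rightarrow> complex) \<Rightarrow> complex \<Rightarrow> complex" where
  "d_dz h z = (frechet_derivative h (at z) 1 - \<i> * frechet_derivative h (at z) \<i>) / 2"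

definition d_dzbar :: "(complex \<Rightarrow> complex) \<Rightarrow> complex \<Rightarrow> complex" where
  "d_dzbar h z = (frechet_derivative h (at z) 1 + \<i> * frechet_derivative h (at z) \<i>) / 2"

definition hyp_laplacian :: "(complex \<Rightarrow> complex) \<Rightarrow> complex \<Rightarrow> complex" where
  "hyp_laplacian h z = - 4 * of_real ((Im z)\<^sup>2) * d_dz (d_dzbar h) z"

text \<open>Enough regularity for the derivatives in \<^const>\<open>hyp_laplacian\<close> to exist throughout \<open>\<H>\<close>.\<close>

definition laplacian_defined :: "(complex \<Rightarrow> complex) \<Rightarrow> bool" where
  "laplacian_defined h \<longleftrightarrow> h differentiable_on upper_half \<and> d_dzbar h differentiable_on upper_half"

text \<open>Substituting \<open>\<delta> \<mapsto> \<delta> \<gamma>\<^sup>-\<^sup>1\<close> in the defining series gives \<open>E\<^sup>0\<^sup>,\<^sup>0(\<gamma> z, s) = chi(\<gamma>)\<^sup>-\<^sup>1 E\<^sup>0\<^sup>,\<^sup>0(z, s)\<close>,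
  so any \<open>\<pi>(\<gamma>)\<close> that transforms the Eisenstein vectors has the eigenvalue \<open>chi(\<gamma>)\<^sup>-\<^sup>1\<close>. For a
  nontrivial character it is therefore \<open>chi(\<gamma>) \<pi>(\<gamma>)\<close>, and not \<open>\<pi>(\<gamma>)\<close> itself, that can be
  unipotent; for the trivial character the two coincide.\<close>

definition Uni :: "nat \<Rightarrow> complex Matrix.mat set" where
  "Uni N = {A \<in> carrier_mat N N. \<exists>k. (A - 1\<^sub>m N) ^\<^sub>m k = 0\<^sub>m N N}"

text \<open>Homomorphisms from \<open>\<Gamma>\<close> to \<open>GL(N, \<complex>)\<close>.\<close>

definition gl_representation :: "(real^2^2) set \<Rightarrow> nat \<Rightarrow> (real^2^2 \<Rightarrow> complex Matrix.mat) \<Rightarrow> bool" where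
  "gl_representation \<Gamma> N \<pi> \<longleftrightarrow>
     \<pi> \<in> hom (SL2R\<lparr>carrier := \<Gamma>\<rparr>) (units_of (ring_mat TYPE(complex) N ()))"

end

theory Submission
  imports Defs
begin

text \<open>Write \<open>\<langle>\<gamma>, f\<rangle> = F (\<gamma> z) - F z\<close> for a primitive \<open>F\<close> of \<open>f\<close>. This is additive in \<open>\<gamma>\<close> and vanishes on
  the stabilizers of cusps, so replacing \<open>\<delta>\<close> by \<open>\<delta> \<gamma>\<^sup>-\<^sup>1\<close> in the Eisenstein series and expanding
  binomially gives the transformation law, with matrices that are block upper triangular up to the
  factor \<open>chi(\<gamma>)\<^sup>-\<^sup>1\<close>.

  The analytic part is absolute convergence for \<open>Re s > 1\<close>. Compactness of \<open>\<Gamma> \ \<H>\<^sup>*\<close> bounds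
  \<open>Im z * \<bar>f z\<bar>\<close>, hence \<open>\<langle>\<gamma>, f\<rangle>\<close> grows at most logarithmically in the length of the bottom row
  \<open>(c, d)\<close> of \<open>\<sigma>\<^sup>-\<^sup>1 \<gamma>\<close>. By Shimizu's lemma, bottom rows of different cosets satisfy
  \<open>\<bar>c d' - d c'\<bar> \<ge> 1\<close>, so that there are \<open>O(R\<^sup>2)\<close> of them of length at most \<open>R\<close>. Each term is an
  eigenfunction of the Laplacian, and its derivatives are dominated locally uniformly by the term
  itself, so the series may be differentiated termwise.\<close>

section \<open>Real unimodular matrices\<close>

text \<open>Cuspidality is given only as convergence of the weight 2 translates to 0, without
  Fourier expansions, while the bound on Im z * |f z| needs decay faster than 1 / Im z. A primitive
  recovers it: smallness at the cusp makes the primitive periodic, so the translate has mean zero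
  over a period, and by Cauchy's estimate its oscillation over a period is o(1 / Im z). The second
  differentiation costs no new estimate of the terms. With j = c z + d the derivative of Im(A z)^s
  in the conjugate variable is (i s / (2 Im z)) Im(A z)^s (j / cnj j). The last factor has modulus
  1, so the series to be differentiated again has the same absolute values as the original one. The
  coefficients of the binomial expansion are the same at every cusp. Hence the matrices are scalars
  chi(\<gamma>)^-1 times a Kronecker product of two binomial matrices with the identity on the
  cusps. A binomial matrix is a one-parameter group in its argument, so additivity of the symbols
  turns into multiplicativity of the matrices. As -I may be absent from \<Gamma>, stabilizers are
  controlled only up to sign; the signs cancel in the action on the half-plane.\<close>

lemma SL2R_mult [simp]: "A \<otimes>\<^bsub>SL2R\<^esub> B = A ** B"
  and SL2R_one [simp]: "\<one>\<^bsub>SL2R\<^esub> = Finite_Cartesian_Product.mat 1"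
  and SL2R_carrier [simp]: "A \<in> carrier SL2R \<longleftrightarrow> det A = 1"
  by (simp_all add: SL2R_def)

lemma matrix_mult_2:
  fixes A B :: "real^2^2"
  shows "(A ** B)$i$j = A$i$1 * B$1$j + A$i$2 * B$2$j"
  by (simp add: matrix_matrix_mult_def sum_2)

lemma matrix_eq_2:
  fixes A B :: "real^2^2"
  shows "A = B \<longleftrightarrow> A$1$1 = B$1$1 \<and> A$1$2 = B$1$2 \<and> A$2$1 = B$2$1 \<and> A$2$2 = B$2$2"
  by (auto simp: Finite_Cartesian_Product.vec_eq_iff forall_2)

lemma mat_one_2 [simp]:
  "(Finite_Cartesian_Product.mat 1 :: real^2^2)$1$1 = 1"
  "(Finite_Cartesian_Product.mat 1 :: real^2^2)$1$2 = 0"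
  "(Finite_Cartesian_Product.mat 1 :: real^2^2)$2$1 = 0"
  "(Finite_Cartesian_Product.mat 1 :: real^2^2)$2$2 = 1"
  by (simp_all add: Finite_Cartesian_Product.mat_def)

abbreviation SL_inv :: "real^2^2 \<Rightarrow> real^2^2" where
  "SL_inv A \<equiv> inv\<^bsub>SL2R\<^esub> A"

lemma det_SL_inv [simp]: "det A = 1 \<Longrightarrow> det (SL_inv A) = 1"
  using group.inv_closed[OF group_SL2R, of A] by simp

lemma SL_inv_left [simp]: "det A = 1 \<Longrightarrow> SL_inv A ** A = Finite_Cartesian_Product.mat 1"
  using group.l_inv[OF group_SL2R, of A] by simp

lemma SL_inv_right [simp]: "det A = 1 \<Longrightarrow> A ** SL_inv A = Finite_Cartesian_Product.mat 1"
  using group.r_inv[OF group_SL2R, of A] by simp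

lemma SL_inv_cancel [simp]:
  assumes "det A = 1"
  shows "SL_inv A ** (A ** B) = B" "A ** (SL_inv A ** B) = B"
    "B ** A ** SL_inv A = B" "B ** SL_inv A ** A = B"
proof -
  show "SL_inv A ** (A ** B) = B" "A ** (SL_inv A ** B) = B"
    using assms by (simp_all add: matrix_mul_assoc)
  show "B ** A ** SL_inv A = B" "B ** SL_inv A ** A = B"
    using assms by (simp_all flip: matrix_mul_assoc)
qed

lemma SL_inv_entries:
  assumes "det A = 1"
  shows "SL_inv A $1$1 = A$2$2" "SL_inv A $1$2 = - A$1$2"
    "SL_inv A $2$1 = - A$2$1" "SL_inv A $2$2 = A$1$1"
proof -
  define B :: "real^2^2" where "B = vector [vector [A$2$2, - A$1$2], vector [- A$2$1, A$1$1]]"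
  have B: "B ** A = Finite_Cartesian_Product.mat 1" "det B = 1"
    using assms by (auto simp: matrix_eq_2 matrix_mult_2 B_def det_2 algebra_simps)
  then have "SL_inv A = B"
    using assms by (metis SL_inv_cancel(3) matrix_mul_lid)
  then show "SL_inv A $1$1 = A$2$2" "SL_inv A $1$2 = - A$1$2"
    "SL_inv A $2$1 = - A$2$1" "SL_inv A $2$2 = A$1$1"
    by (simp_all add: B_def)
qed

lemma moebius_act_eq:
  "moebius_act A z = (of_real (A$1$1) * z + of_real (A$1$2)) / cocycle A z"
  by (simp add: moebius_act_def moebius_def cocycle_def)

lemma moebius_act_one [simp]: "moebius_act (Finite_Cartesian_Product.mat 1) z = z"
  by (simp add: moebius_act_eq cocycle_def)

lemma cocycle_mult':
  assumes "cocycle B z \<noteq> 0"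
  shows "cocycle (A ** B) z = cocycle A (moebius_act B z) * cocycle B z"
  using assms by (simp add: cocycle_def moebius_act_eq matrix_mult_2 field_simps)

lemma moebius_act_mult':
  assumes "cocycle B z \<noteq> 0"
  shows "moebius_act (A ** B) z = moebius_act A (moebius_act B z)"
proof -
  have "of_real ((A ** B)$1$1) * z + of_real ((A ** B)$1$2) =
      (of_real (A$1$1) * moebius_act B z + of_real (A$1$2)) * cocycle B z"
    using assms by (simp add: moebius_act_eq matrix_mult_2 field_simps) (simp add: cocycle_def algebra_simps)
  then show ?thesis
    using assms by (simp add: moebius_act_eq[of "A ** B"] moebius_act_eq[of A] cocycle_mult')
qed

lemma cocycle_mult:
  "det B = 1 \<Longrightarrow> z \<in> upper_half \<Longrightarrow> cocycle (A ** B) z = cocycle A (moebius_act B z) * cocycle B z"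
  by (simp add: cocycle_mult' cocycle_nonzero)

lemma moebius_act_mult:
  "det B = 1 \<Longrightarrow> z \<in> upper_half \<Longrightarrow> moebius_act (A ** B) z = moebius_act A (moebius_act B z)"
  by (simp add: moebius_act_mult' cocycle_nonzero)

lemma moebius_act_has_field_derivative:
  assumes "det A = 1" "z \<in> upper_half"
  shows "(moebius_act A has_field_derivative 1 / (cocycle A z)\<^sup>2) (at z)"
proof -
  have d: "of_real (A$1$1) * of_real (A$2$2) - of_real (A$1$2) * of_real (A$2$1) = (1::complex)"
    using assms(1) by (simp add: det_2 flip: of_real_mult of_real_diff)
  have nz: "of_real (A$2$1) * z + of_real (A$2$2) \<noteq> 0"
    using cocycle_nonzero[OF assms] by (simp add: cocycle_def)
  have "((\<lambda>z. (of_real (A$1$1) * z + of_real (A$1$2)) / (of_real (A$2$1) * z + of_real (A$2$2)))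
      has_field_derivative 1 / (cocycle A z)\<^sup>2) (at z)"
    apply (rule derivative_eq_intros refl nz)+
    using d by (simp add: cocycle_def power2_eq_square algebra_simps)
  moreover have "moebius_act A = (\<lambda>z. (of_real (A$1$1) * z + of_real (A$1$2)) / (of_real (A$2$1) * z + of_real (A$2$2)))"
    by (rule ext) (simp add: moebius_act_eq cocycle_def)
  ultimately show ?thesis
    by simp
qed

lemma moebius_ext_mult:
  assumes "det A = 1" "det B = 1"
  shows "moebius_ext (A ** B) x = moebius_ext A (moebius_ext B x)"
proof (cases x)
  case Infty
  show ?thesis
  proof (cases "B$2$1 = 0")
    case True
    then have "B$1$1 \<noteq> 0" using assms by (auto simp: det_2)
    with True show ?thesis by (simp add: Infty matrix_mult_2)
  next
    case False
    then show ?thesis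
      by (auto simp: Infty matrix_mult_2 cocycle_def moebius_act_eq divide_simps
          simp flip: of_real_mult of_real_add of_real_divide)
  qed
next
  case (Pt z)
  show ?thesis
  proof (cases "cocycle B z = 0")
    case False
    then show ?thesis
      by (simp add: Pt cocycle_mult' moebius_act_mult')
  next
    case True
    then have nz: "B$2$1 \<noteq> 0"
      using assms by (auto simp: cocycle_def det_2)
    then have z: "z = of_real (- B$2$2 / B$2$1)"
      using True by (simp add: cocycle_def field_simps eq_neg_iff_add_eq_0)
    have d: "B$1$1 * B$2$2 - B$1$2 * B$2$1 = 1"
      using assms by (simp add: det_2)
    \<comment> \<open>At the pole -B21^-1 B22 of B, row i of the product collapses to -A_i1 / B21
      because det B = 1. The quotient of the two rows is then the value of A at infinity.\<close>
    have e: "of_real ((A**B)$i$1) * z + of_real ((A**B)$i$2) = of_real (- A$i$1 / B$2$1)" for i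
    proof -
      have "(A**B)$i$1 * (- B$2$2 / B$2$1) + (A**B)$i$2 = - A$i$1 * (B$1$1 * B$2$2 - B$1$2 * B$2$1) / B$2$1"
        using nz by (simp add: matrix_mult_2 field_simps)
      then show ?thesis
        unfolding z d of_real_mult[symmetric] of_real_add[symmetric] by simp
    qed
    have c: "cocycle (A ** B) z = of_real (- A$2$1 / B$2$1)"
      unfolding cocycle_def by (rule e)
    show ?thesis
      using True nz unfolding Pt moebius_ext.simps moebius_act_eq e c by (simp)
  qed
qed

lemma moebius_ext_one [simp]: "moebius_ext (Finite_Cartesian_Product.mat 1) x = x"
  by (cases x) (auto simp: cocycle_def)

lemma moebius_ext_upper:
  assumes "det A = 1" "z \<in> upper_half" shows "moebius_ext A (Pt z) = Pt (moebius_act A z)"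
  using cocycle_nonzero[OF assms] by simp

lemma moebius_ext_inv:
  "det A = 1 \<Longrightarrow> moebius_ext (SL_inv A) (moebius_ext A x) = x"
  by (simp flip: moebius_ext_mult)

lemma open_upper_half [simp]: "open upper_half"
  using open_halfspace_Im_gt[of 0] by (simp add: upper_half_def)

lemma convex_upper_half [simp]: "convex upper_half"
  using convex_halfspace_Im_gt[of 0] by (simp add: upper_half_def)

lemma moebius_ext_Infty_not_upper: "moebius_ext A Infty \<noteq> Pt z" if "z \<in> upper_half"
  using that by (auto simp: upper_half_def)

section \<open>Periodic functions on the upper half-plane\<close>

lemma upper_half_primitive:
  assumes "f holomorphic_on upper_half"
  obtains F where "\<And>z. z \<in> upper_half \<Longrightarrow> (F has_field_derivative f z) (at z)"
  using holomorphic_convex_primitive'[OF convex_upper_half open_upper_half assms]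
  by (metis at_within_open open_upper_half)

lemma upper_half_constant:
  assumes "\<And>z. z \<in> upper_half \<Longrightarrow> (F has_field_derivative 0) (at z)"
    and "z \<in> upper_half" "w \<in> upper_half"
  shows "F z = F w"
proof -
  obtain c where "\<And>z. z \<in> upper_half \<Longrightarrow> F z = c"
    using has_field_derivative_zero_constant[OF convex_upper_half, of F] assms(1)
    by (metis at_within_open open_upper_half)
  then show ?thesis using assms by simp
qed

lemma upper_half_add_real [simp]: "z + of_real h \<in> upper_half \<longleftrightarrow> z \<in> upper_half"
  by (simp add: upper_half_def)

lemma filtercomap_Im_at_top:
  "eventually P (filtercomap Im at_top) \<longleftrightarrow> (\<exists>Y>0. \<forall>z. Im z > Y \<longrightarrow> P z)"
proof
  assume "eventually P (filtercomap Im at_top)"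
  then obtain Q where Q: "eventually Q at_top" "\<And>z. Q (Im z) \<Longrightarrow> P z"
    by (auto simp: eventually_filtercomap)
  then obtain Y where "\<And>y. y > Y \<Longrightarrow> Q y"
    by (auto simp: eventually_at_top_dense)
  then show "\<exists>Y>0. \<forall>z. Im z > Y \<longrightarrow> P z"
    using Q(2) by (intro exI[of _ "max Y 1"]) auto
next
  assume "\<exists>Y>0. \<forall>z. Im z > Y \<longrightarrow> P z"
  then obtain Y where "\<And>z. Im z > Y \<Longrightarrow> P z" by blast
  then show "eventually P (filtercomap Im at_top)"
    unfolding eventually_filtercomap
    by (intro exI[of _ "\<lambda>y. y > Y"] conjI eventually_gt_at_top) auto
qed

text \<open>Meant for the weight 2 translate of a cusp form at one cusp, together with its
  primitive. The period is read off from some matrix fixing the cusp, so neither its size nor its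
  sign is normalized.\<close>

locale periodic_cuspidal =
  fixes \<phi> \<Phi> :: "complex \<Rightarrow> complex" and h :: real
  assumes h: "h \<noteq> 0"
    and primitive: "z \<in> upper_half \<Longrightarrow> (\<Phi> has_field_derivative \<phi> z) (at z)"
    and periodic: "z \<in> upper_half \<Longrightarrow> \<phi> (z + of_real h) = \<phi> z"
    and tendsto: "(\<phi> \<longlongrightarrow> 0) (filtercomap Im at_top)"
begin

lemma small:
  assumes "\<epsilon> > 0"
  obtains Y where "Y > 0" "\<And>z. Im z > Y \<Longrightarrow> cmod (\<phi> z) \<le> \<epsilon>"
proof -
  have "eventually (\<lambda>z. dist (\<phi> z) 0 < \<epsilon>) (filtercomap Im at_top)"
    using tendsto assms by (rule tendstoD)
  then show ?thesis
    using that by (force simp: filtercomap_Im_at_top)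
qed

lemma closed_segment_real: "x \<in> closed_segment z (z + of_real h) \<Longrightarrow> Im x = Im z"
  by (auto simp: closed_segment_def algebra_simps)

lemma holomorphic: "\<phi> holomorphic_on upper_half"
proof -
  have "\<Phi> holomorphic_on upper_half"
    using primitive by (auto simp: holomorphic_on_open)
  then have "deriv \<Phi> holomorphic_on upper_half"
    by (rule holomorphic_deriv) simp
  then show ?thesis
    by (rule holomorphic_transform) (simp add: primitive DERIV_imp_deriv)
qed

text \<open>The increment of \<Phi> over a period is constant on the half-plane, and high up it is
  at most |h| times the small values of \<phi>. This plays the part of a vanishing constant Fourier
  coefficient.\<close>

lemma primitive_periodic:
  assumes "z \<in> upper_half"
  shows "\<Phi> (z + of_real h) = \<Phi> z"
proof -
  define c where "c = (\<lambda>z. \<Phi> (z + of_real h) - \<Phi> z)"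
  have "(c has_field_derivative 0) (at z)" if "z \<in> upper_half" for z
  proof -
    have "((\<lambda>z. \<Phi> (z + of_real h)) has_field_derivative \<phi> (z + of_real h) * 1) (at z)"
      by (rule DERIV_chain2[where f = \<Phi>]) (use that in \<open>auto intro!: primitive derivative_eq_intros\<close>)
    from DERIV_diff[OF this primitive[OF that]] show ?thesis
      using that by (simp add: c_def periodic)
  qed
  then have const: "c z = c w" if "w \<in> upper_half" for w
    using upper_half_constant assms that by blast
  have "cmod (c z) \<le> \<epsilon> * \<bar>h\<bar>" if \<epsilon>: "\<epsilon> > 0" for \<epsilon>
  proof -
    obtain Y where Y: "Y > 0" "\<And>z. Im z > Y \<Longrightarrow> cmod (\<phi> z) \<le> \<epsilon>"
      using small[OF \<epsilon>] by blast
    define w where "w = of_real (Y + 1) * \<i>"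
    have w: "Im w = Y + 1" by (simp add: w_def)
    have "cmod (\<Phi> (w + of_real h) - \<Phi> w) \<le> \<epsilon> * cmod (w + of_real h - w)"
    proof (rule field_differentiable_bound[where S = "closed_segment w (w + of_real h)" and f' = \<phi>])
      fix x assume "x \<in> closed_segment w (w + of_real h)"
      then have x: "Im x = Y + 1"
        using closed_segment_real[of x w] w by simp
      then show "(\<Phi> has_field_derivative \<phi> x) (at x within closed_segment w (w + of_real h))"
        using Y(1) by (intro DERIV_subset[OF primitive subset_UNIV]) (simp add: upper_half_def)
      show "cmod (\<phi> x) \<le> \<epsilon>" using x Y by simp
    qed auto
    then show ?thesis
      using const[of w] w Y(1) by (simp add: c_def upper_half_def)
  qed
  note bound = this
  have "cmod (c z) \<le> \<delta>" if "\<delta> > 0" for \<delta>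
    using bound[of "\<delta> / \<bar>h\<bar>"] that h by simp
  then have "c z = 0"
    using field_le_epsilon[of "cmod (c z)" 0] by simp
  then show ?thesis by (simp add: c_def)
qed

text \<open>A function of mean zero over a period is bounded by its derivative, and Cauchy's estimate
  bounds the derivative by a small multiple of \<open>1 / Im z\<close>.\<close>

lemma Im_times_tendsto:
  "((\<lambda>z. of_real (Im z) * \<phi> z) \<longlongrightarrow> 0) (filtercomap Im at_top)"
proof (rule tendstoI)
  fix \<delta> :: real assume "\<delta> > 0"
  \<comment> \<open>The final estimate is 3 * \<epsilon> * |h|, which is 3/4 of \<delta>.\<close>
  define \<epsilon> where "\<epsilon> = \<delta> / (4 * \<bar>h\<bar>)"
  have \<epsilon>: "\<epsilon> > 0" using \<open>\<delta> > 0\<close> h by (simp add: \<epsilon>_def)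
  obtain Y where Y: "Y > 0" "\<And>z. Im z > Y \<Longrightarrow> cmod (\<phi> z) \<le> \<epsilon>"
    using small[OF \<epsilon>] by blast
  have deriv: "cmod (deriv \<phi> z) \<le> 3 * \<epsilon> / Im z" if z: "Im z > 3 * Y" for z
  proof -
    \<comment> \<open>A disc of this radius stays above height 2/3 * Im z > Y, where |\<phi>| is at
      most \<epsilon>.\<close>
    define \<rho> where "\<rho> = Im z / 3"
    have \<rho>: "\<rho> > 0" using z Y(1) by (simp add: \<rho>_def)
    have sub: "Im w > Y" if "w \<in> cball z \<rho>" for w
    proof -
      have "\<bar>Im z - Im w\<bar> \<le> \<rho>"
        using that abs_Im_le_cmod[of "z - w"] by (simp add: dist_norm)
      then have "Im z - Im w \<le> \<rho>" by (rule abs_le_D1)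
      then show ?thesis using z Y(1) by (simp add: \<rho>_def)
    qed
    then have "cball z \<rho> \<subseteq> upper_half"
      using Y(1) by (force simp: upper_half_def)
    then have hol: "\<phi> holomorphic_on cball z \<rho>"
      using holomorphic by (rule holomorphic_on_subset[rotated])
    have "cmod ((deriv ^^ 1) \<phi> z) \<le> fact 1 * \<epsilon> / \<rho> ^ 1"
    proof (rule Cauchy_inequality)
      show "\<phi> holomorphic_on ball z \<rho>"
        using hol by (rule holomorphic_on_subset) auto
      show "continuous_on (cball z \<rho>) \<phi>"
        using hol by (rule holomorphic_on_imp_continuous_on)
      show "cmod (\<phi> x) \<le> \<epsilon>" if "cmod (z - x) = \<rho>" for x
        using that by (intro Y(2) sub) (simp add: dist_norm)
    qed (rule \<rho>)
    then show ?thesis by (simp add: \<rho>_def mult.commute)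
  qed
  have "cmod (of_real (Im z) * \<phi> z) < \<delta>" if z: "Im z > 3 * Y" for z
  proof -
    have zu: "z \<in> upper_half" and pos: "Im z > 0" using z Y(1) by (auto simp: upper_half_def)
    let ?S = "closed_segment z (z + of_real h)"
    have Im: "Im x = Im z" if "x \<in> ?S" for x
      using that by (rule closed_segment_real)
    have S: "x \<in> upper_half" if "x \<in> ?S" for x
      using Im[OF that] pos by (simp add: upper_half_def)
    have norm_le: "cmod (x - z) \<le> \<bar>h\<bar>" if "x \<in> ?S" for x
      using that segment_bound(1)[of x z "z + of_real h"] by simp
    have var: "cmod (\<phi> x - \<phi> z) \<le> 3 * \<epsilon> / Im z * \<bar>h\<bar>" if x: "x \<in> ?S" for x
    proof -
      have "cmod (\<phi> x - \<phi> z) \<le> 3 * \<epsilon> / Im z * cmod (x - z)"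
      proof (rule field_differentiable_bound[where S = ?S and f' = "deriv \<phi>"])
        fix x assume x: "x \<in> ?S"
        show "(\<phi> has_field_derivative deriv \<phi> x) (at x within ?S)"
          using S[OF x] by (intro DERIV_subset[OF holomorphic_derivI[OF holomorphic] subset_UNIV]) auto
        show "cmod (deriv \<phi> x) \<le> 3 * \<epsilon> / Im z" using deriv[of x] Im[OF x] z by simp
      qed (use x in auto)
      also have "\<dots> \<le> 3 * \<epsilon> / Im z * \<bar>h\<bar>"
        using norm_le[OF x] \<epsilon> pos by (intro mult_left_mono) auto
      finally show ?thesis .
    qed
    \<comment> \<open>The derivative of u is the deviation of \<phi> from \<phi> z. By periodicity
      of \<Phi> the increment of u over the period is -h * \<phi> z, so \<phi> z is itself bounded
      by that deviation.\<close>
    define u where "u = (\<lambda>x. \<Phi> x - x * \<phi> z)"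
    have "cmod (u (z + of_real h) - u z) \<le> 3 * \<epsilon> / Im z * \<bar>h\<bar> * cmod (z + of_real h - z)"
    proof (rule field_differentiable_bound[where S = ?S and f' = "\<lambda>x. \<phi> x - \<phi> z"])
      fix x assume x: "x \<in> ?S"
      show "(u has_field_derivative \<phi> x - \<phi> z) (at x within ?S)"
        unfolding u_def using S[OF x]
        by (auto intro!: derivative_eq_intros DERIV_subset[OF primitive subset_UNIV])
    qed (use var in auto)
    moreover have "u (z + of_real h) - u z = - (of_real h * \<phi> z)"
      using primitive_periodic[OF zu] by (simp add: u_def algebra_simps)
    ultimately have "\<bar>h\<bar> * cmod (\<phi> z) \<le> \<bar>h\<bar> * (3 * \<epsilon> / Im z * \<bar>h\<bar>)"
      by (simp add: norm_mult mult.commute)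
    then have "cmod (\<phi> z) \<le> 3 * \<epsilon> / Im z * \<bar>h\<bar>"
      using h by (subst (asm) mult_le_cancel_left_pos) auto
    then have "Im z * cmod (\<phi> z) \<le> 3 * \<epsilon> * \<bar>h\<bar>"
      using pos by (simp add: field_simps)
    also have "\<dots> < \<delta>" using h \<open>\<delta> > 0\<close> by (simp add: \<epsilon>_def)
    finally show ?thesis using pos by (simp add: norm_mult)
  qed
  then show "\<forall>\<^sub>F z in filtercomap Im at_top. dist (of_real (Im z) * \<phi> z) 0 < \<delta>"
    unfolding filtercomap_Im_at_top using Y(1) by (intro exI[of _ "3 * Y"]) auto
qed

end

section \<open>Cusp forms of weight 2\<close>

definition slash2 :: "(complex \<Rightarrow> complex) \<Rightarrow> real^2^2 \<Rightarrow> complex \<Rightarrow> complex" where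
  "slash2 f \<sigma> z = f (moebius_act \<sigma> z) / (cocycle \<sigma> z)\<^sup>2"

lemma norm_slash2:
  assumes "det \<sigma> = 1" "z \<in> upper_half"
  shows "Im z * cmod (slash2 f \<sigma> z) = Im (moebius_act \<sigma> z) * cmod (f (moebius_act \<sigma> z))"
  using assms by (simp add: slash2_def Im_moebius norm_divide norm_power)

lemma primitive_moebius_act:
  assumes F: "\<And>z. z \<in> upper_half \<Longrightarrow> (F has_field_derivative f z) (at z)"
    and "det \<sigma> = 1" "z \<in> upper_half"
  shows "((\<lambda>z. F (moebius_act \<sigma> z)) has_field_derivative slash2 f \<sigma> z) (at z)"
  using DERIV_chain2[OF F[OF moebius_upper_half] moebius_act_has_field_derivative] assms(2,3)
  by (simp add: slash2_def)

text \<open>Equal diagonal entries with determinant 1 are both 1 or both -1. Dividing by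
  \<open>P$2$2\<close> absorbs the sign, so \<open>translation t\<close> and its negative give the
  same shift.\<close>

lemma moebius_act_upper_triangular:
  assumes "det P = 1" "P$2$1 = 0" "P$1$1 = P$2$2"
  shows "moebius_act P z = z + of_real (P$1$2 / P$2$2)" "(cocycle P z)\<^sup>2 = 1"
proof -
  have *: "P$2$2 * P$2$2 = 1" using assms by (simp add: det_2)
  then have "P$2$2 \<noteq> 0" by auto
  then show "moebius_act P z = z + of_real (P$1$2 / P$2$2)"
    using assms by (simp add: moebius_act_eq cocycle_def field_simps)
  show "(cocycle P z)\<^sup>2 = 1"
    using assms(2) * by (simp add: cocycle_def power2_eq_square flip: of_real_mult)
qed

text \<open>Slashing f with the two sides of \<gamma> ** \<sigma> = \<sigma> ** P: automorphy
  absorbs \<gamma> on the left, and the squared cocycle of P is 1 on the right.\<close>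

lemma slash2_periodic:
  assumes inv: "\<And>z. z \<in> upper_half \<Longrightarrow> f (moebius_act \<gamma> z) = (cocycle \<gamma> z)\<^sup>2 * f z"
    and det: "det \<gamma> = 1" "det \<sigma> = 1" "det P = 1"
    and comm: "\<gamma> ** \<sigma> = \<sigma> ** P"
    and P: "P$2$1 = 0" "P$1$1 = P$2$2"
    and z: "z \<in> upper_half"
  shows "slash2 f \<sigma> (z + of_real (P$1$2 / P$2$2)) = slash2 f \<sigma> z"
proof -
  have w: "moebius_act \<sigma> z \<in> upper_half" using det z by (intro moebius_upper_half)
  have "slash2 f (\<gamma> ** \<sigma>) z = slash2 f \<sigma> z"
    using det z w cocycle_nonzero[OF det(1) w]
    by (simp add: slash2_def cocycle_mult moebius_act_mult inv power_mult_distrib)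
  moreover have "slash2 f (\<sigma> ** P) z = slash2 f \<sigma> (moebius_act P z)"
    using det z moebius_act_upper_triangular(2)[OF det(3) P, of z]
    by (simp add: slash2_def cocycle_mult moebius_act_mult power_mult_distrib)
  ultimately show ?thesis
    unfolding comm moebius_act_upper_triangular(1)[OF det(3) P] by simp
qed

lemma cusp_form2_periodic_cuspidal:
  assumes \<Gamma>: "\<Gamma> \<subseteq> carrier SL2R" and f: "cusp_form2 \<Gamma> f"
    and F: "\<And>z. z \<in> upper_half \<Longrightarrow> (F has_field_derivative f z) (at z)"
    and \<sigma>: "det \<sigma> = 1" "moebius_ext \<sigma> Infty \<in> cusps \<Gamma>"
    and \<gamma>: "\<gamma> \<in> \<Gamma>" "\<gamma> ** \<sigma> = \<sigma> ** P" "det P = 1" "P$2$1 = 0" "P$1$1 = P$2$2" "P$1$2 \<noteq> 0"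
  shows "periodic_cuspidal (slash2 f \<sigma>) (\<lambda>z. F (moebius_act \<sigma> z)) (P$1$2 / P$2$2)"
proof
  show "P$1$2 / P$2$2 \<noteq> 0"
    using \<gamma> by (auto simp: det_2)
  show "((\<lambda>z. F (moebius_act \<sigma> z)) has_field_derivative slash2 f \<sigma> z) (at z)"
    if "z \<in> upper_half" for z
    using F \<sigma>(1) that by (rule primitive_moebius_act)
  show "slash2 f \<sigma> (z + of_real (P$1$2 / P$2$2)) = slash2 f \<sigma> z" if "z \<in> upper_half" for z
  proof (rule slash2_periodic[where \<gamma> = \<gamma>])
    show "f (moebius_act \<gamma> z) = (cocycle \<gamma> z)\<^sup>2 * f z" if "z \<in> upper_half" for z
      using f \<gamma>(1) that by (simp add: cusp_form2_def)
  qed (use \<Gamma> \<gamma> \<sigma> that in auto)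
  show "(slash2 f \<sigma> \<longlongrightarrow> 0) (filtercomap Im at_top)"
    using f \<sigma> by (simp add: cusp_form2_def slash2_def[abs_def])
qed

lemma matrix_minus_mult: "(- A) ** B = - (A ** B)" for A B :: "real^2^2"
  by (simp add: matrix_eq_2 matrix_mult_2)

lemma matrix_mult_minus: "A ** (- B) = - (A ** B)" for A B :: "real^2^2"
  by (simp add: matrix_eq_2 matrix_mult_2)

lemma parabolic_at_Infty:
  assumes "parabolic P" "moebius_ext P Infty = Infty"
  shows "P$2$1 = 0" "P$1$1 = P$2$2" "P$1$2 \<noteq> 0"
proof -
  show P: "P$2$1 = 0" using assms(2) by (simp split: if_splits)
  have d: "P$1$1 * P$2$2 = 1" "\<bar>P$1$1 + P$2$2\<bar> = 2"
    using assms(1) P by (auto simp: parabolic_def det_2 trace_def sum_2)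
  have "(P$1$1 - P$2$2)\<^sup>2 = \<bar>P$1$1 + P$2$2\<bar>\<^sup>2 - 4 * (P$1$1 * P$2$2)"
    by (simp add: power2_eq_square algebra_simps)
  then show e: "P$1$1 = P$2$2" using d by simp
  have "P$2$2 = 1 \<or> P$2$2 = -1"
    using d(1) e by (simp add: square_eq_1_iff)
  with e P assms(1) show "P$1$2 \<noteq> 0"
    by (auto simp: parabolic_def matrix_eq_2)
qed

lemma parabolic_conj:
  assumes "parabolic \<gamma>" "det \<sigma> = 1"
  shows "parabolic (SL_inv \<sigma> ** \<gamma> ** \<sigma>)"
proof -
  let ?P = "SL_inv \<sigma> ** \<gamma> ** \<sigma>"
  have "trace ?P = trace (\<sigma> ** (SL_inv \<sigma> ** \<gamma>))"
    by (rule trace_mul_sym)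
  then have tr: "trace ?P = trace \<gamma>" using assms by simp
  have eq: "\<gamma> = \<sigma> ** ?P ** SL_inv \<sigma>"
    using assms(2) by (simp add: matrix_mul_assoc)
  have "?P \<noteq> Finite_Cartesian_Product.mat 1"
    using assms eq by (metis SL_inv_right matrix_mul_rid parabolic_def)
  moreover have "?P \<noteq> - Finite_Cartesian_Product.mat 1"
    using assms eq by (metis SL_inv_right matrix_mul_rid parabolic_def matrix_mult_minus matrix_minus_mult)
  ultimately show ?thesis
    using assms tr by (simp add: parabolic_def det_mul)
qed

text \<open>\<open>horocycle_topology\<close> tests every \<sigma> that carries infinity to the
  cusp, not only scaling matrices. Hence the period comes from an arbitrary parabolic element fixing
  the cusp, conjugated to infinity by \<sigma>.\<close>

lemma cusp_form2_decay:
  assumes \<Gamma>: "\<Gamma> \<subseteq> carrier SL2R" and f: "cusp_form2 \<Gamma> f"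
    and \<sigma>: "det \<sigma> = 1" "moebius_ext \<sigma> Infty \<in> cusps \<Gamma>" and "\<epsilon> > 0"
  shows "\<exists>Y>0. \<forall>z. Im z > Y \<longrightarrow> Im (moebius_act \<sigma> z) * cmod (f (moebius_act \<sigma> z)) < \<epsilon>"
proof -
  obtain \<gamma> where \<gamma>: "\<gamma> \<in> \<Gamma>" "parabolic \<gamma>" "moebius_ext \<gamma> (moebius_ext \<sigma> Infty) = moebius_ext \<sigma> Infty"
    using \<sigma>(2) by (auto simp: cusps_def)
  define P where "P = SL_inv \<sigma> ** \<gamma> ** \<sigma>"
  have det: "det \<gamma> = 1" using \<gamma>(1) \<Gamma> by auto
  have "moebius_ext P Infty = Infty"
    using \<sigma>(1) det \<gamma>(3) by (simp add: P_def moebius_ext_mult moebius_ext_inv det_mul del: moebius_ext.simps)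
  then have P: "P$2$1 = 0" "P$1$1 = P$2$2" "P$1$2 \<noteq> 0"
    using parabolic_at_Infty[OF parabolic_conj[OF \<gamma>(2) \<sigma>(1)]] unfolding P_def by blast+
  obtain F where F: "\<And>z. z \<in> upper_half \<Longrightarrow> (F has_field_derivative f z) (at z)"
    using upper_half_primitive f by (auto simp: cusp_form2_def)
  interpret periodic_cuspidal "slash2 f \<sigma>" "\<lambda>z. F (moebius_act \<sigma> z)" "P$1$2 / P$2$2"
    using \<Gamma> f F \<sigma> \<gamma>(1) _ _ P
    by (rule cusp_form2_periodic_cuspidal) (use \<sigma> det in \<open>auto simp: P_def det_mul matrix_mul_assoc\<close>)
  have "\<forall>\<^sub>F z in filtercomap Im at_top. dist (of_real (Im z) * slash2 f \<sigma> z) 0 < \<epsilon>"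
    using Im_times_tendsto \<open>\<epsilon> > 0\<close> by (rule tendstoD)
  then obtain Y where Y: "Y > 0" "\<And>z. Im z > Y \<Longrightarrow> \<bar>Im z\<bar> * cmod (slash2 f \<sigma> z) < \<epsilon>"
    by (auto simp: filtercomap_Im_at_top norm_mult)
  have "Im (moebius_act \<sigma> z) * cmod (f (moebius_act \<sigma> z)) < \<epsilon>" if "Im z > Y" for z
    using Y that norm_slash2[OF \<sigma>(1), of z f] by (force simp: upper_half_def)
  then show ?thesis using Y(1) by blast
qed

section \<open>The compact quotient and the invariant size of a cusp form\<close>

lemma topspace_horocycle_topology:
  "\<Gamma> \<subseteq> carrier SL2R \<Longrightarrow> topspace (horocycle_topology \<Gamma>) = extended_half_plane \<Gamma>"
proof
  show "topspace (horocycle_topology \<Gamma>) \<subseteq> extended_half_plane \<Gamma>"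
    using openin_topspace[of "horocycle_topology \<Gamma>"] unfolding openin_horocycle_topology by blast
  have "{z \<in> upper_half. Pt z \<in> extended_half_plane \<Gamma>} = upper_half"
    by (auto simp: extended_half_plane_def)
  moreover have "\<exists>Y>0. \<forall>z. Im z > Y \<longrightarrow> Pt (moebius_act \<sigma> z) \<in> extended_half_plane \<Gamma>"
    if "\<sigma> \<in> carrier SL2R" for \<sigma>
    using that moebius_upper_half
    by (intro exI[of _ 1]) (auto simp: extended_half_plane_def upper_half_def)
  ultimately have "openin (horocycle_topology \<Gamma>) (extended_half_plane \<Gamma>)"
    by (simp add: openin_horocycle_topology)
  then show "extended_half_plane \<Gamma> \<subseteq> topspace (horocycle_topology \<Gamma>)"
    by (rule openin_subset)
qed

lemma topspace_quotient_topology: "topspace (quotient_topology X q) = q ` topspace X"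
proof
  show "topspace (quotient_topology X q) \<subseteq> q ` topspace X"
    using openin_topspace[of "quotient_topology X q"] unfolding openin_quotient_topology by blast
  have "{x \<in> topspace X. q x \<in> q ` topspace X} = topspace X" by blast
  then have "openin (quotient_topology X q) (q ` topspace X)"
    by (simp add: openin_quotient_topology)
  then show "q ` topspace X \<subseteq> topspace (quotient_topology X q)"
    by (rule openin_subset)
qed

lemma cusp_not_upper: "z \<in> upper_half \<Longrightarrow> Pt z \<notin> cusps \<Gamma>"
  by (auto simp: cusps_def real_proj_line_def upper_half_def)

lemma moebius_ext_real_proj_line:
  assumes "x \<in> real_proj_line"
  shows "moebius_ext A x \<in> real_proj_line"
proof (cases x)
  case Infty
  then show ?thesis by (auto simp: real_proj_line_def simp del: of_real_divide)
next
  case (Pt z)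
  with assms obtain t :: real where t: "z = of_real t" by (auto simp: real_proj_line_def)
  have "moebius_act A z = of_real ((A$1$1 * t + A$1$2) / (A$2$1 * t + A$2$2))"
    by (simp add: t moebius_act_eq cocycle_def)
  then show ?thesis
    by (auto simp: Pt real_proj_line_def simp del: of_real_divide of_real_add of_real_mult)
qed

text \<open>The invariant function \<open>Im z * \<bar>f z\<bar>\<close> extends continuously by \<open>0\<close> to the cusps, so its
  sublevel sets give an open cover of the compact quotient.\<close>

lemma cusp_form2_bounded:
  assumes \<Gamma>: "fuchsian_first_kind \<Gamma>" and f: "cusp_form2 \<Gamma> f"
  obtains C where "\<And>z. z \<in> upper_half \<Longrightarrow> Im z * cmod (f z) \<le> C"
proof -
  let ?X = "horocycle_topology \<Gamma>" and ?q = "group_orbit \<Gamma> moebius_ext"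
  let ?Q = "quotient_topology ?X ?q"
  interpret subgroup \<Gamma> SL2R using \<Gamma> by (simp add: fuchsian_first_kind_def)
  have sub: "\<Gamma> \<subseteq> carrier SL2R" by (rule subset)
  have compact: "compact_space ?Q"
    using \<Gamma> by (simp add: fuchsian_first_kind_def)
  define \<mu> where "\<mu> z = Im z * cmod (f z)" for z
  define U where "U k = {Pt z |z. z \<in> upper_half \<and> \<mu> z < real (Suc k)} \<union> cusps \<Gamma>" for k
  have \<mu>_inv: "\<mu> (moebius_act \<gamma> z) = \<mu> z" if "\<gamma> \<in> \<Gamma>" "z \<in> upper_half" for \<gamma> z
  proof -
    have det: "det \<gamma> = 1" using that sub by auto
    show ?thesis
      using f that cocycle_nonzero[OF det that(2)]
      by (simp add: \<mu>_def Im_moebius[OF det] cusp_form2_def norm_mult norm_power)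
  qed
  have U_iff: "Pt z \<in> U k \<longleftrightarrow> \<mu> z < real (Suc k)" if "z \<in> upper_half" for z k
    using that by (simp add: U_def cusp_not_upper)
  have "continuous_on upper_half \<mu>"
    using f unfolding \<mu>_def cusp_form2_def
    by (intro continuous_intros holomorphic_on_imp_continuous_on) auto
  then have "open (upper_half \<inter> \<mu> -` {..<real (Suc k)})" for k
    by (intro continuous_open_preimage) auto
  moreover have "{z \<in> upper_half. Pt z \<in> U k} = upper_half \<inter> \<mu> -` {..<real (Suc k)}" for k
    using U_iff by auto
  moreover have "\<exists>Y>0. \<forall>z. Im z > Y \<longrightarrow> Pt (moebius_act \<sigma> z) \<in> U k"
    if \<sigma>: "\<sigma> \<in> carrier SL2R" "moebius_ext \<sigma> Infty \<in> U k" for \<sigma> k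
  proof -
    have det: "det \<sigma> = 1" using \<sigma> by simp
    have "moebius_ext \<sigma> Infty \<in> cusps \<Gamma>"
      using \<sigma> moebius_ext_Infty_not_upper unfolding U_def by blast
    from cusp_form2_decay[OF sub f det this, of "real (Suc k)"]
    obtain Y where Y: "Y > 0" "\<And>z. Im z > Y \<Longrightarrow> \<mu> (moebius_act \<sigma> z) < real (Suc k)"
      unfolding \<mu>_def by auto
    have "moebius_act \<sigma> z \<in> upper_half" if "Im z > Y" for z
      using that Y(1) by (intro moebius_upper_half[OF det]) (simp add: upper_half_def)
    then show ?thesis
      using Y U_iff by blast
  qed
  ultimately have open_U: "openin ?X (U k)" for k
    unfolding openin_horocycle_topology by (auto simp: U_def extended_half_plane_def)
  \<comment> \<open>Each U k is a union of orbits, which makes its image in the quotient open: the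
    preimage of that image is U k again.\<close>
  have orbit: "x \<in> U k" if x: "x \<in> extended_half_plane \<Gamma>" "?q x \<in> ?q ` U k" for x k
  proof -
    obtain y where y: "y \<in> U k" "?q x = ?q y" using x by blast
    have "moebius_ext \<one>\<^bsub>SL2R\<^esub> x \<in> ?q x"
      unfolding group_orbit_def by (rule imageI) (rule one_closed)
    then obtain \<gamma> where \<gamma>: "\<gamma> \<in> \<Gamma>" "x = moebius_ext \<gamma> y"
      unfolding y(2) by (auto simp: group_orbit_def)
    have det: "det \<gamma> = 1" using \<gamma> sub by auto
    show ?thesis
    proof (cases "y \<in> cusps \<Gamma>")
      case True
      \<comment> \<open>The image of a cusp is seen to lie on the real circle, and the points of the
        extended half-plane on that circle are cusps.\<close>
      then have "x \<in> real_proj_line"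
        using \<gamma> moebius_ext_real_proj_line by (simp add: cusps_def)
      then have "x \<in> cusps \<Gamma>"
        using x(1) by (auto simp: extended_half_plane_def upper_half_def real_proj_line_def)
      then show ?thesis by (simp add: U_def)
    next
      case False
      then obtain z where z: "y = Pt z" "z \<in> upper_half" "\<mu> z < real (Suc k)"
        using y(1) by (auto simp: U_def)
      have "x = Pt (moebius_act \<gamma> z)" "moebius_act \<gamma> z \<in> upper_half"
        unfolding \<gamma> z using det z(2) by (auto simp: moebius_ext_upper moebius_upper_half simp del: moebius_ext.simps)
      then show ?thesis using \<mu>_inv[OF \<gamma>(1) z(2)] z(3) U_iff by simp
    qed
  qed
  have sub_ext: "U k \<subseteq> extended_half_plane \<Gamma>" for k
    by (auto simp: U_def extended_half_plane_def)
  have "{x \<in> topspace ?X. ?q x \<in> ?q ` U k} = U k" for k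
    using orbit[of _ k] sub_ext[of k] unfolding topspace_horocycle_topology[OF sub] by blast
  then have open_V: "openin ?Q (?q ` U k)" for k
    using open_U sub_ext[of k]
    unfolding openin_quotient_topology topspace_horocycle_topology[OF sub] by auto
  have "extended_half_plane \<Gamma> \<subseteq> (\<Union>k. U k)"
  proof
    fix x assume x: "x \<in> extended_half_plane \<Gamma>"
    show "x \<in> (\<Union>k. U k)"
    proof (cases "x \<in> cusps \<Gamma>")
      case True then show ?thesis by (simp add: U_def)
    next
      case False
      then obtain z where z: "x = Pt z" "z \<in> upper_half"
        using x by (auto simp: extended_half_plane_def)
      obtain k where "\<mu> z < real k" using reals_Archimedean2 by blast
      then have "x \<in> U k" using z U_iff by force
      then show ?thesis by blast
    qed
  qed
  then have "topspace ?Q \<subseteq> \<Union> (range (\<lambda>k. ?q ` U k))"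
    unfolding topspace_quotient_topology topspace_horocycle_topology[OF sub] by blast
  moreover have "\<Union> (range (\<lambda>k. ?q ` U k)) \<subseteq> topspace ?Q"
    using open_V openin_subset by blast
  ultimately have cover: "\<Union> (range (\<lambda>k. ?q ` U k)) = topspace ?Q"
    by (rule equalityI[rotated])
  obtain \<F> where \<F>: "finite \<F>" "\<F> \<subseteq> range (\<lambda>k. ?q ` U k)" "\<Union>\<F> = topspace ?Q"
    using compact[unfolded compact_space, THEN spec, of "range (\<lambda>k. ?q ` U k)"] cover open_V
    by (auto simp del: UN_simps)
  obtain K where K: "finite K" "\<F> = (\<lambda>k. ?q ` U k) ` K"
    using finite_subset_image[OF \<F>(1,2)] by blast
  show ?thesis
  proof
    fix z assume z: "z \<in> upper_half"
    then have zx: "Pt z \<in> extended_half_plane \<Gamma>" by (simp add: extended_half_plane_def)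
    then have "?q (Pt z) \<in> topspace ?Q"
      unfolding topspace_quotient_topology topspace_horocycle_topology[OF sub] by blast
    then obtain k where k: "k \<in> K" "?q (Pt z) \<in> ?q ` U k" using \<F>(3) K(2) by blast
    then have "Pt z \<in> U k" using orbit[OF zx] by blast
    then have "\<mu> z < real (Suc k)" using U_iff z by blast
    also have "k \<le> Max (insert 0 K)" using k(1) K(1) by simp
    then have "real (Suc k) \<le> real (Suc (Max (insert 0 K)))" by simp
    finally show "Im z * cmod (f z) \<le> real (Suc (Max (insert 0 K)))"
      unfolding \<mu>_def by simp
  qed
qed

section \<open>Modular symbols\<close>

lemma ii_upper_half [simp]: "\<i> \<in> upper_half"
  by (simp add: upper_half_def)

text \<open>Weight 2 invariance cancels the derivative of \<gamma>, so F(\<gamma> z) - F z has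
  derivative zero. This is the independence of the base point, used below to place it wherever
  \<gamma> acts most simply.\<close>

lemma modular_symbol_primitive:
  assumes F: "\<And>z. z \<in> upper_half \<Longrightarrow> (F has_field_derivative f z) (at z)"
    and inv: "\<And>z. z \<in> upper_half \<Longrightarrow> f (moebius_act \<gamma> z) = (cocycle \<gamma> z)\<^sup>2 * f z"
    and \<gamma>: "det \<gamma> = 1" and z: "z \<in> upper_half"
  shows "modular_symbol \<gamma> f = F (moebius_act \<gamma> z) - F z"
proof -
  have D: "((\<lambda>z. F (moebius_act \<gamma> z) - F z) has_field_derivative 0) (at z)" if "z \<in> upper_half" for z
    using DERIV_diff[OF primitive_moebius_act[OF F \<gamma> that] F[OF that]] cocycle_nonzero[OF \<gamma> that]
    by (simp add: slash2_def inv that)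
  have "F (moebius_act \<gamma> \<i>) - F \<i> = F (moebius_act \<gamma> z) - F z"
    by (rule upper_half_constant[OF D ii_upper_half z])
  moreover have "(f has_contour_integral F (pathfinish (linepath \<i> (moebius_act \<gamma> \<i>)))
      - F (pathstart (linepath \<i> (moebius_act \<gamma> \<i>)))) (linepath \<i> (moebius_act \<gamma> \<i>))"
    by (rule contour_integral_primitive[where S = upper_half])
      (use \<gamma> moebius_upper_half closed_segment_subset[OF _ _ convex_upper_half]
        in \<open>auto intro: DERIV_subset[OF F]\<close>)
  ultimately show ?thesis
    unfolding modular_symbol_def by (simp add: contour_integral_unique)
qed

text \<open>A hyperbolically bounded derivative gives logarithmic growth along vertical lines; periodicity
  moves the end point into a vertical strip of width \<open>1\<close>.\<close>

lemma periodic_log_growth: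
  assumes \<Phi>: "\<And>z. z \<in> upper_half \<Longrightarrow> (\<Phi> has_field_derivative \<phi> z) (at z)"
    and bound: "\<And>z. z \<in> upper_half \<Longrightarrow> Im z * cmod (\<phi> z) \<le> C"
    and periodic: "\<And>z. z \<in> upper_half \<Longrightarrow> \<Phi> (z + 1) = \<Phi> z"
    and z: "z \<in> upper_half"
  shows "cmod (\<Phi> z - \<Phi> \<i>) \<le> C * (1 + \<bar>ln (Im z)\<bar>)"
proof -
  have periodic_nat: "\<Phi> (z + of_nat k) = \<Phi> z" if "z \<in> upper_half" for z k
  proof (induction k)
    case (Suc k)
    have "z + of_nat k \<in> upper_half" using that by (simp add: upper_half_def)
    from periodic[OF this] Suc show ?case by (simp add: add_ac)
  qed simp
  have periodic_int: "\<Phi> (z + of_int k) = \<Phi> z" if "z \<in> upper_half" for z k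
  proof (cases "k \<ge> 0")
    case True
    then show ?thesis using periodic_nat[OF that, of "nat k"] by simp
  next
    case False
    have "z + of_int k \<in> upper_half" using that by (simp add: upper_half_def)
    then show ?thesis using periodic_nat[of "z + of_int k" "nat (-k)"] False by simp
  qed
  define x where "x = frac (Re z)"
  have x: "0 \<le> x" "x < 1" by (auto simp: x_def frac_lt_1)
  have y: "Im z > 0" using z by (simp add: upper_half_def)
  have C: "C \<ge> 0" using bound[of \<i>] by (simp add: upper_half_def) (meson norm_ge_zero order_trans)
  \<comment> \<open>A vertical line whose abscissa is the fractional part of Re z, parametrized by
    the logarithm of the height, that is by hyperbolic length. In this parameter the derivative of
    \<Phi> has norm Im * |\<phi>|, hence at most C.\<close>
  define L where "L t = of_real x + \<i> * of_real (exp t)" for t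
  have L: "L t \<in> upper_half" "Im (L t) = exp t" for t by (simp_all add: L_def upper_half_def)
  have "z = L (ln (Im z)) + of_int \<lfloor>Re z\<rfloor>"
    using y by (simp add: L_def x_def complex_eq_iff frac_def)
  then have 1: "\<Phi> z = \<Phi> (L (ln (Im z)))"
    using periodic_int[OF L(1), of "ln (Im z)" "\<lfloor>Re z\<rfloor>"] by simp
  have "norm (\<Phi> (L (ln (Im z))) - \<Phi> (L 0)) \<le> C * norm (ln (Im z) - 0)"
  proof (rule differentiable_bound[where S = UNIV and f = "\<lambda>t. \<Phi> (L t)"
        and f' = "\<lambda>t h. \<phi> (L t) * (\<i> * of_real (exp t * h))"])
    fix t :: real
    have "(L has_derivative (\<lambda>h. \<i> * of_real (exp t * h))) (at t)"
      unfolding L_def by (auto intro!: derivative_eq_intros)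
    then show "((\<lambda>t. \<Phi> (L t)) has_derivative (\<lambda>h. \<phi> (L t) * (\<i> * of_real (exp t * h)))) (at t)"
      by (rule has_derivative_compose[where g = \<Phi> and g' = "\<lambda>h. \<phi> (L t) * h"])
        (rule \<Phi>[OF L(1), unfolded has_field_derivative_def])
    have "norm (\<phi> (L t) * (\<i> * of_real (exp t * h))) \<le> C * norm h" for h :: real
    proof -
      have "norm (\<phi> (L t) * (\<i> * of_real (exp t * h))) = (Im (L t) * cmod (\<phi> (L t))) * \<bar>h\<bar>"
        by (simp add: norm_mult L(2))
      also have "\<dots> \<le> C * \<bar>h\<bar>" using bound[OF L(1)] by (intro mult_right_mono) auto
      finally show ?thesis by simp
    qed
    then show "onorm (\<lambda>h. \<phi> (L t) * (\<i> * of_real (exp t * h))) \<le> C"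
      by (rule onorm_le)
  qed auto
  then have 2: "cmod (\<Phi> z - \<Phi> (L 0)) \<le> C * \<bar>ln (Im z)\<bar>" by (simp add: 1)
  \<comment> \<open>The remaining piece from \<open>\<i>\<close> to \<open>L 0\<close> is horizontal
    at height 1 and shorter than 1. It accounts for the summand 1 in the bound.\<close>
  have seg: "w \<in> upper_half \<and> Im w = 1" if "w \<in> closed_segment \<i> (L 0)" for w
    using that by (auto simp: closed_segment_def L_def upper_half_def)
  have "cmod (\<Phi> (L 0) - \<Phi> \<i>) \<le> C * cmod (L 0 - \<i>)"
  proof (rule field_differentiable_bound[where S = "closed_segment \<i> (L 0)" and f' = \<phi>])
    fix w assume w: "w \<in> closed_segment \<i> (L 0)"
    show "(\<Phi> has_field_derivative \<phi> w) (at w within closed_segment \<i> (L 0))"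
      using seg[OF w] by (intro DERIV_subset[OF \<Phi> subset_UNIV]) auto
    show "cmod (\<phi> w) \<le> C" using bound[of w] seg[OF w] by simp
  qed auto
  also have "\<dots> \<le> C * 1" using x C by (intro mult_left_mono) (auto simp: L_def)
  finally have 3: "cmod (\<Phi> (L 0) - \<Phi> \<i>) \<le> C" by simp
  have "cmod (\<Phi> z - \<Phi> \<i>) \<le> cmod (\<Phi> z - \<Phi> (L 0)) + cmod (\<Phi> (L 0) - \<Phi> \<i>)"
    using norm_triangle_ineq[of "\<Phi> z - \<Phi> (L 0)" "\<Phi> (L 0) - \<Phi> \<i>"] by simp
  then show ?thesis using 2 3 by (simp add: algebra_simps)
qed

section \<open>Scaled cusps\<close>

lemma translation_entries [simp]:
  "translation t $1$1 = 1" "translation t $1$2 = t" "translation t $2$1 = 0" "translation t $2$2 = 1"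
  by (simp_all add: translation_def)

locale scaled_cusp =
  fixes \<Gamma> :: "(real^2^2) set" and a :: csphere and \<sigma> :: "real^2^2"
  assumes subgroup: "subgroup \<Gamma> SL2R"
    and discrete: "discrete \<Gamma>"
    and cusp: "a \<in> cusps \<Gamma>"
    and scaling: "scaling_matrix \<Gamma> a \<sigma>"
begin

lemma det_\<Gamma>: "\<gamma> \<in> \<Gamma> \<Longrightarrow> det \<gamma> = 1"
  using subgroup.subset[OF subgroup] by auto

lemma mult_\<Gamma>: "\<gamma> \<in> \<Gamma> \<Longrightarrow> \<delta> \<in> \<Gamma> \<Longrightarrow> \<gamma> ** \<delta> \<in> \<Gamma>"
  using subgroup.m_closed[OF subgroup] by simp

lemma one_\<Gamma>: "Finite_Cartesian_Product.mat 1 \<in> \<Gamma>"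
  using subgroup.one_closed[OF subgroup] by simp

lemma inv_\<Gamma>: "\<gamma> \<in> \<Gamma> \<Longrightarrow> SL_inv \<gamma> \<in> \<Gamma>"
  using subgroup.m_inv_closed[OF subgroup] by simp

lemma det_\<sigma> [simp]: "det \<sigma> = 1" and \<sigma>_Infty: "moebius_ext \<sigma> Infty = a"
  using scaling by (auto simp: scaling_matrix_def Let_def)

definition conj :: "real^2^2 \<Rightarrow> real^2^2" where
  "conj \<gamma> = SL_inv \<sigma> ** \<gamma> ** \<sigma>"

lemma det_conj [simp]: "det \<gamma> = 1 \<Longrightarrow> det (conj \<gamma>) = 1"
  by (simp add: conj_def det_mul)

lemma conj_mult: "conj (\<gamma> ** \<delta>) = conj \<gamma> ** conj \<delta>"
  by (simp add: conj_def matrix_mul_assoc)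

lemma conj_inverse: "\<sigma> ** conj \<gamma> ** SL_inv \<sigma> = \<gamma>" "\<sigma> ** conj \<gamma> = \<gamma> ** \<sigma>"
  by (simp_all add: conj_def matrix_mul_assoc)

lemma stabilizer_iff:
  assumes "\<gamma> \<in> \<Gamma>"
  shows "\<gamma> \<in> stabilizer \<Gamma> a \<longleftrightarrow> conj \<gamma> $2$1 = 0"
proof -
  have \<gamma>: "det \<gamma> = 1" using assms by (rule det_\<Gamma>)
  have eq: "moebius_ext (conj \<gamma>) Infty = moebius_ext (SL_inv \<sigma>) (moebius_ext \<gamma> a)"
    using \<gamma> by (simp add: conj_def moebius_ext_mult \<sigma>_Infty det_mul del: moebius_ext.simps)
  have "moebius_ext \<gamma> a = a" if "moebius_ext (conj \<gamma>) Infty = Infty"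
  proof -
    have "moebius_ext \<gamma> a = moebius_ext \<sigma> (moebius_ext (SL_inv \<sigma>) (moebius_ext \<gamma> a))"
      by (simp add: flip: moebius_ext_mult)
    also have "\<dots> = a" using that unfolding eq by (simp add: \<sigma>_Infty del: moebius_ext.simps)
    finally show ?thesis .
  qed
  moreover have "moebius_ext (conj \<gamma>) Infty = Infty" if "moebius_ext \<gamma> a = a"
    unfolding eq that using moebius_ext_inv[of \<sigma> Infty] by (simp only: \<sigma>_Infty det_\<sigma>)
  ultimately show ?thesis
    using assms by (auto simp: stabilizer_def split: if_splits)
qed

lemma conj_stabilizer:
  assumes "\<gamma> \<in> stabilizer \<Gamma> a"
  obtains k :: int where "conj \<gamma> = translation (of_int k) \<or> conj \<gamma> = - translation (of_int k)"
proof -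
  have "conj \<gamma> \<in> range (\<lambda>k::int. translation (of_int k)) \<union> uminus ` range (\<lambda>k::int. translation (of_int k))"
    using scaling assms unfolding scaling_matrix_def Let_def conj_def by blast
  then show ?thesis using that by blast
qed

lemma conj_generator:
  obtains \<tau> where "\<tau> \<in> \<Gamma>" "conj \<tau> = translation 1 \<or> conj \<tau> = - translation 1"
proof -
  have "translation (of_int 1) \<in> conj ` stabilizer \<Gamma> a \<union> uminus ` conj ` stabilizer \<Gamma> a"
    using scaling unfolding scaling_matrix_def Let_def conj_def[abs_def] by blast
  then show ?thesis using that by (force simp: stabilizer_def)
qed

text \<open>The shift 0 is split off because \<open>periodic_cuspidal\<close> requires a nonzero
  period.\<close>

lemma primitive_\<sigma>_periodic:
  assumes f: "cusp_form2 \<Gamma> f" and F: "\<And>z. z \<in> upper_half \<Longrightarrow> (F has_field_derivative f z) (at z)"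
    and \<gamma>: "\<gamma> \<in> stabilizer \<Gamma> a" and z: "z \<in> upper_half"
  shows "F (moebius_act \<sigma> (z + of_real (conj \<gamma> $1$2 / conj \<gamma> $2$2))) = F (moebius_act \<sigma> z)"
proof (cases "conj \<gamma> $1$2 = 0")
  case False
  have g: "\<gamma> \<in> \<Gamma>" using \<gamma> by (simp add: stabilizer_def)
  obtain k where k: "conj \<gamma> = translation (of_int k) \<or> conj \<gamma> = - translation (of_int k)"
    using conj_stabilizer[OF \<gamma>] .
  interpret periodic_cuspidal "slash2 f \<sigma>" "\<lambda>z. F (moebius_act \<sigma> z)" "conj \<gamma> $1$2 / conj \<gamma> $2$2"
  proof (rule cusp_form2_periodic_cuspidal)
    show "moebius_ext \<sigma> Infty \<in> cusps \<Gamma>" using cusp \<sigma>_Infty by simp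
    show "\<gamma> ** \<sigma> = \<sigma> ** conj \<gamma>" by (simp add: conj_inverse)
    show "det (conj \<gamma>) = 1" using g by (simp add: det_\<Gamma>)
    show "conj \<gamma> $2$1 = 0" "conj \<gamma> $1$1 = conj \<gamma> $2$2" using k by auto
  qed (fact subgroup.subset[OF subgroup] f F g False det_\<sigma>)+
  show ?thesis using z by (rule primitive_periodic)
qed simp

text \<open>With the base point \<sigma> i, the action of \<gamma> becomes a horizontal shift in the
  coordinate at the cusp, along which the primitive is periodic.\<close>

lemma modular_symbol_stabilizer:
  assumes f: "cusp_form2 \<Gamma> f" and \<gamma>: "\<gamma> \<in> stabilizer \<Gamma> a"
  shows "modular_symbol \<gamma> f = 0"
proof -
  obtain F where F: "\<And>z. z \<in> upper_half \<Longrightarrow> (F has_field_derivative f z) (at z)"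
    using upper_half_primitive f by (auto simp: cusp_form2_def)
  have g: "\<gamma> \<in> \<Gamma>" using \<gamma> by (simp add: stabilizer_def)
  obtain k where k: "conj \<gamma> = translation (of_int k) \<or> conj \<gamma> = - translation (of_int k)"
    using conj_stabilizer[OF \<gamma>] .
  have det: "det \<gamma> = 1" "det (conj \<gamma>) = 1" using g by (auto simp: det_\<Gamma>)
  have \<sigma>i: "moebius_act \<sigma> \<i> \<in> upper_half" by (rule moebius_upper_half) auto
  have "moebius_act \<gamma> (moebius_act \<sigma> \<i>) = moebius_act (\<sigma> ** conj \<gamma>) \<i>"
    by (simp add: conj_inverse moebius_act_mult)
  also have "\<dots> = moebius_act \<sigma> (\<i> + of_real (conj \<gamma> $1$2 / conj \<gamma> $2$2))"
  proof -
    have "moebius_act (conj \<gamma>) \<i> = \<i> + of_real (conj \<gamma> $1$2 / conj \<gamma> $2$2)"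
      using det(2) k by (intro moebius_act_upper_triangular) auto
    then show ?thesis using det(2) by (simp only: moebius_act_mult ii_upper_half)
  qed
  finally have "F (moebius_act \<gamma> (moebius_act \<sigma> \<i>)) = F (moebius_act \<sigma> \<i>)"
    using primitive_\<sigma>_periodic[OF f F \<gamma>, of \<i>] by simp
  moreover have "modular_symbol \<gamma> f = F (moebius_act \<gamma> (moebius_act \<sigma> \<i>)) - F (moebius_act \<sigma> \<i>)"
    using F _ det(1) \<sigma>i by (rule modular_symbol_primitive) (use f g in \<open>auto simp: cusp_form2_def\<close>)
  ultimately show ?thesis by simp
qed

lemma Im_row_ii:
  assumes "\<gamma> \<in> \<Gamma>"
  shows "Im (moebius_act (SL_inv \<sigma> ** \<gamma>) \<i>) = 1 / ((SL_inv \<sigma> ** \<gamma>)$2$1 ^ 2 + (SL_inv \<sigma> ** \<gamma>)$2$2 ^ 2)"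
  using assms by (subst Im_moebius) (simp_all add: det_mul det_\<Gamma> cocycle_def cmod_def add.commute)

text \<open>Writing \<gamma> i = \<sigma> w with w = \<sigma>^-1 \<gamma> i reduces the claim to
  \<open>periodic_log_growth\<close> in the coordinate at the cusp. The constant c pays for moving
  the base point from i to \<sigma> i, and the added 1 makes K positive.\<close>

lemma modular_symbol_bound:
  assumes f: "cusp_form2 \<Gamma> f" and bound: "\<And>z. z \<in> upper_half \<Longrightarrow> Im z * cmod (f z) \<le> C"
  obtains K where "K > 0"
    "\<And>\<gamma>. \<gamma> \<in> \<Gamma> \<Longrightarrow> cmod (modular_symbol \<gamma> f) \<le> K * (1 + \<bar>ln (Im (moebius_act (SL_inv \<sigma> ** \<gamma>) \<i>))\<bar>)"
proof -
  obtain F where F: "\<And>z. z \<in> upper_half \<Longrightarrow> (F has_field_derivative f z) (at z)"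
    using upper_half_primitive f by (auto simp: cusp_form2_def)
  obtain \<tau> where \<tau>: "\<tau> \<in> \<Gamma>" "conj \<tau> = translation 1 \<or> conj \<tau> = - translation 1"
    using conj_generator .
  have \<tau>s: "\<tau> \<in> stabilizer \<Gamma> a" and one: "conj \<tau> $1$2 / conj \<tau> $2$2 = 1"
    using \<tau> by (auto simp: stabilizer_iff)
  define c where "c = cmod (F (moebius_act \<sigma> \<i>) - F \<i>)"
  show ?thesis
  proof
    show "\<bar>C\<bar> + c + 1 > 0" by (simp add: c_def add_nonneg_pos)
    fix \<gamma> assume g: "\<gamma> \<in> \<Gamma>"
    define w where "w = moebius_act (SL_inv \<sigma> ** \<gamma>) \<i>"
    have w: "w \<in> upper_half"
      unfolding w_def using g by (intro moebius_upper_half) (auto simp: det_mul det_\<Gamma>)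
    have "moebius_act \<sigma> w = moebius_act (\<sigma> ** (SL_inv \<sigma> ** \<gamma>)) \<i>"
      unfolding w_def using g by (subst (2) moebius_act_mult) (auto simp: det_mul det_\<Gamma>)
    then have gi: "moebius_act \<gamma> \<i> = moebius_act \<sigma> w" by simp
    have "cmod (F (moebius_act \<sigma> w) - F (moebius_act \<sigma> \<i>)) \<le> C * (1 + \<bar>ln (Im w)\<bar>)"
    proof (rule periodic_log_growth[where \<Phi> = "\<lambda>z. F (moebius_act \<sigma> z)" and \<phi> = "slash2 f \<sigma>"])
      fix z assume z: "z \<in> upper_half"
      show "((\<lambda>z. F (moebius_act \<sigma> z)) has_field_derivative slash2 f \<sigma> z) (at z)"
        using F det_\<sigma> z by (rule primitive_moebius_act)
      show "Im z * cmod (slash2 f \<sigma> z) \<le> C"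
        using z by (simp add: norm_slash2 bound moebius_upper_half)
      show "F (moebius_act \<sigma> (z + 1)) = F (moebius_act \<sigma> z)"
        using primitive_\<sigma>_periodic[OF f F \<tau>s z] one by simp
    qed (rule w)
    also have "\<dots> \<le> \<bar>C\<bar> * (1 + \<bar>ln (Im w)\<bar>)" by (intro mult_right_mono) auto
    finally have 1: "cmod (F (moebius_act \<sigma> w) - F (moebius_act \<sigma> \<i>)) \<le> \<bar>C\<bar> * (1 + \<bar>ln (Im w)\<bar>)" .
    have "modular_symbol \<gamma> f = F (moebius_act \<gamma> \<i>) - F \<i>"
      using F _ det_\<Gamma>[OF g] ii_upper_half
      by (rule modular_symbol_primitive) (use f g in \<open>auto simp: cusp_form2_def\<close>)
    then have "cmod (modular_symbol \<gamma> f) \<le> cmod (F (moebius_act \<sigma> w) - F (moebius_act \<sigma> \<i>)) + c"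
      using norm_triangle_ineq[of "F (moebius_act \<sigma> w) - F (moebius_act \<sigma> \<i>)" "F (moebius_act \<sigma> \<i>) - F \<i>"]
      by (simp add: gi c_def)
    also have "\<dots> \<le> \<bar>C\<bar> * (1 + \<bar>ln (Im w)\<bar>) + (c + 1) * 1" using 1 by simp
    also have "\<dots> \<le> \<bar>C\<bar> * (1 + \<bar>ln (Im w)\<bar>) + (c + 1) * (1 + \<bar>ln (Im w)\<bar>)"
      by (intro add_left_mono mult_left_mono) (auto simp: c_def)
    also have "\<dots> = (\<bar>C\<bar> + c + 1) * (1 + \<bar>ln (Im w)\<bar>)" by (simp add: algebra_simps)
    finally show "cmod (modular_symbol \<gamma> f) \<le> (\<bar>C\<bar> + c + 1) * (1 + \<bar>ln (Im (moebius_act (SL_inv \<sigma> ** \<gamma>) \<i>))\<bar>)"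
      by (simp add: w_def)
  qed
qed

end

section \<open>Counting bottom rows\<close>

text \<open>Below size R the slopes t x lie in [-1, 1] at mutual distance at least 1 / R^2. After
  scaling by R^2 they have distinct floors, and there are at most 2 R^2 + 2 candidates.\<close>

lemma separated_card:
  fixes c t :: "'a \<Rightarrow> real"
  assumes sep: "\<And>x y. x \<in> F \<Longrightarrow> y \<in> F \<Longrightarrow> x \<noteq> y \<Longrightarrow> \<bar>t x - t y\<bar> * (c x * c y) \<ge> 1"
    and t: "\<And>x. x \<in> F \<Longrightarrow> \<bar>t x\<bar> \<le> 1" and c: "\<And>x. x \<in> F \<Longrightarrow> 0 < c x \<and> c x < R"
  shows "real (card F) \<le> 2 * R\<^sup>2 + 2"
proof (cases "F = {}")
  case False
  then have R: "R > 0" using c by force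
  have "inj_on (\<lambda>x. \<lfloor>t x * R\<^sup>2\<rfloor>) F"
  proof (rule inj_onI, rule ccontr)
    fix x y assume x: "x \<in> F" and y: "y \<in> F" and eq: "\<lfloor>t x * R\<^sup>2\<rfloor> = \<lfloor>t y * R\<^sup>2\<rfloor>" and "x \<noteq> y"
    have "c x * c y \<le> R * R" using c[OF x] c[OF y] by (intro mult_mono) auto
    then have "\<bar>t x - t y\<bar> * (c x * c y) \<le> \<bar>t x - t y\<bar> * R\<^sup>2"
      unfolding power2_eq_square by (rule mult_left_mono) auto
    then have "1 \<le> \<bar>t x - t y\<bar> * R\<^sup>2" using sep[OF x y \<open>x \<noteq> y\<close>] by simp
    then have "1 \<le> \<bar>t x * R\<^sup>2 - t y * R\<^sup>2\<bar>" by (simp add: abs_mult flip: left_diff_distrib)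
    then show False using eq by linarith
  qed
  moreover have "(\<lambda>x. \<lfloor>t x * R\<^sup>2\<rfloor>) ` F \<subseteq> {\<lfloor>-(R\<^sup>2)\<rfloor>..\<lfloor>R\<^sup>2\<rfloor>}"
  proof
    fix i assume "i \<in> (\<lambda>x. \<lfloor>t x * R\<^sup>2\<rfloor>) ` F"
    then obtain x where x: "x \<in> F" "i = \<lfloor>t x * R\<^sup>2\<rfloor>" by blast
    have "\<bar>t x\<bar> * R\<^sup>2 \<le> 1 * R\<^sup>2" using t[OF x(1)] by (rule mult_right_mono) auto
    then have "\<bar>t x * R\<^sup>2\<bar> \<le> R\<^sup>2" by (simp add: abs_mult)
    then show "i \<in> {\<lfloor>-(R\<^sup>2)\<rfloor>..\<lfloor>R\<^sup>2\<rfloor>}" unfolding x(2) by (auto intro!: floor_mono)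
  qed
  ultimately have "card F \<le> card {\<lfloor>-(R\<^sup>2)\<rfloor>..\<lfloor>R\<^sup>2\<rfloor>}"
    by (metis card_image card_mono finite_atLeastAtMost_int)
  have "int (card F) \<le> \<lfloor>R\<^sup>2\<rfloor> - \<lfloor>-(R\<^sup>2)\<rfloor> + 1"
  proof -
    have "\<lfloor>R\<^sup>2\<rfloor> \<ge> 0" by simp
    moreover have "\<lfloor>-(R\<^sup>2)\<rfloor> \<le> \<lfloor>0::real\<rfloor>" by (rule floor_mono) simp
    ultimately have "0 \<le> \<lfloor>R\<^sup>2\<rfloor> - \<lfloor>-(R\<^sup>2)\<rfloor> + 1"
      unfolding floor_zero by linarith
    then show ?thesis using \<open>card F \<le> card {\<lfloor>-(R\<^sup>2)\<rfloor>..\<lfloor>R\<^sup>2\<rfloor>}\<close>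
      unfolding card_atLeastAtMost_int by (simp add: le_nat_iff)
  qed
  then have "real (card F) \<le> real_of_int (\<lfloor>R\<^sup>2\<rfloor> - \<lfloor>-(R\<^sup>2)\<rfloor> + 1)" by linarith
  then show ?thesis by linarith
qed simp

text \<open>Dyadic decomposition in c: the count is quadratic in the size, so an exponent beyond 2
  suffices.\<close>

lemma separated_summable:
  fixes c t :: "'a \<Rightarrow> real"
  assumes sep: "\<And>x y. x \<in> X \<Longrightarrow> y \<in> X \<Longrightarrow> x \<noteq> y \<Longrightarrow> \<bar>t x - t y\<bar> * (c x * c y) \<ge> 1"
    and t: "\<And>x. x \<in> X \<Longrightarrow> \<bar>t x\<bar> \<le> 1" and c: "\<And>x. x \<in> X \<Longrightarrow> 0 < c x" and q: "q > 2"
  shows "(\<lambda>x. c x powr - q) summable_on X"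
proof -
  have "finite {x \<in> X. c x < 1}"
  proof (rule ccontr)
    \<comment> \<open>For R = 1 the count allows at most 4 elements, so 5 of them give a
      contradiction.\<close>
    assume "infinite {x \<in> X. c x < 1}"
    then obtain F where F: "F \<subseteq> {x \<in> X. c x < 1}" "card F = 5" "finite F"
      using infinite_arbitrarily_large by blast
    have "real (card F) \<le> 2 * 1\<^sup>2 + 2"
      using F(1) by (intro separated_card[where c = c and t = t]) (auto intro: sep t c)
    then show False using F by simp
  qed
  then have 1: "(\<lambda>x. c x powr - q) summable_on {x \<in> X. c x < 1}" by simp
  \<comment> \<open>The block of c between 2^j and 2^(j+1) has at most 2 * 4^(j+1) + 2, hence at
    most 10 * 4^j elements, each contributing at most 2^(-q j). The ratio \<rho> is below 1 because
    q > 2.\<close>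
  define \<rho> where "\<rho> = 4 * 2 powr - q"
  have "2 powr - q < 2 powr - 2" using q by (intro powr_less_mono) auto
  then have \<rho>: "0 < \<rho>" "\<rho> < 1" by (auto simp: \<rho>_def powr_minus)
  have geo: "summable (\<lambda>k. 10 * \<rho> ^ k)" using \<rho> by (intro summable_mult summable_geometric) auto
  have 2: "(\<lambda>x. c x powr - q) summable_on {x \<in> X. c x \<ge> 1}"
  proof (rule nonneg_bdd_above_summable_on)
    show "bdd_above (sum (\<lambda>x. c x powr - q) ` {F. F \<subseteq> {x \<in> X. c x \<ge> 1} \<and> finite F})"
    proof (rule bdd_aboveI2)
      fix F assume "F \<in> {F. F \<subseteq> {x \<in> X. c x \<ge> 1} \<and> finite F}"
      then have F: "F \<subseteq> X" "\<And>x. x \<in> F \<Longrightarrow> c x \<ge> 1" "finite F" by auto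
      define k where "k x = nat \<lfloor>log 2 (c x)\<rfloor>" for x
      have k: "2 ^ k x \<le> c x" "c x < 2 ^ Suc (k x)" if "x \<in> F" for x
      proof -
        have pos: "c x > 0" "log 2 (c x) \<ge> 0" using F(2)[OF that] by (auto simp: zero_le_log_cancel_iff)
        have "real (k x) = of_int \<lfloor>log 2 (c x)\<rfloor>" using pos by (simp add: k_def)
        then have "real (k x) \<le> log 2 (c x)" "log 2 (c x) < real (Suc (k x))" by linarith+
        then show "2 ^ k x \<le> c x" "c x < 2 ^ Suc (k x)"
          using pos by (simp_all add: le_log_iff log_less_iff powr_realpow powr_add del: of_nat_Suc power_Suc)
      qed
      have fibre: "(\<Sum>x | x \<in> F \<and> k x = j. c x powr - q) \<le> 10 * \<rho> ^ j" for j
      proof -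
        have "real (card {x. x \<in> F \<and> k x = j}) \<le> 2 * (2 ^ Suc j)\<^sup>2 + 2"
          using F(1) k by (intro separated_card[where c = c and t = t]) (auto intro: sep t c)
        also have "(2 ^ Suc j)\<^sup>2 = 4 * (4::real) ^ j" by (induction j) (auto simp: power_mult_distrib)
        also have "2 * (4 * (4::real) ^ j) + 2 \<le> 10 * 4 ^ j" using one_le_power[of "4::real" j] by simp
        finally have card: "real (card {x. x \<in> F \<and> k x = j}) \<le> 10 * 4 ^ j" .
        have "(\<Sum>x | x \<in> F \<and> k x = j. c x powr - q) \<le> (\<Sum>x | x \<in> F \<and> k x = j. (2 ^ j) powr - q)"
          using k q by (intro sum_mono powr_mono2') auto
        also have "\<dots> = real (card {x. x \<in> F \<and> k x = j}) * (2 ^ j) powr - q" by simp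
        also have "\<dots> \<le> (10 * 4 ^ j) * (2 ^ j) powr - q" using card by (rule mult_right_mono) auto
        also have "((2::real) ^ j) powr - q = (2 powr real j) powr - q" by (simp add: powr_realpow)
        also have "\<dots> = (2 powr - q) powr real j" by (simp add: powr_powr mult.commute)
        also have "\<dots> = (2 powr - q) ^ j" by (rule powr_realpow) simp
        finally show ?thesis by (simp add: \<rho>_def power_mult_distrib)
      qed
      have "(\<Sum>x\<in>F. c x powr - q) = (\<Sum>j\<in>k ` F. \<Sum>x | x \<in> F \<and> k x = j. c x powr - q)"
        by (rule sum.image_gen[OF F(3)])
      also have "\<dots> \<le> (\<Sum>j\<in>k ` F. 10 * \<rho> ^ j)" by (intro sum_mono fibre)
      also have "\<dots> \<le> (\<Sum>j. 10 * \<rho> ^ j)"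
        using F(3) \<rho> by (intro sum_le_suminf geo) auto
      finally show "(\<Sum>x\<in>F. c x powr - q) \<le> (\<Sum>j. 10 * \<rho> ^ j)" .
    qed
  qed auto
  have "X = {x \<in> X. c x < 1} \<union> {x \<in> X. c x \<ge> 1}" by auto
  moreover have "{x \<in> X. c x < 1} \<inter> {x \<in> X. c x \<ge> 1} = {}" by auto
  ultimately show ?thesis using summable_on_Un_disjoint[OF 1 2] by metis
qed

text \<open>Where |d| is at most |c|, the slope d / c lies in [-1, 1], and slope difference times c
  c' is the determinant up to sign. The square in the norm turns p > 1 into the exponent 2 p > 2.
  The inner fact \<open>part\<close> is stated for arbitrary c and d so that it also covers the
  other half with the coordinates swapped.\<close>

lemma separated_vectors_summable:
  fixes c d :: "'a \<Rightarrow> real"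
  assumes sep: "\<And>x y. x \<in> X \<Longrightarrow> y \<in> X \<Longrightarrow> x \<noteq> y \<Longrightarrow> \<bar>c x * d y - d x * c y\<bar> \<ge> 1"
    and nz: "\<And>x. x \<in> X \<Longrightarrow> (c x)\<^sup>2 + (d x)\<^sup>2 > 0" and p: "p > 1"
  shows "(\<lambda>x. ((c x)\<^sup>2 + (d x)\<^sup>2) powr - p) summable_on X"
proof -
  have part: "(\<lambda>x. ((c x)\<^sup>2 + (d x)\<^sup>2) powr - p) summable_on {x \<in> X. c x \<noteq> 0 \<and> \<bar>d x\<bar> \<le> \<bar>c x\<bar>}"
    if sep: "\<And>x y. x \<in> X \<Longrightarrow> y \<in> X \<Longrightarrow> x \<noteq> y \<Longrightarrow> \<bar>c x * d y - d x * c y\<bar> \<ge> 1"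
    for c d :: "'a \<Rightarrow> real"
  proof (rule summable_on_comparison_test)
    show "(\<lambda>x. \<bar>c x\<bar> powr - (2 * p)) summable_on {x \<in> X. c x \<noteq> 0 \<and> \<bar>d x\<bar> \<le> \<bar>c x\<bar>}"
    proof (rule separated_summable[where t = "\<lambda>x. d x / c x"])
      fix x y assume x: "x \<in> {x \<in> X. c x \<noteq> 0 \<and> \<bar>d x\<bar> \<le> \<bar>c x\<bar>}"
        and y: "y \<in> {x \<in> X. c x \<noteq> 0 \<and> \<bar>d x\<bar> \<le> \<bar>c x\<bar>}" and "x \<noteq> y"
      have "(d x / c x - d y / c y) * (c x * c y) = - (c x * d y - d x * c y)"
        using x y by (simp add: field_simps)
      then have "\<bar>d x / c x - d y / c y\<bar> * (\<bar>c x\<bar> * \<bar>c y\<bar>) = \<bar>c x * d y - d x * c y\<bar>"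
        by (metis abs_minus_cancel abs_mult)
      then show "1 \<le> \<bar>d x / c x - d y / c y\<bar> * (\<bar>c x\<bar> * \<bar>c y\<bar>)" using sep x y \<open>x \<noteq> y\<close> by auto
    qed (use p in auto)
    fix x assume x: "x \<in> {x \<in> X. c x \<noteq> 0 \<and> \<bar>d x\<bar> \<le> \<bar>c x\<bar>}"
    then have "((c x)\<^sup>2 + (d x)\<^sup>2) powr - p \<le> ((c x)\<^sup>2) powr - p"
      using p by (intro powr_mono2') auto
    also have "((c x)\<^sup>2) powr - p = (\<bar>c x\<bar> powr 2) powr - p" by simp
    also have "(\<bar>c x\<bar> powr 2) powr - p = \<bar>c x\<bar> powr - (2 * p)" by (simp only: powr_powr mult_minus_right)
    finally show "((c x)\<^sup>2 + (d x)\<^sup>2) powr - p \<le> \<bar>c x\<bar> powr - (2 * p)" .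
  qed auto
  have 1: "(\<lambda>x. ((c x)\<^sup>2 + (d x)\<^sup>2) powr - p) summable_on {x \<in> X. c x \<noteq> 0 \<and> \<bar>d x\<bar> \<le> \<bar>c x\<bar>}"
    using sep by (rule part)
  have "(\<lambda>x. ((d x)\<^sup>2 + (c x)\<^sup>2) powr - p) summable_on {x \<in> X. d x \<noteq> 0 \<and> \<bar>c x\<bar> \<le> \<bar>d x\<bar>}"
    using sep by (intro part) (simp add: abs_minus_commute mult.commute)
  then have 2: "(\<lambda>x. ((c x)\<^sup>2 + (d x)\<^sup>2) powr - p) summable_on {x \<in> X. \<bar>c x\<bar> < \<bar>d x\<bar>}"
    unfolding add.commute[of "(d _)\<^sup>2"] by (rule summable_on_subset_banach) auto
  have "X = {x \<in> X. c x \<noteq> 0 \<and> \<bar>d x\<bar> \<le> \<bar>c x\<bar>} \<union> {x \<in> X. \<bar>c x\<bar> < \<bar>d x\<bar>}"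
  proof (rule equalityI; rule subsetI)
    fix x assume "x \<in> X"
    then show "x \<in> {x \<in> X. c x \<noteq> 0 \<and> \<bar>d x\<bar> \<le> \<bar>c x\<bar>} \<union> {x \<in> X. \<bar>c x\<bar> < \<bar>d x\<bar>}"
      using nz[of x] by (cases "c x = 0") auto
  qed auto
  moreover have "{x \<in> X. c x \<noteq> 0 \<and> \<bar>d x\<bar> \<le> \<bar>c x\<bar>} \<inter> {x \<in> X. \<bar>c x\<bar> < \<bar>d x\<bar>} = {}" by auto
  ultimately show ?thesis using summable_on_Un_disjoint[OF 1 2] by metis
qed

section \<open>Logarithmic weights in the sum over bottom rows\<close>

lemma abs_ln_le_powr:
  assumes "(x::real) > 0" "\<eta> > 0"
  shows "\<bar>ln x\<bar> \<le> (x powr \<eta> + x powr - \<eta>) / \<eta>"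
proof -
  have "\<eta> * ln x \<le> x powr \<eta>" "- \<eta> * ln x \<le> x powr - \<eta>"
    using ln_le_minus_one[of "x powr \<eta>"] ln_le_minus_one[of "x powr - \<eta>"] assms
    by (simp_all add: ln_powr)
  moreover have "x powr \<eta> \<ge> 0" "x powr - \<eta> \<ge> 0" by simp_all
  ultimately have "\<eta> * \<bar>ln x\<bar> \<le> x powr \<eta> + x powr - \<eta>"
    by (smt (verit) mult_minus_left mult_minus_right)
  then show ?thesis using assms by (simp add: field_simps)
qed

text \<open>A power of the logarithm costs an arbitrarily small power of x. Two exponents appear
  because x may be close to 0 as well as large.\<close>

lemma log_weight_bound:
  assumes "p > (1::real)"
  obtains q1 q2 K where "q1 > 1" "q2 > 1"
    "\<And>x. x > 0 \<Longrightarrow> (1 + \<bar>ln x\<bar>) ^ M * x powr - p \<le> K * (x powr - q1 + x powr - q2)"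
proof -
  \<comment> \<open>Chosen so that \<eta> * M is at most (p - 1) / 2, which keeps p - \<eta> * M
    above 1. The summand 1 in the denominator covers M = 0.\<close>
  define \<eta> where "\<eta> = (p - 1) / (2 * (real M + 1))"
  have \<eta>: "\<eta> > 0" using assms by (simp add: \<eta>_def)
  have "real M * (p - 1) \<le> (real M + 1) * (p - 1)" using assms by simp
  then have "\<eta> * real M \<le> (p - 1) / 2" by (simp add: \<eta>_def field_simps)
  then have q1: "p - \<eta> * M > 1" using assms by simp
  have "\<eta> * M \<ge> 0" using \<eta> by simp
  then have q2: "p + \<eta> * M > 1" using assms by simp
  show ?thesis
  proof
    fix x :: real assume x: "x > 0"
    define u v where "u = x powr \<eta>" and "v = x powr - \<eta>"
    have uv: "u > 0" "v > 0" using x by (auto simp: u_def v_def)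
    have "u \<ge> 1 \<or> v \<ge> 1"
      using x \<eta> by (cases "x \<ge> 1") (auto simp: u_def v_def powr_minus ge_one_powr_ge_zero powr_le1 one_le_inverse_iff)
    then have "1 \<le> u + v" using uv by linarith
    moreover have "\<bar>ln x\<bar> \<le> (u + v) / \<eta>" unfolding u_def v_def using x \<eta> by (rule abs_ln_le_powr)
    ultimately have "1 + \<bar>ln x\<bar> \<le> (1 + 1 / \<eta>) * (u + v)" by (simp add: algebra_simps)
    also have "\<dots> \<le> (1 + 1 / \<eta>) * (2 * max u v)" using \<eta> by (intro mult_left_mono) auto
    finally have "(1 + \<bar>ln x\<bar>) ^ M \<le> ((1 + 1 / \<eta>) * (2 * max u v)) ^ M" by (rule power_mono) simp
    also have "\<dots> = (2 * (1 + 1 / \<eta>)) ^ M * (max u v) ^ M" by (simp only: power_mult_distrib mult_ac)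
    also have "\<dots> \<le> (2 * (1 + 1 / \<eta>)) ^ M * (u ^ M + v ^ M)"
      using \<eta> uv by (intro mult_left_mono) (auto simp: max_def)
    finally have "(1 + \<bar>ln x\<bar>) ^ M * x powr - p \<le> (2 * (1 + 1 / \<eta>)) ^ M * (u ^ M + v ^ M) * x powr - p"
      by (rule mult_right_mono) simp
    also have "\<dots> = (2 * (1 + 1 / \<eta>)) ^ M * (u ^ M * x powr - p + v ^ M * x powr - p)"
      by (simp only: distrib_right mult.assoc)
    also have "u ^ M * x powr - p = x powr - (p - \<eta> * M)"
      unfolding powr_realpow[OF uv(1), symmetric] by (simp add: u_def powr_powr flip: powr_add)
    also have "v ^ M * x powr - p = x powr - (p + \<eta> * M)"
      unfolding powr_realpow[OF uv(2), symmetric] by (simp add: v_def powr_powr add.commute flip: powr_add)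
    finally show "(1 + \<bar>ln x\<bar>) ^ M * x powr - p
        \<le> (2 * (1 + 1 / \<eta>)) ^ M * (x powr - (p - \<eta> * M) + x powr - (p + \<eta> * M))" .
  qed (use q1 q2 in auto)
qed

lemma separated_vectors_log_summable:
  fixes c d :: "'a \<Rightarrow> real"
  assumes sep: "\<And>x y. x \<in> X \<Longrightarrow> y \<in> X \<Longrightarrow> x \<noteq> y \<Longrightarrow> \<bar>c x * d y - d x * c y\<bar> \<ge> 1"
    and nz: "\<And>x. x \<in> X \<Longrightarrow> (c x)\<^sup>2 + (d x)\<^sup>2 > 0" and p: "p > 1"
  shows "(\<lambda>x. (1 + \<bar>ln ((c x)\<^sup>2 + (d x)\<^sup>2)\<bar>) ^ M * ((c x)\<^sup>2 + (d x)\<^sup>2) powr - p) summable_on X"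
proof -
  obtain q1 q2 K where q: "q1 > 1" "q2 > 1"
    and K: "\<And>x. x > 0 \<Longrightarrow> (1 + \<bar>ln x\<bar>) ^ M * x powr - p \<le> K * (x powr - q1 + x powr - q2)"
    using log_weight_bound[OF p, where M = M] by blast
  show ?thesis
  proof (rule summable_on_comparison_test)
    show "(\<lambda>x. K * (((c x)\<^sup>2 + (d x)\<^sup>2) powr - q1 + ((c x)\<^sup>2 + (d x)\<^sup>2) powr - q2)) summable_on X"
      using sep nz q
      by (intro summable_on_cmult_right summable_on_add separated_vectors_summable[where c = c and d = d]) auto
  qed (use K nz in auto)
qed

section \<open>Shimizu's lemma\<close>

context scaled_cusp
begin

lemma conj_inv:
  assumes "\<gamma> \<in> \<Gamma>"
  shows "conj (SL_inv \<gamma>) = SL_inv (conj \<gamma>)"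
proof -
  have "conj (SL_inv \<gamma>) ** conj \<gamma> = Finite_Cartesian_Product.mat 1"
    using assms by (simp add: det_\<Gamma> flip: conj_mult) (simp add: conj_def)
  then have "conj (SL_inv \<gamma>) ** conj \<gamma> ** SL_inv (conj \<gamma>) = SL_inv (conj \<gamma>)" by simp
  then show ?thesis using assms by (simp add: det_\<Gamma>)
qed

text \<open>Otherwise the iteration \<open>\<gamma> \<mapsto> \<gamma> \<tau> \<gamma>\<^sup>-\<^sup>1\<close>, with \<open>\<tau>\<close> conjugate to
  \<open>\<plusminus> translation 1\<close>, converges to \<open>\<tau>\<close> without reaching it.\<close>

lemma shimizu:
  assumes \<gamma>: "\<gamma> \<in> \<Gamma>" and nz: "conj \<gamma> $2$1 \<noteq> 0"
  shows "\<bar>conj \<gamma> $2$1\<bar> \<ge> 1"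
proof (rule ccontr)
  assume "\<not> ?thesis"
  then have lt: "\<bar>conj \<gamma> $2$1\<bar> < 1" by simp
  obtain \<tau> where \<tau>: "\<tau> \<in> \<Gamma>" "conj \<tau> = translation 1 \<or> conj \<tau> = - translation 1"
    using conj_generator .
  define \<epsilon> where "\<epsilon> = conj \<tau> $1$1"
  have \<epsilon>: "\<bar>\<epsilon>\<bar> = 1" and T: "conj \<tau> $1$1 = \<epsilon>" "conj \<tau> $1$2 = \<epsilon>" "conj \<tau> $2$1 = 0" "conj \<tau> $2$2 = \<epsilon>"
    using \<tau>(2) by (auto simp: \<epsilon>_def)
  define g where "g = rec_nat \<gamma> (\<lambda>_ x. x ** \<tau> ** SL_inv x)"
  have g_0: "g 0 = \<gamma>" and g_Suc: "g (Suc n) = g n ** \<tau> ** SL_inv (g n)" for n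
    by (simp_all add: g_def)
  have g: "g n \<in> \<Gamma>" for n
    by (induction n) (simp_all add: g_0 g_Suc \<gamma> \<tau> mult_\<Gamma> inv_\<Gamma>)
  define A C where "A n = conj (g n) $1$1" and "C n = conj (g n) $2$1" for n
  have d: "conj (g n) $1$1 * conj (g n) $2$2 - conj (g n) $1$2 * conj (g n) $2$1 = 1" for n
    using det_conj[OF det_\<Gamma>[OF g[of n]]] by (simp add: det_2)
  have conj_Suc: "conj (g (Suc n)) = conj (g n) ** conj \<tau> ** SL_inv (conj (g n))" for n
    by (simp add: g_Suc conj_mult conj_inv[OF g])
  note entries = conj_Suc matrix_mult_2 SL_inv_entries[OF det_conj[OF det_\<Gamma>[OF g]]] T
  \<comment> \<open>The matrix conj \<tau> is \<epsilon> * (I + N) with N the upper right matrix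
    unit, so only the first column (A, C) of conj (g n) enters the next iterate. In particular C is
    squared up to sign at each stage.\<close>
  have step: "conj (g (Suc n)) $1$1 = \<epsilon> * (1 - A n * C n)" "conj (g (Suc n)) $1$2 = \<epsilon> * (A n)\<^sup>2"
    "conj (g (Suc n)) $2$1 = - \<epsilon> * (C n)\<^sup>2" "conj (g (Suc n)) $2$2 = \<epsilon> * (1 + A n * C n)" for n
    using d[of n] unfolding A_def C_def power2_eq_square by (simp_all add: entries algebra_simps)
  have C_nz: "C n \<noteq> 0" for n
    by (induction n) (use nz \<epsilon> in \<open>auto simp: C_def g_0 step\<close>)
  have C_abs: "\<bar>C n\<bar> = \<bar>C 0\<bar> ^ (2 ^ n)" for n
  proof (induction n)
    case (Suc n)
    have eq: "\<bar>C (Suc n)\<bar> = \<bar>C n\<bar>\<^sup>2" using \<epsilon> unfolding C_def step by (simp add: abs_mult C_def)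
    show ?case by (simp only: eq Suc power_mult[symmetric] power_Suc mult.commute[of 2])
  qed simp
  have C0: "\<bar>C 0\<bar> < 1" using lt by (simp add: C_def g_0)
  have C_le: "\<bar>C n\<bar> \<le> \<bar>C 0\<bar> ^ n" for n
    unfolding C_abs[of n] using C0 less_exp[of n] by (intro power_decreasing) auto
  \<comment> \<open>Linear growth of A against geometric decay of C gives A n * C n \<rightarrow> 0.
    Then A tends to \<epsilon>, and all four entries of the next iterate converge.\<close>
  have A_le: "\<bar>A n\<bar> \<le> \<bar>A 0\<bar> + n" for n
  proof (induction n)
    case (Suc n)
    have "\<bar>C n\<bar> \<le> 1" using C_le[of n] power_le_one[of "\<bar>C 0\<bar>" n] C0 by simp
    then have "\<bar>A n\<bar> * \<bar>C n\<bar> \<le> \<bar>A n\<bar>" by (intro mult_left_le) auto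
    moreover have "\<bar>A (Suc n)\<bar> \<le> 1 + \<bar>A n\<bar> * \<bar>C n\<bar>"
      using \<epsilon> abs_triangle_ineq4[of 1 "A n * C n"] unfolding A_def step by (simp add: abs_mult A_def)
    ultimately show ?case using Suc by simp
  qed simp
  have AC: "(\<lambda>n. A n * C n) \<longlonglongrightarrow> 0"
  proof (rule Lim_null_comparison)
    have "norm (A n * C n) \<le> \<bar>A 0\<bar> * \<bar>C 0\<bar> ^ n + real n * \<bar>C 0\<bar> ^ n" for n
    proof -
      have "\<bar>A n\<bar> * \<bar>C n\<bar> \<le> (\<bar>A 0\<bar> + n) * \<bar>C 0\<bar> ^ n"
        using A_le C_le by (intro mult_mono) auto
      then show ?thesis by (simp add: abs_mult distrib_right)
    qed
    then show "\<forall>\<^sub>F n in sequentially. norm (A n * C n) \<le> \<bar>A 0\<bar> * \<bar>C 0\<bar> ^ n + real n * \<bar>C 0\<bar> ^ n"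
      by simp
    show "(\<lambda>n. \<bar>A 0\<bar> * \<bar>C 0\<bar> ^ n + real n * \<bar>C 0\<bar> ^ n) \<longlonglongrightarrow> 0"
      using C0 by (intro tendsto_add_zero tendsto_mult_right_zero LIMSEQ_power_zero powser_times_n_limit_0) auto
  qed
  have C_lim: "C \<longlonglongrightarrow> 0"
    using C_le C0 by (intro Lim_null_comparison[OF _ LIMSEQ_power_zero[of "\<bar>C 0\<bar>"]]) auto
  have "(\<lambda>n. conj (g (Suc n)) $1$1) \<longlonglongrightarrow> \<epsilon>"
    unfolding step
    using tendsto_mult[OF tendsto_const[of \<epsilon>] tendsto_diff[OF tendsto_const[of 1] AC]] by simp
  then have A_lim: "(\<lambda>n. A (Suc n)) \<longlonglongrightarrow> \<epsilon>" by (simp add: A_def)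
  then have A_lim': "A \<longlonglongrightarrow> \<epsilon>" by (rule LIMSEQ_imp_Suc)
  have \<epsilon>2: "\<epsilon> * \<epsilon>\<^sup>2 = \<epsilon>" using \<epsilon> by (metis abs_power2 mult.right_neutral one_power2 power2_abs)
  have lim: "(\<lambda>n. conj (g (Suc n)) $i$j) \<longlonglongrightarrow> conj \<tau> $i$j" for i j
  proof -
    have "(\<lambda>n. conj (g (Suc n)) $1$1) \<longlonglongrightarrow> conj \<tau> $1$1"
      using A_lim by (simp add: A_def T)
    moreover have "(\<lambda>n. conj (g (Suc n)) $1$2) \<longlonglongrightarrow> conj \<tau> $1$2"
      unfolding step T using tendsto_mult[OF tendsto_const[of \<epsilon>] tendsto_power[OF A_lim', of 2]] by (simp add: \<epsilon>2)
    moreover have "(\<lambda>n. conj (g (Suc n)) $2$1) \<longlonglongrightarrow> conj \<tau> $2$1"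
      unfolding step T using tendsto_mult[OF tendsto_const[of "- \<epsilon>"] tendsto_power[OF C_lim, of 2]] by simp
    moreover have "(\<lambda>n. conj (g (Suc n)) $2$2) \<longlonglongrightarrow> conj \<tau> $2$2"
      unfolding step T
      using tendsto_mult[OF tendsto_const[of \<epsilon>] tendsto_add[OF tendsto_const[of 1] AC]] by simp
    ultimately show ?thesis using exhaust_2[of i] exhaust_2[of j] by auto
  qed
  \<comment> \<open>Discreteness is a property of \<Gamma> itself, so the limit is carried back
    through the conjugation. There \<tau> is isolated and is eventually hit, against C n \<noteq>
    0.\<close>
  have "(\<lambda>n. \<sigma> ** conj (g (Suc n)) ** SL_inv \<sigma>) \<longlonglongrightarrow> \<sigma> ** conj \<tau> ** SL_inv \<sigma>"
    by (intro vec_tendstoI) (simp only: matrix_mult_2, intro tendsto_intros lim)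
  then have "(\<lambda>n. g (Suc n)) \<longlonglongrightarrow> \<tau>" by (simp only: conj_inverse(1))
  moreover obtain V where V: "open V" "V \<inter> \<Gamma> = {\<tau>}"
    using discreteD[OF discrete \<tau>(1)] by (auto simp: isolated_in_def)
  ultimately have "\<forall>\<^sub>F n in sequentially. g (Suc n) \<in> V"
    by (auto dest: topological_tendstoD)
  then obtain n where "g (Suc n) \<in> V" by (auto simp: eventually_sequentially)
  then have "g (Suc n) = \<tau>" using V(2) g by blast
  then show False using C_nz[of "Suc n"] T by (simp add: C_def)
qed

text \<open>The whole matrix \<sigma>^-1 \<gamma>, named after its bottom row: up to sign that row
  depends only on the coset of \<gamma>.\<close>

definition row :: "real^2^2 \<Rightarrow> real^2^2" where "row \<gamma> = SL_inv \<sigma> ** \<gamma>"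

text \<open>The determinant of the two bottom rows is the lower left entry of conj (\<gamma>
  \<delta>^-1), which \<open>shimizu\<close> bounds below once it is nonzero.\<close>

lemma row_separated:
  assumes "\<gamma> \<in> \<Gamma>" "\<delta> \<in> \<Gamma>" "\<gamma> ** SL_inv \<delta> \<notin> stabilizer \<Gamma> a"
  shows "\<bar>row \<gamma> $2$1 * row \<delta> $2$2 - row \<gamma> $2$2 * row \<delta> $2$1\<bar> \<ge> 1"
proof -
  let ?B = "conj (\<gamma> ** SL_inv \<delta>)"
  have B: "\<gamma> ** SL_inv \<delta> \<in> \<Gamma>" using assms by (simp add: mult_\<Gamma> inv_\<Gamma>)
  have eq: "row \<gamma> = ?B ** row \<delta>"
    using assms by (simp add: row_def conj_def det_\<Gamma> matrix_mul_assoc)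
  have "det (row \<delta>) = 1" using assms by (simp add: row_def det_mul det_\<Gamma>)
  moreover have "row \<gamma> $2$1 * row \<delta> $2$2 - row \<gamma> $2$2 * row \<delta> $2$1 = ?B $2$1 * det (row \<delta>)"
    unfolding eq det_2 matrix_mult_2 by (simp add: algebra_simps)
  ultimately have "row \<gamma> $2$1 * row \<delta> $2$2 - row \<gamma> $2$2 * row \<delta> $2$1 = ?B $2$1"
    by simp
  then show ?thesis using shimizu[OF B] stabilizer_iff[OF B] assms(3) by simp
qed

end

section \<open>Termwise differentiation\<close>

text \<open>On a convex set the bound on f' i also makes b i a Lipschitz constant of f i. So the
  tails of the increments are controlled by the tail of b uniformly in the increment, and finitely
  many terms remain.\<close>

lemma has_derivative_infsum:
  fixes f :: "'i \<Rightarrow> 'a::real_normed_vector \<Rightarrow> 'b::banach"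
  assumes S: "convex S" "open S" "x \<in> S"
    and deriv: "\<And>i y. i \<in> I \<Longrightarrow> y \<in> S \<Longrightarrow> (f i has_derivative f' i y) (at y)"
    and f: "\<And>i y. i \<in> I \<Longrightarrow> y \<in> S \<Longrightarrow> norm (f i y) \<le> b i"
    and f': "\<And>i y h. i \<in> I \<Longrightarrow> y \<in> S \<Longrightarrow> norm (f' i y h) \<le> b i * norm h"
    and b: "b summable_on I"
  shows "((\<lambda>y. \<Sum>\<^sub>\<infinity>i\<in>I. f i y) has_derivative (\<lambda>h. \<Sum>\<^sub>\<infinity>i\<in>I. f' i x h)) (at x)"
proof -
  have b_nonneg: "b i \<ge> 0" if "i \<in> I" for i
    using f[OF that S(3)] norm_ge_zero order_trans by blast
  have summable: "(\<lambda>i. F i) summable_on J"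
    if "J \<subseteq> I" "\<And>i. i \<in> J \<Longrightarrow> norm (F i) \<le> b i * c" for F :: "'i \<Rightarrow> 'b" and J c
  proof -
    have "(\<lambda>i. b i * c) summable_on J"
      by (rule summable_on_cmult_left) (rule summable_on_subset_banach[OF b that(1)])
    then have "(\<lambda>i. norm (F i)) summable_on J"
      by (rule summable_on_comparison_test) (use that in auto)
    then show ?thesis by (rule abs_summable_summable)
  qed
  have norm_le: "norm (\<Sum>\<^sub>\<infinity>i\<in>J. F i) \<le> (\<Sum>\<^sub>\<infinity>i\<in>J. b i) * c"
    if "J \<subseteq> I" "\<And>i. i \<in> J \<Longrightarrow> norm (F i) \<le> b i * c" for F :: "'i \<Rightarrow> 'b" and J c
  proof -
    have bJ: "b summable_on J" by (rule summable_on_subset_banach[OF b that(1)])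
    have "norm (\<Sum>\<^sub>\<infinity>i\<in>J. F i) \<le> (\<Sum>\<^sub>\<infinity>i\<in>J. b i * c)"
      by (rule norm_infsum_le[OF has_sum_infsum has_sum_infsum])
        (use summable[of J F c] that summable_on_cmult_left[OF bJ] in auto)
    then show ?thesis by (simp add: infsum_cmult_left bJ)
  qed
  have sum_f: "(\<lambda>i. f i y) summable_on J" if "J \<subseteq> I" "y \<in> S" for J y
    by (rule summable[where c = 1]) (use that f in auto)
  have sum_f': "(\<lambda>i. f' i x h) summable_on J" if "J \<subseteq> I" for J h
    by (rule summable[where c = "norm h"]) (use that f' S in auto)
  have lin: "bounded_linear (f' i x)" if "i \<in> I" for i
    using deriv[OF that S(3)] by (rule has_derivative_bounded_linear)
  define D where "D h = (\<Sum>\<^sub>\<infinity>i\<in>I. f' i x h)" for h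
  have "bounded_linear D"
  proof (rule bounded_linear_intro)
    show "D (h + k) = D h + D k" for h k
      unfolding D_def using sum_f'[OF order_refl]
      by (subst infsum_add[symmetric]) (auto intro!: infsum_cong simp: bounded_linear.linear[OF lin] linear_add)
    show "D (r *\<^sub>R h) = r *\<^sub>R D h" for r h
      unfolding D_def
      by (subst infsum_scaleR_right[symmetric]) (auto intro!: infsum_cong simp: bounded_linear.linear[OF lin] linear_cmul)
    show "norm (D h) \<le> norm h * (\<Sum>\<^sub>\<infinity>i\<in>I. b i)" for h
      unfolding D_def mult.commute[of "norm h"] using f' S by (intro norm_le) auto
  qed
  moreover have "\<exists>d>0. \<forall>y. norm (y - x) < d \<longrightarrow>
      norm ((\<Sum>\<^sub>\<infinity>i\<in>I. f i y) - (\<Sum>\<^sub>\<infinity>i\<in>I. f i x) - D (y - x)) \<le> e * norm (y - x)" if "e > 0" for e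
  proof -
    \<comment> \<open>One third of e each goes to the finite part, to the tail of the increments and
      to the tail of the derivatives.\<close>
    obtain F where F: "finite F" "F \<subseteq> I" "dist (sum b F) (infsum b I) \<le> e / 3"
      using infsum_finite_approximation[OF b, of "e / 3"] \<open>e > 0\<close> by auto
    have "infsum b (I - F) = infsum b I - sum b F"
      using infsum_Diff[OF b _ F(2)] F(1) by simp
    then have tail: "infsum b (I - F) \<le> e / 3" using F(3) unfolding dist_real_def by linarith
    have "((\<lambda>y. \<Sum>i\<in>F. f i y) has_derivative (\<lambda>h. \<Sum>i\<in>F. f' i x h)) (at x)"
      using deriv S(3) F(2) by (intro has_derivative_sum) auto
    then obtain d1 where d1: "d1 > 0" "\<And>y. norm (y - x) < d1 \<Longrightarrow>
        norm ((\<Sum>i\<in>F. f i y) - (\<Sum>i\<in>F. f i x) - (\<Sum>i\<in>F. f' i x (y - x))) \<le> e / 3 * norm (y - x)"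
      unfolding has_derivative_at_alt using \<open>e > 0\<close> by (metis divide_pos_pos zero_less_numeral)
    obtain d2 where d2: "d2 > 0" "ball x d2 \<subseteq> S"
      using S openE by blast
    have "norm ((\<Sum>\<^sub>\<infinity>i\<in>I. f i y) - (\<Sum>\<^sub>\<infinity>i\<in>I. f i x) - D (y - x)) \<le> e * norm (y - x)"
      if y: "norm (y - x) < min d1 d2" for y
    proof -
      have yS: "y \<in> S" using y d2 by (auto simp: dist_norm norm_minus_commute)
      have split: "(\<Sum>\<^sub>\<infinity>i\<in>I. G i) = (\<Sum>i\<in>F. G i) + (\<Sum>\<^sub>\<infinity>i\<in>I - F. G i)"
        if "G summable_on I" for G :: "'i \<Rightarrow> 'b"
        using infsum_Diff[OF that _ F(2)] F(1) by simp
      have lip: "norm (f i y - f i x) \<le> b i * norm (y - x)" if "i \<in> I - F" for i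
      proof (rule differentiable_bound[OF S(1)])
        fix z assume "z \<in> S"
        then show "(f i has_derivative f' i z) (at z within S)"
          using that deriv has_derivative_at_withinI by blast
        show "onorm (f' i z) \<le> b i"
          using f' that \<open>z \<in> S\<close> b_nonneg by (intro onorm_bound) auto
      qed (use yS S in auto)
      let ?A = "(\<Sum>i\<in>F. f i y) - (\<Sum>i\<in>F. f i x) - (\<Sum>i\<in>F. f' i x (y - x))"
      let ?B = "\<Sum>\<^sub>\<infinity>i\<in>I - F. f i y - f i x" and ?C = "\<Sum>\<^sub>\<infinity>i\<in>I - F. f' i x (y - x)"
      have B: "?B = (\<Sum>\<^sub>\<infinity>i\<in>I - F. f i y) - (\<Sum>\<^sub>\<infinity>i\<in>I - F. f i x)"
        using infsum_add[OF sum_f[of "I - F" y] summable_on_uminus[THEN iffD2, OF sum_f[of "I - F" x]]] yS S(3)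
        by (simp add: infsum_uminus)
      have "(\<Sum>\<^sub>\<infinity>i\<in>I. f i y) - (\<Sum>\<^sub>\<infinity>i\<in>I. f i x) - D (y - x) = ?A + (?B - ?C)"
        unfolding D_def B
        using sum_f[OF order_refl yS] sum_f[OF order_refl S(3)] sum_f'[OF order_refl]
        by (simp add: split)
      then have "norm ((\<Sum>\<^sub>\<infinity>i\<in>I. f i y) - (\<Sum>\<^sub>\<infinity>i\<in>I. f i x) - D (y - x))
          \<le> norm ?A + norm (?B - ?C)" by (simp only: norm_triangle_ineq)
      moreover have "norm (?B - ?C) \<le> norm ?B + norm ?C" by (rule norm_triangle_ineq4)
      moreover have "norm ?A \<le> e / 3 * norm (y - x)" using d1 y by auto
      moreover have "norm ?B \<le> infsum b (I - F) * norm (y - x)" using lip by (intro norm_le) auto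
      moreover have "norm ?C \<le> infsum b (I - F) * norm (y - x)" using f' S(3) by (intro norm_le) auto
      moreover have "infsum b (I - F) * norm (y - x) \<le> e / 3 * norm (y - x)"
        using tail by (rule mult_right_mono) simp
      ultimately show ?thesis by linarith
    qed
    then show ?thesis using d1(1) d2(1) by (intro exI[of _ "min d1 d2"]) auto
  qed
  ultimately show ?thesis
    unfolding has_derivative_at_alt D_def by blast
qed


section \<open>Powers of the imaginary part\<close>

definition Im_powr :: "complex \<Rightarrow> real^2^2 \<Rightarrow> complex \<Rightarrow> complex" where
  "Im_powr s A z = of_real (Im (moebius_act A z)) powr s"

text \<open>With j the cocycle this is (j / |j|)^2, the unitary automorphy factor produced by
  differentiating a power of Im(A z) in the conjugate variable; see
  \<open>Im_powr_deriv_dzbar\<close>.\<close>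

definition phase :: "real^2^2 \<Rightarrow> complex \<Rightarrow> complex" where
  "phase A z = cocycle A z / cnj (cocycle A z)"

lemma norm_phase [simp]: "det A = 1 \<Longrightarrow> z \<in> upper_half \<Longrightarrow> cmod (phase A z) = 1"
  using cocycle_nonzero[of A z] by (simp add: phase_def norm_divide)

lemma phase_cnj: "det A = 1 \<Longrightarrow> z \<in> upper_half \<Longrightarrow> phase A z * cnj (phase A z) = 1"
  using cocycle_nonzero[of A z] by (simp add: phase_def)

text \<open>Since 1 / j^2 is the conjugate phase divided by |j|^2, the function itself can be
  factored out. This logarithmic form is what makes every later derivative a bounded multiple of the
  term.\<close>

lemma Im_moebius_has_derivative:
  assumes A: "det A = 1" and z: "z \<in> upper_half"
  shows "((\<lambda>z. Im (moebius_act A z)) has_derivative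
      (\<lambda>h. Im (moebius_act A z) * (Im (cnj (phase A z) * h) / Im z))) (at z)"
proof -
  have nz: "cocycle A z \<noteq> 0" "Im z \<noteq> 0"
    using cocycle_nonzero[OF A z] z by (auto simp: upper_half_def)
  have "(moebius_act A has_derivative (\<lambda>h. 1 / (cocycle A z)\<^sup>2 * h)) (at z)"
    using moebius_act_has_field_derivative[OF A z] by (simp only: has_field_derivative_def)
  then have "((\<lambda>z. Im (moebius_act A z)) has_derivative (\<lambda>h. Im (1 / (cocycle A z)\<^sup>2 * h))) (at z)"
    by (rule has_derivative_Im)
  moreover have "Im (1 / (cocycle A z)\<^sup>2 * h) = Im (moebius_act A z) * (Im (cnj (phase A z) * h) / Im z)" for h
  proof -
    have "1 / (cocycle A z)\<^sup>2 * h = of_real (1 / (cmod (cocycle A z))\<^sup>2) * (cnj (phase A z) * h)"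
      using nz unfolding of_real_divide complex_norm_square by (simp add: phase_def power2_eq_square)
    then have "Im (1 / (cocycle A z)\<^sup>2 * h) = 1 / (cmod (cocycle A z))\<^sup>2 * Im (cnj (phase A z) * h)"
      by (metis Im_complex_of_real Re_complex_of_real add.right_neutral mult_zero_left times_complex.sel(2))
    then show ?thesis using nz by (simp add: Im_moebius[OF A])
  qed
  ultimately show ?thesis by simp
qed

lemma Im_moebius_pos: "det A = 1 \<Longrightarrow> z \<in> upper_half \<Longrightarrow> Im (moebius_act A z) > 0"
  using moebius_upper_half[of A z] by (simp add: upper_half_def)

definition Im_powr_deriv :: "complex \<Rightarrow> real^2^2 \<Rightarrow> complex \<Rightarrow> complex \<Rightarrow> complex" where
  "Im_powr_deriv s A z h = s * Im_powr s A z * of_real (Im (cnj (phase A z) * h) / Im z)"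

lemma Im_powr_has_derivative:
  assumes A: "det A = 1" and z: "z \<in> upper_half"
  shows "(Im_powr s A has_derivative Im_powr_deriv s A z) (at z)"
proof -
  define R where "R = Im (moebius_act A z)"
  have R: "R > 0" using Im_moebius_pos[OF A z] by (simp add: R_def)
  have "((\<lambda>z. z powr s) has_field_derivative s * of_real R powr (s - 1)) (at (of_real R))"
    using R by (intro has_field_derivative_powr) (auto simp: complex_nonpos_Reals_iff)
  then have 1: "((\<lambda>z. z powr s) has_derivative (\<lambda>h. s * of_real R powr (s - 1) * h)) (at (complex_of_real R))"
    by (simp add: has_field_derivative_def)
  have 2: "((\<lambda>z. complex_of_real (Im (moebius_act A z))) has_derivative
      (\<lambda>h. of_real (R * (Im (cnj (phase A z) * h) / Im z)))) (at z)"
    unfolding R_def by (intro has_derivative_of_real Im_moebius_has_derivative A z)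
  have "((\<lambda>z. complex_of_real (Im (moebius_act A z)) powr s) has_derivative
      (\<lambda>h. s * of_real R powr (s - 1) * of_real (R * (Im (cnj (phase A z) * h) / Im z)))) (at z)"
    by (rule has_derivative_compose[OF 2, where g = "\<lambda>z. z powr s"]) (use 1 in \<open>simp add: R_def\<close>)
  moreover have "s * of_real R powr (s - 1) * of_real (R * (Im (cnj (phase A z) * h) / Im z))
      = Im_powr_deriv s A z h" for h
    using R unfolding Im_powr_deriv_def Im_powr_def R_def[symmetric] by (simp add: powr_diff)
  ultimately show ?thesis
    unfolding Im_powr_def[abs_def] by simp
qed

definition phase_deriv :: "real^2^2 \<Rightarrow> complex \<Rightarrow> complex \<Rightarrow> complex" where
  "phase_deriv A z h = of_real (A$2$1) * (h * cnj (cocycle A z) - cocycle A z * cnj h) / (cnj (cocycle A z))\<^sup>2"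

lemma phase_has_derivative:
  assumes A: "det A = 1" and z: "z \<in> upper_half"
  shows "(phase A has_derivative phase_deriv A z) (at z)"
proof -
  have j: "(cocycle A has_derivative (\<lambda>h. of_real (A$2$1) * h)) (at z)"
    unfolding cocycle_def[abs_def] by (auto intro!: derivative_eq_intros)
  have "((\<lambda>z. cocycle A z / cnj (cocycle A z)) has_derivative
      (\<lambda>h. (of_real (A$2$1) * h * cnj (cocycle A z) - cocycle A z * cnj (of_real (A$2$1) * h))
        / (cnj (cocycle A z) * cnj (cocycle A z)))) (at z)"
    using cocycle_nonzero[OF A z] by (intro has_derivative_divide' j has_derivative_cnj) auto
  moreover have "(of_real (A$2$1) * h * cnj (cocycle A z) - cocycle A z * cnj (of_real (A$2$1) * h))
        / (cnj (cocycle A z) * cnj (cocycle A z)) = phase_deriv A z h" for h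
    by (simp add: phase_deriv_def power2_eq_square algebra_simps)
  ultimately show ?thesis
    by (simp add: phase_def[abs_def])
qed

lemma norm_Im_powr_deriv:
  assumes A: "det A = 1" and z: "z \<in> upper_half"
  shows "cmod (Im_powr_deriv s A z h) \<le> cmod s * cmod (Im_powr s A z) / Im z * cmod h"
proof -
  have y: "Im z > 0" using z by (simp add: upper_half_def)
  have "\<bar>Im (cnj (phase A z) * h)\<bar> \<le> cmod h"
    using abs_Im_le_cmod[of "cnj (phase A z) * h"] norm_phase[OF A z] by (simp add: norm_mult)
  then have "cmod s * cmod (Im_powr s A z) * (\<bar>Im (cnj (phase A z) * h)\<bar> / Im z)
      \<le> cmod s * cmod (Im_powr s A z) * (cmod h / Im z)"
    using y by (intro mult_left_mono divide_right_mono) auto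
  moreover have "cmod (Im_powr_deriv s A z h)
      = cmod s * cmod (Im_powr s A z) * (\<bar>Im (cnj (phase A z) * h)\<bar> / Im z)"
    using y by (simp only: Im_powr_deriv_def norm_mult norm_of_real abs_divide abs_of_pos)
  ultimately show ?thesis by simp
qed

text \<open>The imaginary part of j = c z + d is c * Im z, hence |c| / |j| is at most 1 / Im z,
  uniformly in the matrix.\<close>

lemma norm_phase_deriv:
  assumes A: "det A = 1" and z: "z \<in> upper_half"
  shows "cmod (phase_deriv A z h) \<le> 2 / Im z * cmod h"
proof -
  have y: "Im z > 0" using z by (simp add: upper_half_def)
  have j: "cmod (cocycle A z) > 0" using cocycle_nonzero[OF A z] by simp
  have c: "\<bar>A$2$1\<bar> * Im z \<le> cmod (cocycle A z)"
    using abs_Im_le_cmod[of "cocycle A z"] y by (simp add: cocycle_def abs_mult)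
  have "cmod (h * cnj (cocycle A z) - cocycle A z * cnj h) \<le> 2 * (cmod h * cmod (cocycle A z))"
    using norm_triangle_ineq4[of "h * cnj (cocycle A z)" "cocycle A z * cnj h"]
    by (simp add: norm_mult mult.commute)
  then have "cmod (phase_deriv A z h) \<le> \<bar>A$2$1\<bar> * (2 * (cmod h * cmod (cocycle A z))) / (cmod (cocycle A z))\<^sup>2"
    unfolding phase_deriv_def by (auto simp: norm_mult norm_divide norm_power intro!: divide_right_mono mult_left_mono)
  also have "\<dots> = 2 * cmod h * (\<bar>A$2$1\<bar> / cmod (cocycle A z))"
    using j by (simp add: power2_eq_square field_simps)
  also have "\<dots> \<le> 2 * cmod h * (1 / Im z)"
    using c y j by (intro mult_left_mono) (auto simp: field_simps)
  finally show ?thesis by (simp add: field_simps)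
qed

lemma Im_powr_phase_has_derivative:
  assumes A: "det A = 1" and z: "z \<in> upper_half"
  shows "((\<lambda>z. Im_powr s A z * phase A z) has_derivative
    (\<lambda>h. Im_powr_deriv s A z h * phase A z + Im_powr s A z * phase_deriv A z h)) (at z)"
  by (rule has_derivative_eq_rhs[OF has_derivative_mult[OF Im_powr_has_derivative[OF A z] phase_has_derivative[OF A z]]])
    (simp add: fun_eq_iff add.commute)

lemma norm_Im_powr_phase_deriv:
  assumes A: "det A = 1" and z: "z \<in> upper_half"
  shows "cmod (Im_powr_deriv s A z h * phase A z + Im_powr s A z * phase_deriv A z h)
    \<le> (cmod s + 2) * cmod (Im_powr s A z) / Im z * cmod h"
proof -
  have "cmod (Im_powr_deriv s A z h * phase A z + Im_powr s A z * phase_deriv A z h)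
      \<le> cmod (Im_powr_deriv s A z h) + cmod (Im_powr s A z) * cmod (phase_deriv A z h)"
    using norm_triangle_ineq[of "Im_powr_deriv s A z h * phase A z" "Im_powr s A z * phase_deriv A z h"] A z
    by (simp add: norm_mult)
  also have "\<dots> \<le> cmod s * cmod (Im_powr s A z) / Im z * cmod h + cmod (Im_powr s A z) * (2 / Im z * cmod h)"
    by (intro add_mono mult_left_mono norm_Im_powr_deriv norm_phase_deriv A z) auto
  finally show ?thesis by (simp add: algebra_simps add_divide_distrib)
qed

text \<open>Twice the derivative in the conjugate variable. It is again a power of Im(A z), up to
  \<open>phase\<close> and a factor independent of A, so the factor can be pulled out of the
  series.\<close>

lemma Im_powr_deriv_dzbar:
  "Im_powr_deriv s A z 1 + \<i> * Im_powr_deriv s A z \<i> = \<i> * s / of_real (Im z) * (Im_powr s A z * phase A z)"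
proof -
  have "of_real (- Im (phase A z)) + \<i> * of_real (Re (phase A z)) = \<i> * phase A z"
    by (simp add: complex_eq_iff)
  then have "\<i> * s / of_real (Im z) * (Im_powr s A z * phase A z)
      = s * Im_powr s A z * (of_real (- Im (phase A z)) + \<i> * of_real (Re (phase A z))) / of_real (Im z)"
    by simp
  then show ?thesis
    by (simp add: Im_powr_deriv_def algebra_simps add_divide_distrib diff_divide_distrib)
qed

text \<open>With \<open>j = c z + d\<close>, the entry \<open>c\<close> is eliminated by \<open>c = (j - cnj j) / (2 \<i> Im z)\<close>.\<close>

lemma Im_powr_phase_deriv_dz:
  fixes s :: complex
  assumes A: "det A = 1" and z: "z \<in> upper_half"
  defines "D \<equiv> \<lambda>h. Im_powr_deriv s A z h * phase A z + Im_powr s A z * phase_deriv A z h"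
  shows "D 1 - \<i> * D \<i> = - \<i> / of_real (Im z) * ((s - 1) * Im_powr s A z + Im_powr s A z * phase A z)"
proof -
  have y: "complex_of_real (Im z) \<noteq> 0" using z by (simp add: upper_half_def)
  have j: "cnj (cocycle A z) \<noteq> 0" using cocycle_nonzero[OF A z] by simp
  have "Im_powr_deriv s A z 1 - \<i> * Im_powr_deriv s A z \<i> = - \<i> * s * Im_powr s A z * cnj (phase A z) / of_real (Im z)"
  proof -
    have "of_real (Im (cnj (phase A z))) - \<i> * of_real (Re (cnj (phase A z))) = - \<i> * cnj (phase A z)"
      by (simp add: complex_eq_iff)
    then have "- \<i> * s * Im_powr s A z * cnj (phase A z) / of_real (Im z)
        = s * Im_powr s A z * (of_real (Im (cnj (phase A z))) - \<i> * of_real (Re (cnj (phase A z)))) / of_real (Im z)"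
      by simp
    then show ?thesis
      by (simp add: Im_powr_deriv_def algebra_simps add_divide_distrib diff_divide_distrib)
  qed
  then have 1: "(Im_powr_deriv s A z 1 - \<i> * Im_powr_deriv s A z \<i>) * phase A z
      = - \<i> / of_real (Im z) * (s * Im_powr s A z)"
    using phase_cnj[OF A z] by (simp add: mult_ac)
  have c: "of_real (A$2$1) * (2 * \<i> * of_real (Im z)) = cocycle A z - cnj (cocycle A z)"
    by (simp add: cocycle_def complex_eq_iff)
  have "phase_deriv A z 1 - \<i> * phase_deriv A z \<i> = 2 * of_real (A$2$1) / cnj (cocycle A z)"
    using j by (simp add: phase_deriv_def divide_simps power2_eq_square) (simp add: algebra_simps)
  also have "\<dots> = - \<i> / of_real (Im z) * ((cocycle A z - cnj (cocycle A z)) / cnj (cocycle A z))"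
    unfolding c[symmetric] using y by (simp add: mult_ac)
  also have "\<dots> = - \<i> / of_real (Im z) * (phase A z - 1)"
    using j by (simp add: phase_def diff_divide_distrib)
  finally have 2: "phase_deriv A z 1 - \<i> * phase_deriv A z \<i> = - \<i> / of_real (Im z) * (phase A z - 1)" .
  have "D 1 - \<i> * D \<i> = (Im_powr_deriv s A z 1 - \<i> * Im_powr_deriv s A z \<i>) * phase A z
      + Im_powr s A z * (phase_deriv A z 1 - \<i> * phase_deriv A z \<i>)"
    by (simp add: D_def algebra_simps)
  also have "\<dots> = - \<i> / of_real (Im z) * ((s - 1) * Im_powr s A z + Im_powr s A z * phase A z)"
    unfolding 1 2 by (simp add: algebra_simps diff_divide_distrib)
  finally show ?thesis .
qed

text \<open>Locally uniformly in \<open>z\<close>, \<open>\<bar>c z + d\<bar>\<^sup>2\<close> dominates a multiple of \<open>c\<^sup>2 + d\<^sup>2\<close>.\<close>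

lemma Im_powr_local_bound:
  assumes z0: "z0 \<in> upper_half" and s: "Re s > 0"
  obtains L where "L \<ge> 0" "\<And>A z. det A = 1 \<Longrightarrow> z \<in> ball z0 (Im z0 / 2) \<Longrightarrow>
      cmod (Im_powr s A z) \<le> L * ((A$2$1)\<^sup>2 + (A$2$2)\<^sup>2) powr - Re s"
proof -
  define y0 where "y0 = Im z0 / 2"
  define B where "B = \<bar>Re z0\<bar> + y0"
  \<comment> \<open>On the ball |Re z| \<le> B and y0 < Im z < 3 * y0. These bounds give c^2 + d^2
    \<le> \<kappa> * |c z + d|^2: the 2 serves the square of c * Re z + d, the quotient serves the
    square of c * Im z.\<close>
  define \<kappa> where "\<kappa> = 2 + (1 + 2 * B\<^sup>2) / y0\<^sup>2"
  have y0: "y0 > 0" using z0 by (simp add: y0_def upper_half_def)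
  have \<kappa>: "\<kappa> > 0" unfolding \<kappa>_def by (intro add_pos_nonneg) auto
  show ?thesis
  proof
    show "(3 * y0 * \<kappa>) powr Re s \<ge> 0" by simp
    fix A :: "real^2^2" and z assume A: "det A = 1" and z: "z \<in> ball z0 (Im z0 / 2)"
    define c d where "c = A$2$1" and "d = A$2$2"
    have dist: "cmod (z0 - z) < y0" using z by (simp add: dist_norm y0_def)
    then have "\<bar>Im (z0 - z)\<bar> < y0" "\<bar>Re (z0 - z)\<bar> < y0"
      using abs_Im_le_cmod[of "z0 - z"] abs_Re_le_cmod[of "z0 - z"] by linarith+
    then have "\<bar>Im z0 - Im z\<bar> < y0" "\<bar>Re z0 - Re z\<bar> < y0" "Im z0 = 2 * y0"
      by (simp_all add: y0_def)
    then have y: "Im z > y0" "Im z < 3 * y0" and x: "\<bar>Re z\<bar> \<le> B"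
      unfolding B_def by linarith+
    have zu: "z \<in> upper_half" using y y0 by (simp add: upper_half_def)
    have N: "c\<^sup>2 + d\<^sup>2 > 0"
      using A by (auto simp: sum_power2_gt_zero_iff c_def d_def det_2)
    define J where "J = (cmod (cocycle A z))\<^sup>2"
    have J: "J = (c * Re z + d)\<^sup>2 + (c * Im z)\<^sup>2"
      by (simp add: J_def cmod_power2 cocycle_def c_def d_def)
    have "(Re z)\<^sup>2 \<le> B\<^sup>2" using power_mono[OF x abs_ge_zero, of 2] by simp
    then have "c\<^sup>2 * (Re z)\<^sup>2 \<le> c\<^sup>2 * B\<^sup>2" by (rule mult_left_mono) simp
    \<comment> \<open>This square is the difference of the two sides of the next inequality.\<close>
    moreover have "0 \<le> (d + 2 * c * Re z)\<^sup>2" by simp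
    then have "d\<^sup>2 \<le> 2 * (c * Re z + d)\<^sup>2 + 2 * (c\<^sup>2 * (Re z)\<^sup>2)"
      by (simp add: power2_eq_square algebra_simps)
    ultimately have "c\<^sup>2 + d\<^sup>2 \<le> 2 * (c * Re z + d)\<^sup>2 + (1 + 2 * B\<^sup>2) * c\<^sup>2"
      by (simp add: algebra_simps)
    also have "(1 + 2 * B\<^sup>2) * c\<^sup>2 \<le> (1 + 2 * B\<^sup>2) / y0\<^sup>2 * (c * Im z)\<^sup>2"
    proof -
      have "y0\<^sup>2 \<le> (Im z)\<^sup>2" using y y0 by (intro power_mono) auto
      then have "(1 + 2 * B\<^sup>2) / y0\<^sup>2 * c\<^sup>2 * y0\<^sup>2 \<le> (1 + 2 * B\<^sup>2) / y0\<^sup>2 * c\<^sup>2 * (Im z)\<^sup>2"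
        by (intro mult_left_mono) auto
      then show ?thesis using y0 by (simp add: power_mult_distrib mult.assoc)
    qed
    also have "2 * (c * Re z + d)\<^sup>2 + (1 + 2 * B\<^sup>2) / y0\<^sup>2 * (c * Im z)\<^sup>2 \<le> \<kappa> * J"
    proof -
      have "2 * (c * Re z + d)\<^sup>2 \<le> \<kappa> * (c * Re z + d)\<^sup>2"
        by (intro mult_right_mono) (auto simp: \<kappa>_def)
      moreover have "(1 + 2 * B\<^sup>2) / y0\<^sup>2 * (c * Im z)\<^sup>2 \<le> \<kappa> * (c * Im z)\<^sup>2"
        by (intro mult_right_mono) (auto simp: \<kappa>_def)
      ultimately show ?thesis by (simp add: J distrib_left)
    qed
    finally have NJ: "c\<^sup>2 + d\<^sup>2 \<le> \<kappa> * J" by simp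
    then have Jpos: "J > 0" using N \<kappa> by (smt (verit) mult_nonneg_nonpos)
    have "Im z / J \<le> 3 * y0 / J" using y Jpos by (intro divide_right_mono) auto
    also have "\<dots> \<le> 3 * y0 * \<kappa> * (1 / (c\<^sup>2 + d\<^sup>2))"
    proof -
      have "1 / J \<le> \<kappa> * (1 / (c\<^sup>2 + d\<^sup>2))" using NJ N Jpos by (simp add: field_simps)
      then have "3 * y0 * (1 / J) \<le> 3 * y0 * (\<kappa> * (1 / (c\<^sup>2 + d\<^sup>2)))"
        using y0 by (intro mult_left_mono) auto
      then show ?thesis by (simp add: mult.assoc)
    qed
    finally have le: "Im z / J \<le> 3 * y0 * \<kappa> * (1 / (c\<^sup>2 + d\<^sup>2))" .
    have "cmod (Im_powr s A z) = (Im z / J) powr Re s"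
      using Im_moebius_pos[OF A zu] by (simp add: Im_powr_def norm_powr_real_powr Im_moebius[OF A] J_def)
    also have "\<dots> \<le> (3 * y0 * \<kappa> * (1 / (c\<^sup>2 + d\<^sup>2))) powr Re s"
      using le s y y0 Jpos by (intro powr_mono2) auto
    also have "\<dots> = (3 * y0 * \<kappa>) powr Re s * (1 / (c\<^sup>2 + d\<^sup>2)) powr Re s"
      using N y0 \<kappa> by (simp only: powr_mult)
    also have "(1 / (c\<^sup>2 + d\<^sup>2)) powr Re s = (c\<^sup>2 + d\<^sup>2) powr - Re s"
      using N by (simp add: powr_divide powr_minus_divide)
    finally show "cmod (Im_powr s A z) \<le> (3 * y0 * \<kappa>) powr Re s * ((A$2$1)\<^sup>2 + (A$2$2)\<^sup>2) powr - Re s"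
      by (simp add: c_def d_def)
  qed
qed

section \<open>Twisted Eisenstein series at one cusp\<close>

text \<open>Compactness of the quotient enters only through \<open>bounded\<close>, which is
  supplied by \<open>cusp_form2_bounded\<close> when the locale is instantiated for each
  cusp.\<close>

locale eisenstein_cusp = scaled_cusp +
  fixes chi :: "real^2^2 \<Rightarrow> complex" and f g :: "complex \<Rightarrow> complex"
  assumes character: "cuspidal_unitary_character \<Gamma> chi"
    and cusp_form: "cusp_form2 \<Gamma> f" "cusp_form2 \<Gamma> g"
    and bounded: "\<exists>C. \<forall>z\<in>upper_half. Im z * cmod (f z) \<le> C" "\<exists>C. \<forall>z\<in>upper_half. Im z * cmod (g z) \<le> C"
begin

abbreviation stab :: "(real^2^2) set" where "stab \<equiv> stabilizer \<Gamma> a"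

lemma stab_\<Gamma>: "h \<in> stab \<Longrightarrow> h \<in> \<Gamma>"
  by (simp add: stabilizer_def)

lemma stab_one: "Finite_Cartesian_Product.mat 1 \<in> stab"
  by (simp add: stabilizer_iff one_\<Gamma> conj_def)

lemma stab_entry: "h \<in> stab \<Longrightarrow> conj h $2$1 = 0"
  using stabilizer_iff stab_\<Gamma> by blast

lemma stab_mult: "h \<in> stab \<Longrightarrow> k \<in> stab \<Longrightarrow> h ** k \<in> stab"
  by (simp add: stabilizer_iff stab_\<Gamma> mult_\<Gamma> conj_mult matrix_mult_2 stab_entry)

lemma stab_inv: "h \<in> stab \<Longrightarrow> SL_inv h \<in> stab"
  by (simp add: stabilizer_iff stab_\<Gamma> inv_\<Gamma> conj_inv SL_inv_entries det_\<Gamma> stab_entry)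

section \<open>Cosets of the stabilizer and their representatives\<close>

definition coset :: "real^2^2 \<Rightarrow> (real^2^2) set" where
  "coset \<gamma> = (\<lambda>h. h ** \<gamma>) ` stab"

definition cosets :: "(real^2^2) set set" where
  "cosets = coset ` \<Gamma>"

definition rep :: "(real^2^2) set \<Rightarrow> real^2^2" where
  "rep C = (SOME \<gamma>. \<gamma> \<in> C)"

lemma rcosets_eq: "rcosets\<^bsub>SL2R\<lparr>carrier := \<Gamma>\<rparr>\<^esub> stab = cosets"
  by (auto simp: RCOSETS_def r_coset_def cosets_def coset_def)

lemma coset_stab:
  assumes "h \<in> stab" shows "coset (h ** \<gamma>) = coset \<gamma>"
proof
  show "coset (h ** \<gamma>) \<subseteq> coset \<gamma>"
    using assms by (auto simp: coset_def matrix_mul_assoc intro!: imageI stab_mult)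
  show "coset \<gamma> \<subseteq> coset (h ** \<gamma>)"
  proof
    fix x assume "x \<in> coset \<gamma>"
    then obtain k where k: "k \<in> stab" "x = k ** \<gamma>" by (auto simp: coset_def)
    then have "x = (k ** SL_inv h) ** (h ** \<gamma>)"
      using det_\<Gamma>[OF stab_\<Gamma>[OF assms]] by (simp flip: matrix_mul_assoc)
    then show "x \<in> coset (h ** \<gamma>)"
      unfolding coset_def using k assms by (intro image_eqI[of _ _ "k ** SL_inv h"] stab_mult stab_inv) auto
  qed
qed

lemma rep_coset:
  assumes "\<gamma> \<in> \<Gamma>"
  obtains h where "h \<in> stab" "rep (coset \<gamma>) = h ** \<gamma>"
proof -
  have "\<gamma> \<in> coset \<gamma>" unfolding coset_def using stab_one by (intro image_eqI[of _ _ "Finite_Cartesian_Product.mat 1"]) auto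
  then have "rep (coset \<gamma>) \<in> coset \<gamma>" unfolding rep_def by (rule someI)
  then show ?thesis using that by (auto simp: coset_def)
qed

lemma rep_cosets:
  assumes "C \<in> cosets"
  shows "rep C \<in> \<Gamma>" "coset (rep C) = C"
proof -
  obtain \<gamma> where \<gamma>: "\<gamma> \<in> \<Gamma>" "C = coset \<gamma>" using assms by (auto simp: cosets_def)
  obtain h where h: "h \<in> stab" "rep (coset \<gamma>) = h ** \<gamma>" using rep_coset[OF \<gamma>(1)] .
  show "rep C \<in> \<Gamma>" "coset (rep C) = C"
    using h \<gamma> by (simp_all add: mult_\<Gamma> stab_\<Gamma> coset_stab)
qed

lemma rep_separated:
  assumes "C \<in> cosets" "D \<in> cosets" "C \<noteq> D"
  shows "rep C ** SL_inv (rep D) \<notin> stab"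
proof
  assume h: "rep C ** SL_inv (rep D) \<in> stab"
  have "rep C ** SL_inv (rep D) ** rep D = rep C"
    using rep_cosets[OF assms(2)] by (simp add: det_\<Gamma>)
  then have "coset (rep C) = coset (rep D)"
    using coset_stab[OF h, of "rep D"] by simp
  then show False using assms rep_cosets by simp
qed

text \<open>By \<open>Im_row_ii\<close> this is the reciprocal of Im(\<sigma>^-1 \<gamma> i). So the
  logarithm in the bound for modular symbols is, up to sign, that of the quantity counted by the
  bottom rows.\<close>

definition height :: "real^2^2 \<Rightarrow> real" where
  "height \<gamma> = (row \<gamma> $2$1)\<^sup>2 + (row \<gamma> $2$2)\<^sup>2"

lemma det_row: "\<gamma> \<in> \<Gamma> \<Longrightarrow> det (row \<gamma>) = 1"
  by (simp add: row_def det_mul det_\<Gamma>)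

lemma height_pos:
  assumes "\<gamma> \<in> \<Gamma>" shows "height \<gamma> > 0"
  using det_row[OF assms] by (auto simp: height_def sum_power2_gt_zero_iff det_2)

lemma height_summable:
  assumes "p > 1"
  shows "(\<lambda>C. (1 + \<bar>ln (height (rep C))\<bar>) ^ M * height (rep C) powr - p) summable_on cosets"
  unfolding height_def
proof (rule separated_vectors_log_summable)
  fix C D assume C: "C \<in> cosets" and D: "D \<in> cosets" and "C \<noteq> D"
  then show "1 \<le> \<bar>row (rep C) $2$1 * row (rep D) $2$2 - row (rep C) $2$2 * row (rep D) $2$1\<bar>"
    by (intro row_separated rep_cosets rep_separated)
qed (use assms height_pos rep_cosets in \<open>auto simp: height_def\<close>)

definition weight :: "nat \<Rightarrow> nat \<Rightarrow> real^2^2 \<Rightarrow> complex" where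
  "weight i j \<gamma> = chi \<gamma> * modular_symbol \<gamma> f ^ i * cnj (modular_symbol \<gamma> g) ^ j"

lemma modular_symbol_height:
  assumes u: "cusp_form2 \<Gamma> u" and b: "\<exists>C. \<forall>z\<in>upper_half. Im z * cmod (u z) \<le> C"
  obtains K where "K > 0" "\<And>\<gamma>. \<gamma> \<in> \<Gamma> \<Longrightarrow> cmod (modular_symbol \<gamma> u) \<le> K * (1 + \<bar>ln (height \<gamma>)\<bar>)"
proof -
  obtain C where "\<And>z. z \<in> upper_half \<Longrightarrow> Im z * cmod (u z) \<le> C" using b by blast
  then obtain K where K: "K > 0"
    "\<And>\<gamma>. \<gamma> \<in> \<Gamma> \<Longrightarrow> cmod (modular_symbol \<gamma> u) \<le> K * (1 + \<bar>ln (Im (moebius_act (SL_inv \<sigma> ** \<gamma>) \<i>))\<bar>)"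
    using modular_symbol_bound[OF u] by blast
  have "\<bar>ln (Im (moebius_act (SL_inv \<sigma> ** \<gamma>) \<i>))\<bar> = \<bar>ln (height \<gamma>)\<bar>" if "\<gamma> \<in> \<Gamma>" for \<gamma>
    using height_pos[OF that] Im_row_ii[OF that]
    by (simp add: height_def row_def ln_div)
  then show ?thesis using K that by simp
qed

lemma weight_bound:
  obtains K where "K \<ge> 0" "\<And>\<gamma>. \<gamma> \<in> \<Gamma> \<Longrightarrow> cmod (weight i j \<gamma>) \<le> K * (1 + \<bar>ln (height \<gamma>)\<bar>) ^ (i + j)"
proof -
  obtain K1 where K1: "K1 > 0" "\<And>\<gamma>. \<gamma> \<in> \<Gamma> \<Longrightarrow> cmod (modular_symbol \<gamma> f) \<le> K1 * (1 + \<bar>ln (height \<gamma>)\<bar>)"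
    using modular_symbol_height[OF cusp_form(1) bounded(1)] by blast
  obtain K2 where K2: "K2 > 0" "\<And>\<gamma>. \<gamma> \<in> \<Gamma> \<Longrightarrow> cmod (modular_symbol \<gamma> g) \<le> K2 * (1 + \<bar>ln (height \<gamma>)\<bar>)"
    using modular_symbol_height[OF cusp_form(2) bounded(2)] by blast
  show ?thesis
  proof
    show "K1 ^ i * K2 ^ j \<ge> 0" using K1 K2 by simp
    fix \<gamma> assume \<gamma>: "\<gamma> \<in> \<Gamma>"
    have "cmod (weight i j \<gamma>) = cmod (modular_symbol \<gamma> f) ^ i * cmod (modular_symbol \<gamma> g) ^ j"
      using character \<gamma> by (simp add: weight_def norm_mult norm_power cuspidal_unitary_character_def)
    also have "\<dots> \<le> (K1 * (1 + \<bar>ln (height \<gamma>)\<bar>)) ^ i * (K2 * (1 + \<bar>ln (height \<gamma>)\<bar>)) ^ j"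
      using K1 K2 \<gamma> by (intro mult_mono power_mono zero_le_power) auto
    finally show "cmod (weight i j \<gamma>) \<le> K1 ^ i * K2 ^ j * (1 + \<bar>ln (height \<gamma>)\<bar>) ^ (i + j)"
      by (simp add: power_mult_distrib power_add mult_ac)
  qed
qed

definition E :: "nat \<Rightarrow> nat \<Rightarrow> complex \<Rightarrow> complex \<Rightarrow> complex" where
  "E i j s z = (\<Sum>\<^sub>\<infinity>C\<in>cosets. weight i j (rep C) * Im_powr s (row (rep C)) z)"

text \<open>The derivative of \<open>E\<close> in the conjugate variable, up to the factor i s / (2
  Im z).\<close>

definition E_phase :: "nat \<Rightarrow> nat \<Rightarrow> complex \<Rightarrow> complex \<Rightarrow> complex" where
  "E_phase i j s z = (\<Sum>\<^sub>\<infinity>C\<in>cosets. weight i j (rep C) *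
     (Im_powr s (row (rep C)) z * phase (row (rep C)) z))"

lemma Im_row:
  assumes "\<gamma> \<in> \<Gamma>" "z \<in> upper_half"
  shows "Im (moebius_act (SL_inv \<sigma>) (moebius_act \<gamma> z)) = Im (moebius_act (row \<gamma>) z)"
  using assms by (simp add: row_def moebius_act_mult det_\<Gamma>)

lemma eisenstein_eq:
  assumes "z \<in> upper_half"
  shows "eisenstein \<Gamma> chi f g a \<sigma> i j z s = E i j s z"
  unfolding eisenstein_def E_def rcosets_eq rep_def[symmetric] Let_def weight_def Im_powr_def
  by (intro infsum_cong) (simp add: Im_row rep_cosets assms)

lemma upper_half_ball:
  assumes "z0 \<in> upper_half" "z \<in> ball z0 (Im z0 / 2)"
  shows "z \<in> upper_half" "Im z0 / 2 < Im z"
proof -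
  have "\<bar>Im (z0 - z)\<bar> < Im z0 / 2"
    using assms(2) abs_Im_le_cmod[of "z0 - z"] by (simp add: dist_norm)
  then show "Im z0 / 2 < Im z" unfolding minus_complex.sel by linarith
  then show "z \<in> upper_half" using assms(1) by (simp add: upper_half_def)
qed

lemma majorant:
  assumes s: "Re s > 1" and z0: "z0 \<in> upper_half"
  obtains b where "b summable_on cosets"
    "\<And>C z. C \<in> cosets \<Longrightarrow> z \<in> ball z0 (Im z0 / 2) \<Longrightarrow>
       cmod (weight i j (rep C) * Im_powr s (row (rep C)) z) \<le> b C"
    "\<And>C z h. C \<in> cosets \<Longrightarrow> z \<in> ball z0 (Im z0 / 2) \<Longrightarrow>
       cmod (weight i j (rep C)) * ((cmod s + 2) * cmod (Im_powr s (row (rep C)) z) / Im z) \<le> b C"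
proof -
  obtain K where K: "K \<ge> 0" "\<And>\<gamma>. \<gamma> \<in> \<Gamma> \<Longrightarrow> cmod (weight i j \<gamma>) \<le> K * (1 + \<bar>ln (height \<gamma>)\<bar>) ^ (i + j)"
    using weight_bound[of i j] by blast
  obtain L where L: "L \<ge> 0" "\<And>A z. det A = 1 \<Longrightarrow> z \<in> ball z0 (Im z0 / 2) \<Longrightarrow>
      cmod (Im_powr s A z) \<le> L * ((A$2$1)\<^sup>2 + (A$2$2)\<^sup>2) powr - Re s"
    using Im_powr_local_bound[OF z0, of s] s by auto
  \<comment> \<open>The summand 1 covers the terms themselves. The rest covers the first derivatives
    of both series, because 1 / Im z is at most 2 / Im z0 on the ball.\<close>
  define Q where "Q = 1 + (cmod s + 2) * (2 / Im z0)"
  have y0: "Im z0 > 0" using z0 by (simp add: upper_half_def)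
  have Q: "Q \<ge> 1" using y0 by (simp add: Q_def)
  define m where "m C = (1 + \<bar>ln (height (rep C))\<bar>) ^ (i + j) * height (rep C) powr - Re s" for C
  define b where "b C = K * L * Q * m C" for C
  have main: "cmod (weight i j (rep C)) * cmod (Im_powr s (row (rep C)) z) \<le> K * L * m C"
    if C: "C \<in> cosets" and z: "z \<in> ball z0 (Im z0 / 2)" for C z
  proof -
    have "cmod (weight i j (rep C)) * cmod (Im_powr s (row (rep C)) z)
        \<le> (K * (1 + \<bar>ln (height (rep C))\<bar>) ^ (i + j)) * (L * height (rep C) powr - Re s)"
      using K L(2)[OF det_row z] rep_cosets[OF C] by (intro mult_mono) (auto simp: height_def)
    then show ?thesis by (simp add: m_def mult_ac)
  qed
  have nonneg: "K * L * m C \<ge> 0" for C using K L by (simp add: m_def)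
  show ?thesis
  proof
    show "b summable_on cosets"
      unfolding b_def m_def using s by (intro summable_on_cmult_right height_summable)
    fix C z assume C: "C \<in> cosets" and z: "z \<in> ball z0 (Im z0 / 2)"
    have "K * L * m C * 1 \<le> K * L * m C * Q" using Q nonneg by (rule mult_left_mono)
    then show "cmod (weight i j (rep C) * Im_powr s (row (rep C)) z) \<le> b C"
      using main[OF C z] by (simp add: norm_mult b_def mult_ac)
    have "1 / Im z \<le> 2 / Im z0" using upper_half_ball[OF z0 z] y0 by (simp add: field_simps)
    then have "(cmod s + 2) * (1 / Im z) \<le> (cmod s + 2) * (2 / Im z0)" by (intro mult_left_mono) auto
    then have "(cmod s + 2) * (1 / Im z) \<le> Q" by (simp add: Q_def)
    then have "(cmod (weight i j (rep C)) * cmod (Im_powr s (row (rep C)) z)) * ((cmod s + 2) * (1 / Im z))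
        \<le> (K * L * m C) * Q"
      using main[OF C z] nonneg[of C] upper_half_ball[OF z0 z] y0
      by - (rule mult_mono, auto)
    then show "cmod (weight i j (rep C)) * ((cmod s + 2) * cmod (Im_powr s (row (rep C)) z) / Im z) \<le> b C"
      by (simp add: b_def mult_ac)
  qed
qed

lemma summable_of_bound:
  fixes F :: "(real^2^2) set \<Rightarrow> complex"
  assumes "b summable_on cosets" "\<And>C. C \<in> cosets \<Longrightarrow> cmod (F C) \<le> b C * c"
  shows "F summable_on cosets"
proof (rule abs_summable_summable, rule summable_on_comparison_test)
  show "(\<lambda>C. b C * c) summable_on cosets"
    using assms(1) by (rule summable_on_cmult_left)
qed (use assms in auto)

section \<open>Termwise derivatives of the two series\<close>

definition DE :: "nat \<Rightarrow> nat \<Rightarrow> complex \<Rightarrow> complex \<Rightarrow> complex \<Rightarrow> complex" where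
  "DE i j s z h = (\<Sum>\<^sub>\<infinity>C\<in>cosets. weight i j (rep C) * Im_powr_deriv s (row (rep C)) z h)"

definition DE_phase :: "nat \<Rightarrow> nat \<Rightarrow> complex \<Rightarrow> complex \<Rightarrow> complex \<Rightarrow> complex" where
  "DE_phase i j s z h = (\<Sum>\<^sub>\<infinity>C\<in>cosets. weight i j (rep C) *
     (Im_powr_deriv s (row (rep C)) z h * phase (row (rep C)) z
        + Im_powr s (row (rep C)) z * phase_deriv (row (rep C)) z h))"

context
  fixes s z0 :: complex and i j :: nat
  assumes s: "Re s > 1" and z0: "z0 \<in> upper_half"
begin

lemma norm_term_derivs:
  assumes C: "C \<in> cosets" and z: "z \<in> upper_half"
    and b: "cmod (weight i j (rep C)) * ((cmod s + 2) * cmod (Im_powr s (row (rep C)) z) / Im z) \<le> b C"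
  shows "cmod (weight i j (rep C) * Im_powr_deriv s (row (rep C)) z h) \<le> b C * cmod h"
    "cmod (weight i j (rep C) * (Im_powr_deriv s (row (rep C)) z h * phase (row (rep C)) z
        + Im_powr s (row (rep C)) z * phase_deriv (row (rep C)) z h)) \<le> b C * cmod h"
proof -
  let ?w = "cmod (weight i j (rep C))" and ?u = "cmod (Im_powr s (row (rep C)) z)"
  have det: "det (row (rep C)) = 1" using C by (intro det_row rep_cosets)
  have y: "Im z > 0" using z by (simp add: upper_half_def)
  have *: "?w * ((cmod s + 2) * ?u / Im z * cmod h) \<le> b C * cmod h"
    using mult_right_mono[OF b, of "cmod h"] by (simp add: mult.assoc)
  have "cmod (Im_powr_deriv s (row (rep C)) z h) \<le> cmod s * ?u / Im z * cmod h"
    by (rule norm_Im_powr_deriv[OF det z])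
  also have "\<dots> \<le> (cmod s + 2) * ?u / Im z * cmod h"
    using y by (intro mult_right_mono divide_right_mono) auto
  finally have "?w * cmod (Im_powr_deriv s (row (rep C)) z h) \<le> ?w * ((cmod s + 2) * ?u / Im z * cmod h)"
    by (rule mult_left_mono) simp
  then show "cmod (weight i j (rep C) * Im_powr_deriv s (row (rep C)) z h) \<le> b C * cmod h"
    using * by (simp add: norm_mult)
  have "?w * cmod (Im_powr_deriv s (row (rep C)) z h * phase (row (rep C)) z
        + Im_powr s (row (rep C)) z * phase_deriv (row (rep C)) z h)
      \<le> ?w * ((cmod s + 2) * ?u / Im z * cmod h)"
    by (rule mult_left_mono[OF norm_Im_powr_phase_deriv[OF det z]]) simp
  then show "cmod (weight i j (rep C) * (Im_powr_deriv s (row (rep C)) z h * phase (row (rep C)) z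
        + Im_powr s (row (rep C)) z * phase_deriv (row (rep C)) z h)) \<le> b C * cmod h"
    using * by (simp add: norm_mult)
qed

lemma E_has_derivative: "(E i j s has_derivative DE i j s z0) (at z0)"
  and E_phase_has_derivative: "(E_phase i j s has_derivative DE_phase i j s z0) (at z0)"
  and E_summable: "(\<lambda>C. weight i j (rep C) * Im_powr s (row (rep C)) z0) summable_on cosets"
  and E_phase_summable:
    "(\<lambda>C. weight i j (rep C) * (Im_powr s (row (rep C)) z0 * phase (row (rep C)) z0)) summable_on cosets"
  and DE_summable: "(\<lambda>C. weight i j (rep C) * Im_powr_deriv s (row (rep C)) z0 h) summable_on cosets"
  and DE_phase_summable:
    "(\<lambda>C. weight i j (rep C) * (Im_powr_deriv s (row (rep C)) z0 h * phase (row (rep C)) z0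
        + Im_powr s (row (rep C)) z0 * phase_deriv (row (rep C)) z0 h)) summable_on cosets"
proof -
  obtain b where b: "b summable_on cosets"
    "\<And>C z. C \<in> cosets \<Longrightarrow> z \<in> ball z0 (Im z0 / 2) \<Longrightarrow>
       cmod (weight i j (rep C) * Im_powr s (row (rep C)) z) \<le> b C"
    "\<And>C z h. C \<in> cosets \<Longrightarrow> z \<in> ball z0 (Im z0 / 2) \<Longrightarrow>
       cmod (weight i j (rep C)) * ((cmod s + 2) * cmod (Im_powr s (row (rep C)) z) / Im z) \<le> b C"
    using majorant[OF s z0] by blast
  have zb: "z0 \<in> ball z0 (Im z0 / 2)" using z0 by (simp add: upper_half_def)
  have det: "det (row (rep C)) = 1" if "C \<in> cosets" for C
    using that by (intro det_row rep_cosets)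
  have b': "cmod (weight i j (rep C) * (Im_powr s (row (rep C)) z * phase (row (rep C)) z)) \<le> b C"
    if "C \<in> cosets" "z \<in> ball z0 (Im z0 / 2)" for C z
    using b(2)[OF that] det[OF that(1)] upper_half_ball[OF z0 that(2)] by (simp add: norm_mult)
  have derivs: "cmod (weight i j (rep C) * Im_powr_deriv s (row (rep C)) z h) \<le> b C * cmod h"
    "cmod (weight i j (rep C) * (Im_powr_deriv s (row (rep C)) z h * phase (row (rep C)) z
        + Im_powr s (row (rep C)) z * phase_deriv (row (rep C)) z h)) \<le> b C * cmod h"
    if "C \<in> cosets" "z \<in> ball z0 (Im z0 / 2)" for C z h
    using norm_term_derivs[of C z b h, OF that(1) upper_half_ball(1)[OF z0 that(2)] b(3)[OF that]]
    by blast+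
  show "(E i j s has_derivative DE i j s z0) (at z0)"
    unfolding E_def[abs_def] DE_def[abs_def]
    by (rule has_derivative_infsum[where S = "ball z0 (Im z0 / 2)" and b = b
          and f' = "\<lambda>C z h. weight i j (rep C) * Im_powr_deriv s (row (rep C)) z h"])
      (use zb b det derivs(1) upper_half_ball[OF z0]
        in \<open>auto intro!: has_derivative_mult_right Im_powr_has_derivative\<close>)
  show "(E_phase i j s has_derivative DE_phase i j s z0) (at z0)"
    unfolding E_phase_def[abs_def] DE_phase_def[abs_def]
    by (rule has_derivative_infsum[where S = "ball z0 (Im z0 / 2)" and b = b
          and f' = "\<lambda>C z h. weight i j (rep C) * (Im_powr_deriv s (row (rep C)) z h * phase (row (rep C)) z
        + Im_powr s (row (rep C)) z * phase_deriv (row (rep C)) z h)"])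
      (use zb b(1) b' det derivs(2) upper_half_ball[OF z0]
        in \<open>auto intro!: has_derivative_mult_right Im_powr_phase_has_derivative\<close>)
  show "(\<lambda>C. weight i j (rep C) * Im_powr s (row (rep C)) z0) summable_on cosets"
    using b(2)[OF _ zb] by (intro summable_of_bound[OF b(1), where c = 1]) simp
  show "(\<lambda>C. weight i j (rep C) * (Im_powr s (row (rep C)) z0 * phase (row (rep C)) z0)) summable_on cosets"
    using b'[OF _ zb] by (intro summable_of_bound[OF b(1), where c = 1]) simp
  show "(\<lambda>C. weight i j (rep C) * Im_powr_deriv s (row (rep C)) z0 h) summable_on cosets"
    using derivs(1)[OF _ zb] by (intro summable_of_bound[OF b(1), where c = "cmod h"])
  show "(\<lambda>C. weight i j (rep C) * (Im_powr_deriv s (row (rep C)) z0 h * phase (row (rep C)) z0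
        + Im_powr s (row (rep C)) z0 * phase_deriv (row (rep C)) z0 h)) summable_on cosets"
    using derivs(2)[OF _ zb] by (intro summable_of_bound[OF b(1), where c = "cmod h"])
qed

lemma d_dzbar_E: "d_dzbar (E i j s) z0 = \<i> * s / 2 * (E_phase i j s z0 / of_real (Im z0))"
proof -
  have "DE i j s z0 1 + \<i> * DE i j s z0 \<i> =
      (\<Sum>\<^sub>\<infinity>C\<in>cosets. weight i j (rep C) * Im_powr_deriv s (row (rep C)) z0 1
        + \<i> * (weight i j (rep C) * Im_powr_deriv s (row (rep C)) z0 \<i>))"
    unfolding DE_def
    by (subst infsum_add) (auto intro!: DE_summable summable_on_cmult_right simp: infsum_cmult_right DE_summable)
  also have "\<dots> = (\<Sum>\<^sub>\<infinity>C\<in>cosets. \<i> * s / of_real (Im z0) *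
      (weight i j (rep C) * (Im_powr s (row (rep C)) z0 * phase (row (rep C)) z0)))"
  proof (rule infsum_cong)
    fix C
    have "weight i j (rep C) * Im_powr_deriv s (row (rep C)) z0 1
        + \<i> * (weight i j (rep C) * Im_powr_deriv s (row (rep C)) z0 \<i>)
      = weight i j (rep C) * (Im_powr_deriv s (row (rep C)) z0 1 + \<i> * Im_powr_deriv s (row (rep C)) z0 \<i>)"
      by (simp add: algebra_simps)
    then show "weight i j (rep C) * Im_powr_deriv s (row (rep C)) z0 1
        + \<i> * (weight i j (rep C) * Im_powr_deriv s (row (rep C)) z0 \<i>)
      = \<i> * s / of_real (Im z0) *
      (weight i j (rep C) * (Im_powr s (row (rep C)) z0 * phase (row (rep C)) z0))"
      unfolding Im_powr_deriv_dzbar by (simp add: mult_ac)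
  qed
  also have "\<dots> = \<i> * s / of_real (Im z0) * E_phase i j s z0"
    unfolding E_phase_def by (intro infsum_cmult_right E_phase_summable)
  finally show ?thesis
    unfolding d_dzbar_def frechet_derivative_at[OF E_has_derivative, symmetric] by simp
qed

lemma DE_phase_dz:
  "DE_phase i j s z0 1 - \<i> * DE_phase i j s z0 \<i>
    = - \<i> / of_real (Im z0) * ((s - 1) * E i j s z0 + E_phase i j s z0)"
proof -
  define T where "T C h = weight i j (rep C) * (Im_powr_deriv s (row (rep C)) z0 h * phase (row (rep C)) z0
        + Im_powr s (row (rep C)) z0 * phase_deriv (row (rep C)) z0 h)" for C h
  define U where "U C = weight i j (rep C) * Im_powr s (row (rep C)) z0" for C
  define V where "V C = weight i j (rep C) * (Im_powr s (row (rep C)) z0 * phase (row (rep C)) z0)" for C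
  have T: "(\<lambda>C. T C h) summable_on cosets" for h unfolding T_def by (rule DE_phase_summable)
  have U: "U summable_on cosets" unfolding U_def by (rule E_summable)
  have V: "V summable_on cosets" unfolding V_def by (rule E_phase_summable)
  have "DE_phase i j s z0 1 - \<i> * DE_phase i j s z0 \<i> = (\<Sum>\<^sub>\<infinity>C\<in>cosets. T C 1 + (- \<i>) * T C \<i>)"
    unfolding DE_phase_def T_def[symmetric] infsum_add[OF T summable_on_cmult_right[OF T]] infsum_cmult_right'
    by simp
  also have "\<dots> = (\<Sum>\<^sub>\<infinity>C\<in>cosets. - \<i> / of_real (Im z0) * ((s - 1) * U C + V C))"
  proof (rule infsum_cong)
    fix C assume C: "C \<in> cosets"
    have det: "det (row (rep C)) = 1" using C by (intro det_row rep_cosets)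
    let ?D = "\<lambda>h. Im_powr_deriv s (row (rep C)) z0 h * phase (row (rep C)) z0
        + Im_powr s (row (rep C)) z0 * phase_deriv (row (rep C)) z0 h"
    have "T C 1 + (- \<i>) * T C \<i> = weight i j (rep C) * (?D 1 - \<i> * ?D \<i>)"
      by (simp add: T_def algebra_simps)
    also have "\<dots> = - \<i> / of_real (Im z0) * ((s - 1) * U C + V C)"
      unfolding Im_powr_phase_deriv_dz[OF det z0] U_def V_def by (simp only: distrib_left mult_ac)
    finally show "T C 1 + (- \<i>) * T C \<i> = - \<i> / of_real (Im z0) * ((s - 1) * U C + V C)" .
  qed
  also have "\<dots> = - \<i> / of_real (Im z0) * ((s - 1) * E i j s z0 + E_phase i j s z0)"
    unfolding E_def E_phase_def U_def[symmetric] V_def[symmetric]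
    using U V by (simp only: infsum_cmult_right summable_on_cmult_right summable_on_add infsum_add)
  finally show ?thesis .
qed

end

text \<open>The two functions are known to agree only on the half-plane, so the derivative is
  transferred through an open set.\<close>

lemma eisenstein_has_derivative:
  assumes "Re s > 1" "z \<in> upper_half"
  shows "((\<lambda>z. eisenstein \<Gamma> chi f g a \<sigma> i j z s) has_derivative DE i j s z) (at z)"
  by (rule has_derivative_transform_within_open[OF E_has_derivative[OF assms] open_upper_half])
    (use assms in \<open>auto simp: eisenstein_eq\<close>)

lemma d_dzbar_eisenstein:
  assumes "Re s > 1" "z \<in> upper_half"
  shows "d_dzbar (\<lambda>z. eisenstein \<Gamma> chi f g a \<sigma> i j z s) z = \<i> * s / 2 * (E_phase i j s z / of_real (Im z))"
  using d_dzbar_E[OF assms, of i j]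
  unfolding d_dzbar_def frechet_derivative_at[OF eisenstein_has_derivative[OF assms], symmetric]
    frechet_derivative_at[OF E_has_derivative[OF assms], symmetric] .

lemma d_dzbar_eisenstein_has_derivative:
  assumes s: "Re s > 1" and z: "z \<in> upper_half"
  shows "(d_dzbar (\<lambda>z. eisenstein \<Gamma> chi f g a \<sigma> i j z s) has_derivative
    (\<lambda>h. \<i> * s / 2 * ((DE_phase i j s z h * of_real (Im z) - E_phase i j s z * of_real (Im h)) / (of_real (Im z) * of_real (Im z))))) (at z)"
proof (rule has_derivative_transform_within_open[OF _ open_upper_half])
  show "((\<lambda>z. \<i> * s / 2 * (E_phase i j s z / of_real (Im z))) has_derivative
    (\<lambda>h. \<i> * s / 2 * ((DE_phase i j s z h * of_real (Im z) - E_phase i j s z * of_real (Im h)) / (of_real (Im z) * of_real (Im z))))) (at z)"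
    using z by (intro has_derivative_mult_right has_derivative_divide' E_phase_has_derivative s
        has_derivative_of_real has_derivative_Im has_derivative_ident) (auto simp: upper_half_def)
qed (use d_dzbar_eisenstein[OF s] z in auto)

lemma laplacian_defined_eisenstein:
  assumes "Re s > 1"
  shows "laplacian_defined (\<lambda>z. eisenstein \<Gamma> chi f g a \<sigma> i j z s)"
  unfolding laplacian_defined_def differentiable_on_def
  using eisenstein_has_derivative[OF assms] d_dzbar_eisenstein_has_derivative[OF assms]
  by (meson differentiableI differentiable_at_withinI)

lemma hyp_laplacian_eisenstein:
  assumes s: "Re s > 1" and z: "z \<in> upper_half"
  shows "hyp_laplacian (\<lambda>z. eisenstein \<Gamma> chi f g a \<sigma> i j z s) z
    = s * (1 - s) * eisenstein \<Gamma> chi f g a \<sigma> i j z s"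
proof -
  define y where "y = complex_of_real (Im z)"
  have y: "y \<noteq> 0" using z by (simp add: y_def upper_half_def)
  let ?d = "\<lambda>h. \<i> * s / 2 * ((DE_phase i j s z h * y - E_phase i j s z * of_real (Im h)) / (y * y))"
  have "?d 1 - \<i> * ?d \<i> = \<i> * s / 2 * (((DE_phase i j s z 1 - \<i> * DE_phase i j s z \<i>) * y
      + \<i> * E_phase i j s z) / (y * y))"
    by (simp add: algebra_simps add_divide_distrib diff_divide_distrib)
  also have "(DE_phase i j s z 1 - \<i> * DE_phase i j s z \<i>) * y = - \<i> * ((s - 1) * E i j s z + E_phase i j s z)"
    unfolding DE_phase_dz[OF s z] y_def[symmetric] using y by simp
  \<comment> \<open>The quotient rule for 1 / Im z contributes i * E_phase, which cancels the phase
    part of \<open>DE_phase_dz\<close>. Only a multiple of \<open>E\<close> survives.\<close>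
  also have "- \<i> * ((s - 1) * E i j s z + E_phase i j s z) + \<i> * E_phase i j s z = - \<i> * (s - 1) * E i j s z"
    by (simp add: algebra_simps)
  also have "\<i> * s / 2 * (- \<i> * (s - 1) * E i j s z / (y * y)) = s * (s - 1) * E i j s z / (2 * (y * y))"
    using y by (simp add: field_simps)
  finally have "?d 1 - \<i> * ?d \<i> = s * (s - 1) * E i j s z / (2 * (y * y))" .
  then have "d_dz (d_dzbar (\<lambda>z. eisenstein \<Gamma> chi f g a \<sigma> i j z s)) z = s * (s - 1) * E i j s z / (4 * (y * y))"
    unfolding d_dz_def frechet_derivative_at[OF d_dzbar_eisenstein_has_derivative[OF s z], symmetric] y_def[symmetric]
    by simp
  then have "hyp_laplacian (\<lambda>z. eisenstein \<Gamma> chi f g a \<sigma> i j z s) z = - (s * (s - 1) * E i j s z)"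
    unfolding hyp_laplacian_def of_real_power y_def[symmetric]
    using y by (simp add: power2_eq_square)
  then show ?thesis by (simp add: eisenstein_eq[OF z] algebra_simps)
qed

end

section \<open>The transformation law\<close>

text \<open>The path from i to \<gamma> \<delta> i is split at \<delta> i, which serves as base
  point for \<gamma>.\<close>

lemma modular_symbol_mult:
  assumes "\<Gamma> \<subseteq> carrier SL2R" "cusp_form2 \<Gamma> u" "\<gamma> \<in> \<Gamma>" "\<delta> \<in> \<Gamma>" "\<gamma> ** \<delta> \<in> \<Gamma>"
  shows "modular_symbol (\<gamma> ** \<delta>) u = modular_symbol \<gamma> u + modular_symbol \<delta> u"
proof -
  obtain F where F: "\<And>z. z \<in> upper_half \<Longrightarrow> (F has_field_derivative u z) (at z)"
    using upper_half_primitive assms by (auto simp: cusp_form2_def)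
  have ms: "modular_symbol \<eta> u = F (moebius_act \<eta> z) - F z" if "\<eta> \<in> \<Gamma>" "z \<in> upper_half" for \<eta> z
    using F _ _ that(2) by (rule modular_symbol_primitive) (use assms that in \<open>auto simp: cusp_form2_def\<close>)
  have det: "det \<delta> = 1" using assms by auto
  have "moebius_act \<delta> \<i> \<in> upper_half" by (rule moebius_upper_half[OF det]) simp
  then show ?thesis
    using ms[OF assms(3)] ms[OF assms(4) ii_upper_half] ms[OF assms(5) ii_upper_half]
    by (simp add: moebius_act_mult det)
qed

lemma infsum_sum:
  fixes F :: "'i \<Rightarrow> 'a \<Rightarrow> complex"
  assumes "finite I" "\<And>i. i \<in> I \<Longrightarrow> F i summable_on A"
  shows "(\<lambda>x. \<Sum>i\<in>I. F i x) summable_on A"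
    and "(\<Sum>\<^sub>\<infinity>x\<in>A. \<Sum>i\<in>I. F i x) = (\<Sum>i\<in>I. \<Sum>\<^sub>\<infinity>x\<in>A. F i x)"
  using assms by (induction I rule: finite_induct) (simp_all add: summable_on_add infsum_add)

lemma unitary_character_one:
  assumes "subgroup \<Gamma> SL2R" "cuspidal_unitary_character \<Gamma> chi"
  shows "chi (Finite_Cartesian_Product.mat 1) = 1"
proof -
  have one: "Finite_Cartesian_Product.mat 1 \<in> \<Gamma>"
    using subgroup.one_closed[OF assms(1)] by simp
  then have "chi (Finite_Cartesian_Product.mat 1) = chi (Finite_Cartesian_Product.mat 1) * chi (Finite_Cartesian_Product.mat 1)"
    using assms(2) unfolding cuspidal_unitary_character_def by (metis matrix_mul_lid)
  moreover have "chi (Finite_Cartesian_Product.mat 1) \<noteq> 0"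
    using assms(2) one by (auto simp: cuspidal_unitary_character_def)
  ultimately show ?thesis by simp
qed

context eisenstein_cusp
begin

lemma \<Gamma>_subset: "\<Gamma> \<subseteq> carrier SL2R"
  using subgroup by (rule subgroup.subset)

lemma chi_mult: "\<gamma> \<in> \<Gamma> \<Longrightarrow> \<delta> \<in> \<Gamma> \<Longrightarrow> chi (\<gamma> ** \<delta>) = chi \<gamma> * chi \<delta>"
  using character by (simp add: cuspidal_unitary_character_def)

lemma chi_nonzero: "\<gamma> \<in> \<Gamma> \<Longrightarrow> chi \<gamma> \<noteq> 0"
  using character by (auto simp: cuspidal_unitary_character_def)

lemma weight_mult:
  assumes "\<gamma> \<in> \<Gamma>" "\<delta> \<in> \<Gamma>"
  shows "weight i j (\<gamma> ** \<delta>) = chi \<gamma> * chi \<delta> * (modular_symbol \<gamma> f + modular_symbol \<delta> f) ^ i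
    * cnj (modular_symbol \<gamma> g + modular_symbol \<delta> g) ^ j"
  using assms cusp_form \<Gamma>_subset by (simp add: weight_def chi_mult modular_symbol_mult mult_\<Gamma>)

lemma weight_stab:
  assumes "h \<in> stab" "\<gamma> \<in> \<Gamma>"
  shows "weight i j (h ** \<gamma>) = weight i j \<gamma>"
proof -
  have "chi h = 1" using character cusp assms by (simp add: cuspidal_unitary_character_def)
  moreover have "modular_symbol h f = 0" "modular_symbol h g = 0"
    using assms cusp_form by (simp_all add: modular_symbol_stabilizer)
  ultimately show ?thesis
    unfolding weight_mult[OF stab_\<Gamma>[OF assms(1)] assms(2)] by (simp add: weight_def)
qed

text \<open>A stabilizing h acts in the coordinate at the cusp as a real shift, whatever the sign of
  conj h.\<close>

lemma Im_powr_stab: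
  assumes "h \<in> stab" "\<gamma> \<in> \<Gamma>" "z \<in> upper_half"
  shows "Im_powr s (row (h ** \<gamma>)) z = Im_powr s (row \<gamma>) z"
proof -
  have det: "det (conj h) = 1" using assms by (simp add: stab_\<Gamma> det_\<Gamma>)
  obtain k :: int where k: "conj h = translation (of_int k) \<or> conj h = - translation (of_int k)"
    using conj_stabilizer[OF assms(1)] .
  have "row (h ** \<gamma>) = conj h ** row \<gamma>" by (simp add: row_def conj_def matrix_mul_assoc)
  then have "moebius_act (row (h ** \<gamma>)) z = moebius_act (conj h) (moebius_act (row \<gamma>) z)"
    using assms by (simp add: moebius_act_mult det_row)
  also have "\<dots> = moebius_act (row \<gamma>) z + of_real (conj h $1$2 / conj h $2$2)"
    by (rule moebius_act_upper_triangular[OF det]) (use k in auto)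
  finally have "Im (moebius_act (row (h ** \<gamma>)) z) = Im (moebius_act (row \<gamma>) z)"
    by (simp del: of_real_divide)
  then show ?thesis by (simp add: Im_powr_def)
qed

text \<open>Right multiplication by \<delta> permutes the cosets of \<Gamma>_a, with inverse right
  multiplication by \<delta>^-1. The map passes through chosen representatives, and
  \<open>coset_stab\<close> removes the stabilizer element this introduces.\<close>

lemma coset_translate_bij:
  assumes "\<delta> \<in> \<Gamma>"
  shows "bij_betw (\<lambda>C. coset (rep C ** \<delta>)) cosets cosets"
proof -
  have inverse: "coset (rep (coset (rep C ** \<delta>)) ** \<epsilon>) = C"
    if "\<delta> \<in> \<Gamma>" "C \<in> cosets" "\<And>A :: real^2^2. A ** \<delta> ** \<epsilon> = A" for \<delta> \<epsilon> C
  proof -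
    have "rep C ** \<delta> \<in> \<Gamma>" using that by (intro mult_\<Gamma> rep_cosets)
    then obtain h where h: "h \<in> stab" "rep (coset (rep C ** \<delta>)) = h ** (rep C ** \<delta>)"
      using rep_coset by blast
    have "h ** (rep C ** \<delta>) ** \<epsilon> = h ** rep C"
      by (simp only: matrix_mul_assoc that(3))
    then show ?thesis using h that(2) by (simp add: coset_stab rep_cosets)
  qed
  have det: "det \<delta> = 1" using assms by (rule det_\<Gamma>)
  show ?thesis
  proof (rule bij_betw_byWitness[where f' = "\<lambda>C. coset (rep C ** SL_inv \<delta>)"])
    show "\<forall>C\<in>cosets. coset (rep (coset (rep C ** \<delta>)) ** SL_inv \<delta>) = C"
      using assms det by (intro ballI inverse) auto
    show "\<forall>C\<in>cosets. coset (rep (coset (rep C ** SL_inv \<delta>)) ** \<delta>) = C"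
      using assms det by (intro ballI inverse inv_\<Gamma>) auto
  qed (use assms in \<open>auto simp: cosets_def intro!: imageI mult_\<Gamma> inv_\<Gamma> rep_cosets\<close>)
qed

text \<open>The chosen representative of the translated coset differs from rep C ** \<delta> by a
  stabilizing factor. Reindexing is still possible because H takes the same value on all elements of
  a coset.\<close>

lemma E_translate:
  assumes \<delta>: "\<delta> \<in> \<Gamma>" and z: "z \<in> upper_half"
  shows "E i j s (moebius_act \<delta> z)
    = (\<Sum>\<^sub>\<infinity>C\<in>cosets. weight i j (rep C ** SL_inv \<delta>) * Im_powr s (row (rep C)) z)"
proof -
  have det: "det \<delta> = 1" using \<delta> by (rule det_\<Gamma>)
  define H where "H \<eta> = weight i j (\<eta> ** SL_inv \<delta>) * Im_powr s (row \<eta>) z" for \<eta>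
  have H: "H (rep (coset \<eta>)) = H \<eta>" if \<eta>: "\<eta> \<in> \<Gamma>" for \<eta>
  proof -
    obtain h where h: "h \<in> stab" "rep (coset \<eta>) = h ** \<eta>" using rep_coset[OF \<eta>] .
    have "weight i j (h ** \<eta> ** SL_inv \<delta>) = weight i j (\<eta> ** SL_inv \<delta>)"
      unfolding matrix_mul_assoc[symmetric] using h \<eta> \<delta> by (intro weight_stab mult_\<Gamma> inv_\<Gamma>)
    then show ?thesis using h \<eta> z by (simp add: H_def Im_powr_stab)
  qed
  have "E i j s (moebius_act \<delta> z) = (\<Sum>\<^sub>\<infinity>C\<in>cosets. H (rep (coset (rep C ** \<delta>))))"
    unfolding E_def
  proof (rule infsum_cong)
    fix C assume C: "C \<in> cosets"
    have "row (rep C ** \<delta>) = row (rep C) ** \<delta>" by (simp add: row_def matrix_mul_assoc)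
    then have "Im_powr s (row (rep C)) (moebius_act \<delta> z) = Im_powr s (row (rep C ** \<delta>)) z"
      using det z by (simp add: Im_powr_def moebius_act_mult)
    moreover have "H (rep (coset (rep C ** \<delta>))) = H (rep C ** \<delta>)"
      using C \<delta> by (intro H mult_\<Gamma> rep_cosets)
    ultimately show "weight i j (rep C) * Im_powr s (row (rep C)) (moebius_act \<delta> z)
        = H (rep (coset (rep C ** \<delta>)))"
      using det by (simp add: H_def)
  qed
  also have "\<dots> = (\<Sum>\<^sub>\<infinity>C\<in>cosets. H (rep C))"
    by (rule infsum_reindex_bij_betw[OF coset_translate_bij[OF \<delta>], of "\<lambda>C. H (rep C)"])
  finally show ?thesis by (simp add: H_def)
qed

lemma weight_translate:
  assumes \<gamma>: "\<gamma> \<in> \<Gamma>" and \<delta>: "\<delta> \<in> \<Gamma>"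
  shows "weight i j (\<gamma> ** SL_inv \<delta>) = (\<Sum>p\<le>i. \<Sum>q\<le>j. inverse (chi \<delta>) *
    (of_nat (i choose p) * (- modular_symbol \<delta> f) ^ p) *
    (of_nat (j choose q) * (- cnj (modular_symbol \<delta> g)) ^ q) * weight (i - p) (j - q) \<gamma>)"
proof -
  have det: "det \<delta> = 1" using \<delta> by (rule det_\<Gamma>)
  \<comment> \<open>With both exponents 0 the weight is chi, so this is its multiplicativity applied
    to \<gamma> = (\<gamma> \<delta>^-1) \<delta>.\<close>
  have w: "weight 0 0 (\<gamma> ** SL_inv \<delta> ** \<delta>) = chi (\<gamma> ** SL_inv \<delta>) * chi \<delta>"
    using \<gamma> \<delta> by (subst weight_mult) (auto intro: mult_\<Gamma> inv_\<Gamma>)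
  then have chi: "chi (\<gamma> ** SL_inv \<delta>) = inverse (chi \<delta>) * chi \<gamma>"
    using det chi_nonzero[OF \<delta>] by (simp add: weight_def field_simps)
  have ms: "modular_symbol (\<gamma> ** SL_inv \<delta>) u = - modular_symbol \<delta> u + modular_symbol \<gamma> u"
    if "cusp_form2 \<Gamma> u" for u
    using modular_symbol_mult[OF \<Gamma>_subset that, of "\<gamma> ** SL_inv \<delta>" \<delta>] \<gamma> \<delta> det
    by (simp add: mult_\<Gamma> inv_\<Gamma>)
  have "weight i j (\<gamma> ** SL_inv \<delta>) = inverse (chi \<delta>) * chi \<gamma>
      * (- modular_symbol \<delta> f + modular_symbol \<gamma> f) ^ i
      * (- cnj (modular_symbol \<delta> g) + cnj (modular_symbol \<gamma> g)) ^ j"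
    by (simp add: weight_def chi ms cusp_form)
  also have "\<dots> = (\<Sum>p\<le>i. \<Sum>q\<le>j. inverse (chi \<delta>) * chi \<gamma> *
    ((of_nat (i choose p) * (- modular_symbol \<delta> f) ^ p * modular_symbol \<gamma> f ^ (i - p)) *
    (of_nat (j choose q) * (- cnj (modular_symbol \<delta> g)) ^ q * cnj (modular_symbol \<gamma> g) ^ (j - q))))"
    unfolding mult.assoc[of "inverse (chi \<delta>) * chi \<gamma>"] binomial_ring sum_product unfolding sum_distrib_left ..
  also have "\<dots> = (\<Sum>p\<le>i. \<Sum>q\<le>j. inverse (chi \<delta>) *
    (of_nat (i choose p) * (- modular_symbol \<delta> f) ^ p) *
    (of_nat (j choose q) * (- cnj (modular_symbol \<delta> g)) ^ q) * weight (i - p) (j - q) \<gamma>)"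
    by (intro sum.cong refl) (simp add: weight_def)
  finally show ?thesis .
qed

lemma E_transformation:
  assumes s: "Re s > 1" and \<delta>: "\<delta> \<in> \<Gamma>" and z: "z \<in> upper_half"
  shows "E i j s (moebius_act \<delta> z) = (\<Sum>p\<le>i. \<Sum>q\<le>j. inverse (chi \<delta>) *
    (of_nat (i choose p) * (- modular_symbol \<delta> f) ^ p) *
    (of_nat (j choose q) * (- cnj (modular_symbol \<delta> g)) ^ q) * E (i - p) (j - q) s z)"
proof -
  define c where "c p q = inverse (chi \<delta>) *
    (of_nat (i choose p) * (- modular_symbol \<delta> f) ^ p) *
    (of_nat (j choose q) * (- cnj (modular_symbol \<delta> g)) ^ q)" for p q
  have "E i j s (moebius_act \<delta> z) = (\<Sum>\<^sub>\<infinity>C\<in>cosets. \<Sum>p\<le>i. \<Sum>q\<le>j.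
      c p q * (weight (i - p) (j - q) (rep C) * Im_powr s (row (rep C)) z))"
    unfolding E_translate[OF \<delta> z]
    by (intro infsum_cong) (simp add: weight_translate rep_cosets \<delta> sum_distrib_right c_def mult.assoc)
  also have "\<dots> = (\<Sum>p\<le>i. \<Sum>q\<le>j. \<Sum>\<^sub>\<infinity>C\<in>cosets.
      c p q * (weight (i - p) (j - q) (rep C) * Im_powr s (row (rep C)) z))"
    by (simp only: infsum_sum finite_atMost summable_on_cmult_right E_summable s z)
  also have "\<dots> = (\<Sum>p\<le>i. \<Sum>q\<le>j. c p q * E (i - p) (j - q) s z)"
    by (simp add: infsum_cmult_right' E_def)
  finally show ?thesis by (simp add: c_def)
qed

end

section \<open>Binomial matrices\<close>

text \<open>The matrix of the substitution X \<mapsto> X + a on polynomials of degree at most M, in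
  the basis X^M, ..., X, 1: row i expands (X + a)^(M-i). In this order it is upper triangular with
  ones on the diagonal.\<close>

definition binomial_entry :: "nat \<Rightarrow> complex \<Rightarrow> nat \<Rightarrow> nat \<Rightarrow> complex" where
  "binomial_entry M a i k = (if i \<le> k then of_nat ((M - i) choose (k - i)) * a ^ (k - i) else 0)"

lemma binomial_entry_sum:
  assumes "i < M + 1"
  shows "(\<Sum>k<M+1. binomial_entry M a i k * X (M - k))
    = (\<Sum>p\<le>M - i. of_nat ((M - i) choose p) * a ^ p * X (M - i - p))"
proof -
  have "(\<Sum>k<M+1. binomial_entry M a i k * X (M - k)) = (\<Sum>k\<in>{i..M}. binomial_entry M a i k * X (M - k))"
    by (rule sum.mono_neutral_right) (auto simp: binomial_entry_def)
  also have "\<dots> = (\<Sum>p\<le>M - i. of_nat ((M - i) choose p) * a ^ p * X (M - i - p))"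
    by (rule sum.reindex_bij_witness[where i = "\<lambda>p. p + i" and j = "\<lambda>k. k - i"])
      (use assms in \<open>auto simp: binomial_entry_def\<close>)
  finally show ?thesis .
qed

text \<open>Two successive shifts by a and b are the shift by a + b. In coefficients this is the
  trinomial revision \<open>choose_mult\<close> followed by the binomial theorem; l \<le> M ensures
  that the sum contains all k from i to l.\<close>

lemma binomial_entry_mult:
  assumes "l < M + 1"
  shows "(\<Sum>k<M+1. binomial_entry M a i k * binomial_entry M b k l) = binomial_entry M (a + b) i l"
proof (cases "i \<le> l")
  case True
  have "(\<Sum>k<M+1. binomial_entry M a i k * binomial_entry M b k l)
      = (\<Sum>k\<in>{i..l}. binomial_entry M a i k * binomial_entry M b k l)"
    using assms by (intro sum.mono_neutral_right) (auto simp: binomial_entry_def)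
  also have "\<dots> = (\<Sum>p\<le>l - i. of_nat ((M - i) choose (l - i)) * (of_nat ((l - i) choose p) * a ^ p * b ^ (l - i - p)))"
  proof (rule sum.reindex_bij_witness[where i = "\<lambda>p. p + i" and j = "\<lambda>k. k - i"])
    fix k assume k: "k \<in> {i..l}"
    have "((M - i) choose (l - i)) * ((l - i) choose (k - i)) = ((M - i) choose (k - i)) * ((M - i - (k - i)) choose (l - i - (k - i)))"
      using k assms by (intro choose_mult) auto
    moreover have "M - i - (k - i) = M - k" "l - i - (k - i) = l - k" using k by auto
    ultimately have "of_nat ((M - i) choose (l - i)) * of_nat ((l - i) choose (k - i))
        = (of_nat ((M - i) choose (k - i)) * of_nat ((M - k) choose (l - k)) :: complex)"
      by (metis of_nat_mult)
    then show "of_nat ((M - i) choose (l - i)) * (of_nat ((l - i) choose (k - i)) * a ^ (k - i) * b ^ (l - i - (k - i)))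
        = binomial_entry M a i k * binomial_entry M b k l"
      using k by (simp add: binomial_entry_def mult_ac)
  qed (use assms True in auto)
  also have "\<dots> = binomial_entry M (a + b) i l"
    using True by (simp add: binomial_entry_def binomial_ring sum_distrib_left)
  finally show ?thesis .
next
  case False
  then have "(\<Sum>k<M+1. binomial_entry M a i k * binomial_entry M b k l) = 0"
    by (intro sum.neutral) (auto simp: binomial_entry_def)
  then show ?thesis using False by (simp add: binomial_entry_def)
qed

lemma binomial_entry_zero: "binomial_entry M 0 i k = (if i = k then 1 else 0)"
  by (auto simp: binomial_entry_def power_0_left)

lemma binomial_entry_diag [simp]: "binomial_entry M a i i = 1"
  by (simp add: binomial_entry_def)

section \<open>Lexicographic block indices\<close>

lemma nth_concat_uniform:
  assumes "\<And>x. x \<in> set xs \<Longrightarrow> length (F x) = L" "k < length xs * L"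
  shows "concat (map F xs) ! k = F (xs ! (k div L)) ! (k mod L)"
  using assms
proof (induction xs arbitrary: k)
  case (Cons x xs)
  have L: "L > 0" using Cons.prems(2) by (cases L) auto
  show ?case
  proof (cases "k < L")
    case True
    then show ?thesis using Cons.prems by (simp add: nth_append)
  next
    case False
    then have "k div L = Suc ((k - L) div L)" "k mod L = (k - L) mod L"
      using L by (simp_all add: le_div_geq le_mod_geq)
    then show ?thesis
      using False Cons.prems Cons.IH[of "k - L"] by (simp add: nth_append)
  qed
qed simp

lemma sum_div_mod:
  "(\<Sum>k<A * L. F (k div L) (k mod L)) = (\<Sum>x<A. \<Sum>y<L. F x y :: 'a::comm_monoid_add)" for A L :: nat
proof -
  have "(\<Sum>k<A * L. F (k div L) (k mod L)) = (\<Sum>(x, y)\<in>{..<A} \<times> {..<L}. F x y)"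
  proof (rule sum.reindex_bij_witness[where i = "\<lambda>(x, y). x * L + y" and j = "\<lambda>k. (k div L, k mod L)"])
    fix k assume k: "k \<in> {..<A * L}"
    then have "L > 0" by (cases L) auto
    then show "(k div L, k mod L) \<in> {..<A} \<times> {..<L}"
      using k by (auto simp: less_mult_imp_div_less)
  next
    fix b assume b: "b \<in> {..<A} \<times> {..<L}"
    then obtain x y where xy: "b = (x, y)" "x < A" "y < L" by auto
    have "x * L + y < (x + 1) * L" using xy by simp
    also have "\<dots> \<le> A * L" using xy by (intro mult_le_mono1) simp
    finally show "(case b of (x, y) \<Rightarrow> x * L + y) \<in> {..<A * L}" using xy by simp
    show "((case b of (x, y) \<Rightarrow> x * L + y) div L, (case b of (x, y) \<Rightarrow> x * L + y) mod L) = b"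
      using xy by simp
  qed auto
  then show ?thesis by (simp add: sum.cartesian_product)
qed

locale block_index =
  fixes r m n :: nat
begin

text \<open>Bracketed like the nested list in \<open>eisenstein_vec\<close>, so that the position
  (i1 * (n + 1) + i2) * r + j is decoded by two divisions with remainder.\<close>

definition N :: nat where "N = (m + 1) * ((n + 1) * r)"

definition i1 :: "nat \<Rightarrow> nat" where "i1 k = k div ((n + 1) * r)"

definition i2 :: "nat \<Rightarrow> nat" where "i2 k = k mod ((n + 1) * r) div r"

definition cusp_index :: "nat \<Rightarrow> nat" where "cusp_index k = k mod ((n + 1) * r) mod r"

lemma index_bounds:
  assumes "k < N"
  shows "i1 k < m + 1" "i2 k < n + 1" "cusp_index k < r"
proof -
  have r: "(n + 1) * r > 0" using assms by (auto simp: N_def intro: ccontr)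
  show "i1 k < m + 1"
    using assms by (simp add: i1_def N_def less_mult_imp_div_less del: mult_Suc mult_Suc_right)
  show "i2 k < n + 1"
    unfolding i2_def using r by (intro less_mult_imp_div_less mod_less_divisor)
  show "cusp_index k < r" unfolding cusp_index_def using r by (intro mod_less_divisor) auto
qed

lemma index_sum: "(\<Sum>k<N. F (i1 k) (i2 k) (cusp_index k)) = (\<Sum>a<m+1. \<Sum>b<n+1. \<Sum>j<r. F a b j :: 'a::comm_monoid_add)"
  unfolding N_def i1_def i2_def cusp_index_def
  by (subst sum_div_mod[of "\<lambda>x y. F x (y div r) (y mod r)"]) (simp only: sum_div_mod[of "F _"])

lemma index_eqI:
  assumes "i1 x = i1 y" "i2 x = i2 y" "cusp_index x = cusp_index y"
  shows "x = y"
proof -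
  have "x mod ((n + 1) * r) = y mod ((n + 1) * r)"
    using assms(2,3) unfolding i2_def cusp_index_def by (metis div_mult_mod_eq)
  then show ?thesis using assms(1) unfolding i1_def by (metis div_mult_mod_eq)
qed

lemma index_mono:
  assumes "x \<le> y"
  shows "i1 x < i1 y \<or> (i1 x = i1 y \<and> i2 x \<le> i2 y)"
proof -
  have "i1 x \<le> i1 y" unfolding i1_def using assms by (rule div_le_mono)
  moreover have "i2 x \<le> i2 y" if "i1 x = i1 y"
  proof -
    have "x mod ((n + 1) * r) \<le> y mod ((n + 1) * r)"
      using assms that unfolding i1_def
      by (metis add_le_cancel_left div_mult_mod_eq)
    then show ?thesis unfolding i2_def by (rule div_le_mono)
  qed
  ultimately show ?thesis by auto
qed

lemma eisenstein_vec_index: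
  assumes "k < N"
  shows "vec_index (eisenstein_vec \<Gamma> chi f g r \<aa> \<sigma> m n z s) k
    = eisenstein \<Gamma> chi f g (\<aa> (cusp_index k)) (\<sigma> (cusp_index k)) (m - i1 k) (n - i2 k) z s"
proof -
  note b = index_bounds[OF assms]
  have k: "k < (m + 1) * ((n + 1) * r)" using assms by (simp add: N_def)
  have r: "r > 0" using b(3) by simp
  have len: "length (concat (map (\<lambda>i2. map (\<lambda>j. F i2 j) [0..<r]) [0..<n+1])) = (n + 1) * r" for F :: "nat \<Rightarrow> nat \<Rightarrow> complex"
    by (simp add: length_concat comp_def sum_list_triv del: upt_Suc)
  have md: "k mod ((n + 1) * r) < (n + 1) * r" using r by (intro mod_less_divisor) simp
  show ?thesis
    unfolding eisenstein_vec_def vec_of_list_index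
    apply (subst nth_concat_uniform[where L = "(n + 1) * r"])
      apply (rule len)
    using k apply (simp del: upt_Suc)
    apply (subst nth_concat_uniform[where L = r])
      apply (simp del: upt_Suc)
    using md apply (simp del: upt_Suc)
    using b by (simp add: i1_def i2_def cusp_index_def del: upt_Suc)
qed

text \<open>c times the Kronecker product of P, Q and the identity of size r: the cusps are never
  mixed, and each of them carries the same coefficients.\<close>

definition block_mat :: "complex \<Rightarrow> (nat \<Rightarrow> nat \<Rightarrow> complex) \<Rightarrow> (nat \<Rightarrow> nat \<Rightarrow> complex) \<Rightarrow> complex Matrix.mat" where
  "block_mat c P Q = Matrix.mat N N (\<lambda>(x, y). c * P (i1 x) (i1 y) * Q (i2 x) (i2 y)
     * (if cusp_index x = cusp_index y then 1 else 0))"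

lemma block_mat_carrier [simp]: "block_mat c P Q \<in> carrier_mat N N"
  by (simp add: block_mat_def)

text \<open>The mixed product rule for Kronecker products.\<close>

lemma block_mat_mult:
  "block_mat c P Q * block_mat c' P' Q' =
     block_mat (c * c') (\<lambda>i l. \<Sum>k<m+1. P i k * P' k l) (\<lambda>i l. \<Sum>k<n+1. Q i k * Q' k l)"
proof (rule eq_matI)
  fix x y assume "x < dim_row (block_mat (c * c') (\<lambda>i l. \<Sum>k<m+1. P i k * P' k l) (\<lambda>i l. \<Sum>k<n+1. Q i k * Q' k l))"
    "y < dim_col (block_mat (c * c') (\<lambda>i l. \<Sum>k<m+1. P i k * P' k l) (\<lambda>i l. \<Sum>k<n+1. Q i k * Q' k l))"
  then have xy: "x < N" "y < N" by (simp_all add: block_mat_def)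
  have jx: "cusp_index x \<in> {..<r}" using index_bounds[OF xy(1)] by simp
  define \<delta> where "\<delta> j l = (if j = l then 1 else 0 :: complex)" for j l :: nat
  have "(block_mat c P Q * block_mat c' P' Q') $$ (x, y) =
      (\<Sum>k<N. (c * P (i1 x) (i1 k) * Q (i2 x) (i2 k) * \<delta> (cusp_index x) (cusp_index k))
        * (c' * P' (i1 k) (i1 y) * Q' (i2 k) (i2 y) * \<delta> (cusp_index k) (cusp_index y)))"
    using xy by (simp add: block_mat_def scalar_prod_def \<delta>_def atLeast0LessThan)
  also have "\<dots> = (\<Sum>a<m+1. \<Sum>b<n+1. \<Sum>j<r. (c * P (i1 x) a * Q (i2 x) b * \<delta> (cusp_index x) j)
        * (c' * P' a (i1 y) * Q' b (i2 y) * \<delta> j (cusp_index y)))"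
    by (rule index_sum)
  also have "\<dots> = (\<Sum>a<m+1. \<Sum>b<n+1. c * c' * (P (i1 x) a * P' a (i1 y)) * (Q (i2 x) b * Q' b (i2 y))
      * (\<Sum>j<r. \<delta> (cusp_index x) j * \<delta> j (cusp_index y)))"
    unfolding sum_distrib_left by (intro sum.cong refl) (simp add: mult_ac)
  also have "(\<Sum>j<r. \<delta> (cusp_index x) j * \<delta> j (cusp_index y)) = \<delta> (cusp_index x) (cusp_index y)"
    using jx by (simp add: \<delta>_def if_distrib[of "\<lambda>u. u * _"] sum.delta cong: if_cong)
  also have "(\<Sum>a<m+1. \<Sum>b<n+1. c * c' * (P (i1 x) a * P' a (i1 y)) * (Q (i2 x) b * Q' b (i2 y)) * \<delta> (cusp_index x) (cusp_index y))
    = c * c' * (\<Sum>a<m+1. P (i1 x) a * P' a (i1 y)) * (\<Sum>b<n+1. Q (i2 x) b * Q' b (i2 y)) * \<delta> (cusp_index x) (cusp_index y)"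
    unfolding mult.assoc[of "c * c'"] sum_product unfolding sum_distrib_left sum_distrib_right
    by (simp only: mult.assoc)
  finally show "(block_mat c P Q * block_mat c' P' Q') $$ (x, y) =
      block_mat (c * c') (\<lambda>i l. \<Sum>k<m+1. P i k * P' k l) (\<lambda>i l. \<Sum>k<n+1. Q i k * Q' k l) $$ (x, y)"
    using xy by (simp add: block_mat_def \<delta>_def)
qed (simp_all add: block_mat_def)

lemma block_mat_cong:
  assumes "c = c'" "\<And>i l. i < m + 1 \<Longrightarrow> l < m + 1 \<Longrightarrow> P i l = P' i l" "\<And>i l. i < n + 1 \<Longrightarrow> l < n + 1 \<Longrightarrow> Q i l = Q' i l"
  shows "block_mat c P Q = block_mat c' P' Q'"
  unfolding block_mat_def
proof (rule cong_mat)
  fix x y assume x: "x < N" and y: "y < N"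
  have "P (i1 x) (i1 y) = P' (i1 x) (i1 y)"
    using index_bounds[OF x] index_bounds[OF y] by (intro assms)
  moreover have "Q (i2 x) (i2 y) = Q' (i2 x) (i2 y)"
    using index_bounds[OF x] index_bounds[OF y] by (intro assms)
  ultimately show "(case (x, y) of (x, y) \<Rightarrow> c * P (i1 x) (i1 y) * Q (i2 x) (i2 y) * (if cusp_index x = cusp_index y then 1 else 0))
    = (case (x, y) of (x, y) \<Rightarrow> c' * P' (i1 x) (i1 y) * Q' (i2 x) (i2 y) * (if cusp_index x = cusp_index y then 1 else 0))"
    by (simp add: assms(1))
qed simp_all

definition rep_mat :: "complex \<Rightarrow> complex \<Rightarrow> complex \<Rightarrow> complex Matrix.mat" where
  "rep_mat c a b = block_mat c (binomial_entry m a) (binomial_entry n b)"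

lemma rep_mat_carrier [simp]: "rep_mat c a b \<in> carrier_mat N N"
  by (simp add: rep_mat_def)

lemma rep_mat_mult: "rep_mat c a b * rep_mat c' a' b' = rep_mat (c * c') (a + a') (b + b')"
  unfolding rep_mat_def block_mat_mult by (intro block_mat_cong refl binomial_entry_mult)

lemma rep_mat_one: "rep_mat 1 0 0 = 1\<^sub>m N"
  by (rule eq_matI) (auto simp: rep_mat_def block_mat_def binomial_entry_zero dest: index_eqI)

text \<open>Each factor moves the support at least one diagonal further from the main one. For k = M
  no entry is left, which yields nilpotency below.\<close>

lemma strictly_upper_power:
  assumes A: "A \<in> carrier_mat M M" and upper: "\<And>x y. x < M \<Longrightarrow> y < M \<Longrightarrow> y \<le> x \<Longrightarrow> A $$ (x, y) = 0"
    and "x < M" "y < M" "y < x + k"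
  shows "(A ^\<^sub>m k) $$ (x, y) = (0 :: complex)"
  using assms(3-)
proof (induction k arbitrary: y)
  case (Suc k)
  have "(A ^\<^sub>m Suc k) $$ (x, y) = (\<Sum>j<M. (A ^\<^sub>m k) $$ (x, j) * A $$ (j, y))"
    using A Suc.prems pow_carrier_mat[OF A, of k] by (simp add: scalar_prod_def atLeast0LessThan)
  also have "\<dots> = 0"
  proof (rule sum.neutral, rule ballI)
    fix j assume j: "j \<in> {..<M}"
    show "(A ^\<^sub>m k) $$ (x, j) * A $$ (j, y) = 0"
    \<comment> \<open>If j \<ge> x + k, then y \<le> x + k \<le> j, so the last factor lies on or
      below the diagonal.\<close>
    proof (cases "j < x + k")
      case True
      then show ?thesis using Suc j by simp
    next
      case False
      then show ?thesis using upper[of j y] Suc.prems j by simp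
    qed
  qed
  finally show ?case .
qed (use A in simp)

lemma rep_mat_Uni: "rep_mat 1 a b \<in> Uni N"
proof -
  let ?A = "rep_mat 1 a b - 1\<^sub>m N"
  have A: "?A \<in> carrier_mat N N" by (intro minus_carrier_mat one_carrier_mat)
  have upper: "?A $$ (x, y) = 0" if xy: "x < N" "y < N" "y \<le> x" for x y
  proof (cases "x = y")
    case True
    then show ?thesis using xy by (simp add: rep_mat_def block_mat_def)
  next
    case False
    \<comment> \<open>The cusp index need not be monotone along the ordering, but it differs once
      both block indices agree. Each of the three alternatives annihilates one Kronecker
      factor.\<close>
    have "i1 y < i1 x \<or> (i1 x = i1 y \<and> i2 y < i2 x) \<or> cusp_index x \<noteq> cusp_index y"
      using index_mono[OF xy(3)] index_eqI[of x y] False by (metis le_neq_implies_less)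
    then show ?thesis using xy False by (auto simp: rep_mat_def block_mat_def binomial_entry_def)
  qed
  have "?A ^\<^sub>m N = 0\<^sub>m N N"
    by (rule eq_matI) (use strictly_upper_power[OF A upper] pow_carrier_mat[OF A] in auto)
  then show ?thesis unfolding Uni_def by auto
qed

text \<open>The right-hand side has the shape of \<open>E_transformation\<close> at each cusp. Since
  the orders m - i1 and n - i2 decrease along the vector, terms of lower order stand to the right of
  the diagonal.\<close>

lemma rep_mat_vec:
  "rep_mat c a b *\<^sub>v Matrix.vec N (\<lambda>k. V (cusp_index k) (m - i1 k) (n - i2 k)) =
   Matrix.vec N (\<lambda>k. \<Sum>p\<le>m - i1 k. \<Sum>q\<le>n - i2 k. c *
     (of_nat ((m - i1 k) choose p) * a ^ p) * (of_nat ((n - i2 k) choose q) * b ^ q) *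
     V (cusp_index k) (m - i1 k - p) (n - i2 k - q))"
proof (rule eq_vecI)
  fix x assume "x < dim_vec (Matrix.vec N (\<lambda>k. \<Sum>p\<le>m - i1 k. \<Sum>q\<le>n - i2 k. c *
     (of_nat ((m - i1 k) choose p) * a ^ p) * (of_nat ((n - i2 k) choose q) * b ^ q) *
     V (cusp_index k) (m - i1 k - p) (n - i2 k - q)))"
  then have x: "x < N" by simp
  note bx = index_bounds[OF x]
  define B where "B = binomial_entry m a (i1 x)"
  define B' where "B' = binomial_entry n b (i2 x)"
  define W where "W = V (cusp_index x)"
  have "vec_index (rep_mat c a b *\<^sub>v Matrix.vec N (\<lambda>k. V (cusp_index k) (m - i1 k) (n - i2 k))) x
      = (\<Sum>k<N. c * B (i1 k) * B' (i2 k) * (if cusp_index x = cusp_index k then 1 else 0)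
          * V (cusp_index k) (m - i1 k) (n - i2 k))"
    using x by (simp add: rep_mat_def block_mat_def scalar_prod_def atLeast0LessThan B_def B'_def)
  also have "\<dots> = (\<Sum>k<m+1. \<Sum>l<n+1. \<Sum>j<r. c * B k * B' l * (if cusp_index x = j then 1 else 0)
          * V j (m - k) (n - l))"
    by (rule index_sum)
  also have "\<dots> = (\<Sum>k<m+1. \<Sum>l<n+1. c * B k * B' l * W (m - k) (n - l))"
    using bx(3) by (simp add: W_def if_distrib[of "\<lambda>u. _ * u * _"] if_distrib[of "\<lambda>u. u * _"] sum.delta cong: if_cong del: sum.lessThan_Suc)
  also have "\<dots> = (\<Sum>k<m+1. B k * (\<Sum>l<n+1. B' l * (c * W (m - k) (n - l))))"
    unfolding sum_distrib_left by (intro sum.cong refl) (simp add: mult_ac)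
  also have "\<dots> = (\<Sum>k<m+1. B k * (\<Sum>q\<le>n - i2 x. of_nat ((n - i2 x) choose q) * b ^ q * (c * W (m - k) (n - i2 x - q))))"
    unfolding B'_def binomial_entry_sum[OF bx(2), of b "\<lambda>t. c * W _ t"] ..
  also have "\<dots> = (\<Sum>p\<le>m - i1 x. of_nat ((m - i1 x) choose p) * a ^ p *
      (\<Sum>q\<le>n - i2 x. of_nat ((n - i2 x) choose q) * b ^ q * (c * W (m - i1 x - p) (n - i2 x - q))))"
    unfolding B_def
    by (rule binomial_entry_sum[OF bx(1), of a "\<lambda>t. \<Sum>q\<le>n - i2 x. of_nat ((n - i2 x) choose q) * b ^ q * (c * W t (n - i2 x - q))"])
  also have "\<dots> = (\<Sum>p\<le>m - i1 x. \<Sum>q\<le>n - i2 x. c *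
     (of_nat ((m - i1 x) choose p) * a ^ p) * (of_nat ((n - i2 x) choose q) * b ^ q) *
     V (cusp_index x) (m - i1 x - p) (n - i2 x - q))"
    unfolding sum_distrib_left W_def by (intro sum.cong refl) (simp add: mult_ac)
  finally show "vec_index (rep_mat c a b *\<^sub>v Matrix.vec N (\<lambda>k. V (cusp_index k) (m - i1 k) (n - i2 k))) x
    = vec_index (Matrix.vec N (\<lambda>k. \<Sum>p\<le>m - i1 k. \<Sum>q\<le>n - i2 k. c *
     (of_nat ((m - i1 k) choose p) * a ^ p) * (of_nat ((n - i2 k) choose q) * b ^ q) *
     V (cusp_index k) (m - i1 k - p) (n - i2 k - q))) x"
    using x by simp
qed (simp add: rep_mat_def block_mat_def)

end

section \<open>The representation and the eigenvalue equation for the full vector\<close>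

theorem theorem2p1:
  fixes \<Gamma> :: "(real^2^2) set"
    and r :: nat
    and \<aa> :: "nat \<Rightarrow> csphere"
    and \<sigma> :: "nat \<Rightarrow> real^2^2"
    and chi :: "real^2^2 \<Rightarrow> complex"
    and f g :: "complex \<Rightarrow> complex"
    and m n N :: nat
  assumes "fuchsian_first_kind \<Gamma>"
    and "finite_covolume \<Gamma>"
    and "noncompact_quotient \<Gamma>"
    and "cusp_representatives \<Gamma> r \<aa>"
    and "\<And>j. j < r \<Longrightarrow> scaling_matrix \<Gamma> (\<aa> j) (\<sigma> j)"
    and "cuspidal_unitary_character \<Gamma> chi"
    and "cusp_form2 \<Gamma> f"
    and "cusp_form2 \<Gamma> g"
    and "N = r * (m + 1) * (n + 1)"
  shows "(\<exists>\<pi>. gl_representation \<Gamma> N \<pi>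
             \<and> (\<forall>\<gamma>\<in>\<Gamma>. chi \<gamma> \<cdot>\<^sub>m \<pi> \<gamma> \<in> Uni N)
             \<and> (\<forall>\<gamma>\<in>\<Gamma>. \<forall>z\<in>upper_half. \<forall>s. Re s > 1 \<longrightarrow>
                  eisenstein_vec \<Gamma> chi f g r \<aa> \<sigma> m n (moebius_act \<gamma> z) s
                    = \<pi> \<gamma> *\<^sub>v eisenstein_vec \<Gamma> chi f g r \<aa> \<sigma> m n z s))
       \<and> (\<forall>s. Re s > 1 \<longrightarrow>
            (\<forall>k<N. laplacian_defined
               (\<lambda>z. vec_index (eisenstein_vec \<Gamma> chi f g r \<aa> \<sigma> m n z s) k))
            \<and> (\<forall>z\<in>upper_half.
                 Matrix.vec N (\<lambda>k. hyp_laplacian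
                   (\<lambda>w. vec_index (eisenstein_vec \<Gamma> chi f g r \<aa> \<sigma> m n w s) k) z)
                 = (s * (1 - s)) \<cdot>\<^sub>v eisenstein_vec \<Gamma> chi f g r \<aa> \<sigma> m n z s))"
proof -
  interpret B: block_index r m n .
  have N: "N = B.N" using assms(9) by (simp add: B.N_def algebra_simps)
  have subgroup: "subgroup \<Gamma> SL2R" and discrete: "discrete \<Gamma>"
    using assms(1) by (simp_all add: fuchsian_first_kind_def)
  have sub: "\<Gamma> \<subseteq> carrier SL2R" by (rule subgroup.subset[OF subgroup])
  have det: "det \<gamma> = 1" if "\<gamma> \<in> \<Gamma>" for \<gamma> using sub that by auto
  have mult: "\<gamma> ** \<delta> \<in> \<Gamma>" if "\<gamma> \<in> \<Gamma>" "\<delta> \<in> \<Gamma>" for \<gamma> \<delta>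
    using subgroup.m_closed[OF subgroup] that by simp
  have inv: "SL_inv \<gamma> \<in> \<Gamma>" if "\<gamma> \<in> \<Gamma>" for \<gamma>
    using subgroup.m_inv_closed[OF subgroup] that by simp
  have one: "Finite_Cartesian_Product.mat 1 \<in> \<Gamma>"
    using subgroup.one_closed[OF subgroup] by simp
  have chi: "chi (\<gamma> ** \<delta>) = chi \<gamma> * chi \<delta>" "chi \<gamma> \<noteq> 0" if "\<gamma> \<in> \<Gamma>" "\<delta> \<in> \<Gamma>" for \<gamma> \<delta>
    using assms(6) that by (auto simp: cuspidal_unitary_character_def)
  have bounded: "\<exists>C. \<forall>z\<in>upper_half. Im z * cmod (u z) \<le> C" if "cusp_form2 \<Gamma> u" for u
    by (rule cusp_form2_bounded[OF assms(1) that]) blast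
  have cusp: "eisenstein_cusp \<Gamma> (\<aa> j) (\<sigma> j) chi f g" if "j < r" for j
  proof (intro eisenstein_cusp.intro scaled_cusp.intro eisenstein_cusp_axioms.intro)
    show "\<aa> j \<in> cusps \<Gamma>"
      using assms(4) that by (simp add: cusp_representatives_def)
  qed (fact subgroup discrete assms(5)[OF that] assms(6-8) bounded[OF assms(7)] bounded[OF assms(8)])+
  define V where "V s z j i l = eisenstein \<Gamma> chi f g (\<aa> j) (\<sigma> j) i l z s" for s z j i l
  have ev: "eisenstein_vec \<Gamma> chi f g r \<aa> \<sigma> m n z s =
      Matrix.vec B.N (\<lambda>k. V s z (B.cusp_index k) (m - B.i1 k) (n - B.i2 k))" for z s
    by (rule eq_vecI) (simp_all add: V_def B.eisenstein_vec_index dim_eisenstein_vec assms(9) flip: N)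
  \<comment> \<open>The inverse and the minus signs are the character and the modular symbols of
    \<gamma>^-1, which enter through the substitution in the series.\<close>
  define \<pi> where "\<pi> \<gamma> = B.rep_mat (inverse (chi \<gamma>)) (- modular_symbol \<gamma> f) (- cnj (modular_symbol \<gamma> g))" for \<gamma>
  have \<pi>_mult: "\<pi> (\<gamma> ** \<delta>) = \<pi> \<gamma> * \<pi> \<delta>" if "\<gamma> \<in> \<Gamma>" "\<delta> \<in> \<Gamma>" for \<gamma> \<delta>
    using that assms(7,8) sub
    by (simp add: \<pi>_def B.rep_mat_mult chi modular_symbol_mult[OF sub] mult)
  have "modular_symbol (Finite_Cartesian_Product.mat 1) u = 0" if "cusp_form2 \<Gamma> u" for u
    using modular_symbol_mult[OF sub that one one] one by simp
  then have \<pi>_one: "\<pi> (Finite_Cartesian_Product.mat 1) = 1\<^sub>m N"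
    using assms(7,8) unitary_character_one[OF subgroup assms(6)]
    by (simp add: \<pi>_def B.rep_mat_one N)
  have \<pi>_carrier: "\<pi> \<gamma> \<in> carrier_mat N N" for \<gamma>
    by (simp add: \<pi>_def N)
  have \<pi>_unit: "\<pi> \<gamma> \<in> Units (ring_mat TYPE(complex) N ())" if "\<gamma> \<in> \<Gamma>" for \<gamma>
  proof -
    have "\<pi> (SL_inv \<gamma>) * \<pi> \<gamma> = 1\<^sub>m N" "\<pi> \<gamma> * \<pi> (SL_inv \<gamma>) = 1\<^sub>m N"
      using that by (simp_all add: \<pi>_one inv det flip: \<pi>_mult)
    then show ?thesis
      using \<pi>_carrier by (auto simp: Units_def ring_mat_def)
  qed
  have rep: "gl_representation \<Gamma> N \<pi>"
    unfolding gl_representation_def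
    by (rule homI) (simp_all add: units_of_def \<pi>_unit \<pi>_mult ring_mat_simps)
  have uni: "chi \<gamma> \<cdot>\<^sub>m \<pi> \<gamma> \<in> Uni N" if "\<gamma> \<in> \<Gamma>" for \<gamma>
  proof -
    \<comment> \<open>Multiplication by chi \<gamma> cancels the scalar and leaves the triangular
      Kronecker product with ones on the diagonal.\<close>
    have "chi \<gamma> \<cdot>\<^sub>m \<pi> \<gamma> = B.rep_mat 1 (- modular_symbol \<gamma> f) (- cnj (modular_symbol \<gamma> g))"
      using chi(2)[OF that that] by (intro eq_matI) (auto simp: \<pi>_def B.rep_mat_def B.block_mat_def)
    then show ?thesis using B.rep_mat_Uni by (simp add: N)
  qed
  have transform: "eisenstein_vec \<Gamma> chi f g r \<aa> \<sigma> m n (moebius_act \<gamma> z) s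
      = \<pi> \<gamma> *\<^sub>v eisenstein_vec \<Gamma> chi f g r \<aa> \<sigma> m n z s"
    if \<gamma>: "\<gamma> \<in> \<Gamma>" and z: "z \<in> upper_half" and s: "Re s > 1" for \<gamma> z s
    unfolding ev \<pi>_def B.rep_mat_vec
  proof (rule eq_vecI)
    fix k assume "k < dim_vec (Matrix.vec B.N (\<lambda>k. \<Sum>p\<le>m - B.i1 k. \<Sum>q\<le>n - B.i2 k. inverse (chi \<gamma>) *
      (of_nat ((m - B.i1 k) choose p) * (- modular_symbol \<gamma> f) ^ p) *
      (of_nat ((n - B.i2 k) choose q) * (- cnj (modular_symbol \<gamma> g)) ^ q) *
      V s z (B.cusp_index k) (m - B.i1 k - p) (n - B.i2 k - q)))"
    then have k: "k < B.N" by simp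
    interpret eisenstein_cusp \<Gamma> "\<aa> (B.cusp_index k)" "\<sigma> (B.cusp_index k)" chi f g
      by (rule cusp[OF B.index_bounds(3)[OF k]])
    have "moebius_act \<gamma> z \<in> upper_half" using \<gamma> z by (intro moebius_upper_half det)
    then show "vec_index (Matrix.vec B.N (\<lambda>k. V s (moebius_act \<gamma> z) (B.cusp_index k) (m - B.i1 k) (n - B.i2 k))) k
      = vec_index (Matrix.vec B.N (\<lambda>k. \<Sum>p\<le>m - B.i1 k. \<Sum>q\<le>n - B.i2 k. inverse (chi \<gamma>) *
      (of_nat ((m - B.i1 k) choose p) * (- modular_symbol \<gamma> f) ^ p) *
      (of_nat ((n - B.i2 k) choose q) * (- cnj (modular_symbol \<gamma> g)) ^ q) *
      V s z (B.cusp_index k) (m - B.i1 k - p) (n - B.i2 k - q))) k"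
      using k by (simp add: V_def eisenstein_eq z E_transformation[OF s \<gamma> z])
  qed simp
  have index: "(\<lambda>w. vec_index (eisenstein_vec \<Gamma> chi f g r \<aa> \<sigma> m n w s) k)
      = (\<lambda>w. eisenstein \<Gamma> chi f g (\<aa> (B.cusp_index k)) (\<sigma> (B.cusp_index k)) (m - B.i1 k) (n - B.i2 k) w s)"
    if "k < N" for k s
    using that by (simp add: B.eisenstein_vec_index N)
  have defined: "laplacian_defined (\<lambda>z. vec_index (eisenstein_vec \<Gamma> chi f g r \<aa> \<sigma> m n z s) k)"
    if "Re s > 1" "k < N" for s k
    unfolding index[OF that(2)]
    using that eisenstein_cusp.laplacian_defined_eisenstein[OF cusp] B.index_bounds(3) by (simp add: N)
  have laplacian: "Matrix.vec N (\<lambda>k. hyp_laplacian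
        (\<lambda>w. vec_index (eisenstein_vec \<Gamma> chi f g r \<aa> \<sigma> m n w s) k) z)
      = (s * (1 - s)) \<cdot>\<^sub>v eisenstein_vec \<Gamma> chi f g r \<aa> \<sigma> m n z s"
    if s: "Re s > 1" and z: "z \<in> upper_half" for s z
  proof (rule eq_vecI)
    show "dim_vec (Matrix.vec N (\<lambda>k. hyp_laplacian
        (\<lambda>w. vec_index (eisenstein_vec \<Gamma> chi f g r \<aa> \<sigma> m n w s) k) z))
      = dim_vec ((s * (1 - s)) \<cdot>\<^sub>v eisenstein_vec \<Gamma> chi f g r \<aa> \<sigma> m n z s)"
      by (simp add: ev N)
    fix k assume "k < dim_vec ((s * (1 - s)) \<cdot>\<^sub>v eisenstein_vec \<Gamma> chi f g r \<aa> \<sigma> m n z s)"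
    then have k: "k < N" by (simp add: ev N)
    then have j: "B.cusp_index k < r" by (simp add: N B.index_bounds)
    have "hyp_laplacian (\<lambda>w. vec_index (eisenstein_vec \<Gamma> chi f g r \<aa> \<sigma> m n w s) k) z
        = s * (1 - s) * vec_index (eisenstein_vec \<Gamma> chi f g r \<aa> \<sigma> m n z s) k"
      unfolding index[OF k] eisenstein_cusp.hyp_laplacian_eisenstein[OF cusp[OF j] s z]
      using k by (simp add: B.eisenstein_vec_index N)
    then show "vec_index (Matrix.vec N (\<lambda>k. hyp_laplacian
        (\<lambda>w. vec_index (eisenstein_vec \<Gamma> chi f g r \<aa> \<sigma> m n w s) k) z)) k
      = vec_index ((s * (1 - s)) \<cdot>\<^sub>v eisenstein_vec \<Gamma> chi f g r \<aa> \<sigma> m n z s) k"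
      using k by (simp add: ev N)
  qed
  show ?thesis
    using rep uni transform defined laplacian by blast
qed

end
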